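(* Let $A$ be a separable unital $C^*$-algebra with a dense unital $*$-subalgebra $\mathcal{A}$ and a lower semicontinuous Lipschitz seminorm $L:\mathcal{A}\to\mathbb{R}_+$ (in particular, $\mathcal{A}$ may be the Lipschitz algebra $\mathcal{C}^1(A)$ of a spectral triple on $A$, with its induced seminorm) such that $(A,L)$ is a compact quantum metric space. Let $\Gamma$ be a discrete group and let $\alpha:\Gamma\to\mathrm{Aut}(A)$ be a smooth action. Consider the following statements: (i) $\alpha$ is metrically equicontinuous on $(A,L)$; (ii) there exist a Lipschitz seminorm $L'$ on $\mathcal{A}$ for which $\alpha$ is isometric and a constant $C>0$ such that $L(a)\le L'(a)\le CL(a)$ for all $a\in\mathcal{A}$; (iii) there exists an $\hat\alpha$-invariant metric $d$ on $S(A)$ which is equivalent to $d_L$. Then (ii)$\Rightarrow$(iii)$\Rightarrow$(i) in general, and in the case that $L$ is closed one additionally has (i)$\Rightarrow$(ii).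
   Context: A Lipschitz seminorm on a dense subspace $\mathcal{A}\ni1$ of a unital $C^*$-algebra $A$ is a seminorm $L:\mathcal{A}\to\mathbb{R}_+$ with $L(1)=0$. It is lower semicontinuous (respectively closed) if $\{a\in\mathcal{A}:L(a)\le r\}$ is norm closed in $\mathcal{A}$ (respectively in $A$) for some, hence all, $r>0$. It induces the pseudometric $$d_L(\omega_1,\omega_2)=\sup\{|\omega_1(a)-\omega_2(a)|:a\in\mathcal{A},\ L(a)\le1\}$$ on the state space $S(A)$. The pair $(A,L)$ is a compact quantum metric space if $d_L$ is a metric inducing the weak-$*$ topology on $S(A)$. For a spectral triple on $A$ given by a representation $\pi$ of $A$ on a Hilbert space $\mathsf{H}$ and a Dirac operator $D$ on $\mathsf{H}$ (densely defined, self-adjoint, with $(1+D^2)^{-1/2}$ compact, and such that $\pi(a)$ preserves the domain of $D$ and $[D,\pi(a)]$ is bounded for all $a$ in a dense $*$-subalgebra of $A$), the Lipschitz algebra $\mathcal{C}^1(A)$ is the set of all $a\in A$ such that $\pi(a)$ leaves the domain of $D$ invariant and $[D,\pi(a)]$ is bounded; the induced seminorm is $L_D(a)=\|[D,\pi(a)]\|$. An action $\alpha:\Gamma\to\mathrm{Aut}(A)$ is smooth if each $\alpha_g$ leaves $\mathcal{A}$ globally invariant; it is metrically equicontinuous on $(A,L)$ if it is smooth and $\sup_{g\in\Gamma}L(\alpha_g(a))<\infty$ for all $a\in\mathcal{A}$; it is isometric for a Lipschitz seminorm $L'$ on $\mathcal{A}$ if it is smooth and $L'(\alpha_g(a))=L'(a)$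 for all $a\in\mathcal{A}$, $g\in\Gamma$. The induced action $\hat\alpha$ of $\Gamma$ on $S(A)$ is $\hat\alpha_g(\phi)=\phi\circ\alpha_{g^{-1}}$. Two metrics $d,d'$ on a set are equivalent if there is $C>0$ with $\frac1Cd\le d'\le Cd$ pointwise.
   Formalization: The implication (iii)⇒(i) is proved under the additional assumption L(a* )=L(a) for all a in 𝒜 (automatic for the seminorm of a spectral triple); for Lipschitz seminorms without this symmetry it can fail. *)

theory Defs
  imports "HOL-Analysis.Analysis" "HOL-Algebra.Group"
begin

section \<open>Complex Banach spaces, Hilbert spaces and unital C*-algebras\<close>

class complex_banach = banach +
  fixes scaleC :: "complex \<Rightarrow> 'a \<Rightarrow> 'a" (infixr \<open>*\<^sub>C\<close> 75)
  assumes scaleC_add_right: "c *\<^sub>C (x + y) = c *\<^sub>C x + c *\<^sub>C y"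
    and scaleC_add_left: "(c + d) *\<^sub>C x = c *\<^sub>C x + d *\<^sub>C x"
    and scaleC_scaleC: "c *\<^sub>C (d *\<^sub>C x) = (c * d) *\<^sub>C x"
    and scaleC_of_real: "complex_of_real r *\<^sub>C x = r *\<^sub>R x"
    and norm_scaleC: "norm (c *\<^sub>C x) = cmod c * norm x"

text \<open>The inner product is linear in the first variable; positive definiteness is contained
  in the last axiom.\<close>

class complex_hilbert = complex_banach +
  fixes cinner :: "'a \<Rightarrow> 'a \<Rightarrow> complex"
  assumes cinner_commute: "cinner x y = cnj (cinner y x)"
    and cinner_add_left: "cinner (x + y) z = cinner x z + cinner y z"
    and cinner_scaleC_left: "cinner (c *\<^sub>C x) y = c * cinner x y"
    and cinner_self: "cinner x x = complex_of_real ((norm x)\<^sup>2)"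

text \<open>Unital C*-algebras. As is customary the unit is nonzero, so that \<open>norm 1 = 1\<close>.\<close>

class unital_cstar_algebra = real_normed_algebra_1 + complex_banach +
  fixes star :: "'a \<Rightarrow> 'a"
  assumes scaleC_mult_left: "(c *\<^sub>C x) * y = c *\<^sub>C (x * y)"
    and scaleC_mult_right: "x * (c *\<^sub>C y) = c *\<^sub>C (x * y)"
    and star_star: "star (star x) = x"
    and star_add: "star (x + y) = star x + star y"
    and star_scaleC: "star (c *\<^sub>C x) = cnj c *\<^sub>C star x"
    and star_mult: "star (x * y) = star y * star x"
    and cstar_identity: "norm (star x * x) = (norm x)\<^sup>2"

definition complex_linear :: "('a::complex_banach \<Rightarrow> 'b::complex_banach) \<Rightarrow> bool" where
  "complex_linear f \<longleftrightarrow>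
     (\<forall>x y. f (x + y) = f x + f y) \<and> (\<forall>c x. f (c *\<^sub>C x) = c *\<^sub>C f x)"

definition star_subalgebra :: "'a::unital_cstar_algebra set \<Rightarrow> bool" where
  "star_subalgebra B \<longleftrightarrow>
     0 \<in> B \<and> (\<forall>a\<in>B. \<forall>b\<in>B. a + b \<in> B \<and> a * b \<in> B) \<and>
     (\<forall>c. \<forall>a\<in>B. c *\<^sub>C a \<in> B) \<and> (\<forall>a\<in>B. star a \<in> B)"

definition dense_star_subalgebra :: "'a::unital_cstar_algebra set \<Rightarrow> bool" where
  "dense_star_subalgebra B \<longleftrightarrow> star_subalgebra B \<and> closure B = UNIV"

definition dense_unital_star_subalgebra :: "'a::unital_cstar_algebra set \<Rightarrow> bool" where
  "dense_unital_star_subalgebra B \<longleftrightarrow> dense_star_subalgebra B \<and> 1 \<in> B"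

definition star_automorphism :: "('a::unital_cstar_algebra \<Rightarrow> 'a) \<Rightarrow> bool" where
  "star_automorphism f \<longleftrightarrow>
     bij f \<and> complex_linear f \<and> (\<forall>a b. f (a * b) = f a * f b) \<and> (\<forall>a. f (star a) = star (f a))"

section \<open>States and the metric induced by a Lipschitz seminorm\<close>

definition state_space :: "('a::unital_cstar_algebra \<Rightarrow> complex) set" where
  "state_space = {\<omega>. (\<forall>a b. \<omega> (a + b) = \<omega> a + \<omega> b) \<and> (\<forall>c a. \<omega> (c *\<^sub>C a) = c * \<omega> a) \<and>
     (\<forall>a. \<omega> (star a * a) \<in> \<real>\<^sub>\<ge>\<^sub>0) \<and> \<omega> 1 = 1}"

text \<open>The library topology on a function type is the product topology, that is, the topology of
  pointwise convergence; its restriction to the states is the weak-* topology.\<close>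

definition weak_star_topology :: "('a::unital_cstar_algebra \<Rightarrow> complex) topology" where
  "weak_star_topology = subtopology euclidean state_space"

text \<open>Seminorms live on a subspace \<open>\<A>\<close>; the values of \<open>L\<close> outside \<open>\<A>\<close> are irrelevant.\<close>

definition lipschitz_seminorm ::
    "'a::unital_cstar_algebra set \<Rightarrow> ('a \<Rightarrow> real) \<Rightarrow> bool" where
  "lipschitz_seminorm \<A> L \<longleftrightarrow>
     (\<forall>a\<in>\<A>. 0 \<le> L a) \<and> (\<forall>a\<in>\<A>. \<forall>b\<in>\<A>. L (a + b) \<le> L a + L b) \<and>
     (\<forall>c. \<forall>a\<in>\<A>. L (c *\<^sub>C a) = cmod c * L a) \<and> L 1 = 0"

definition lsc_seminorm :: "'a::unital_cstar_algebra set \<Rightarrow> ('a \<Rightarrow> real) \<Rightarrow> bool" where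
  "lsc_seminorm \<A> L \<longleftrightarrow> (\<exists>r>0. closedin (top_of_set \<A>) {a\<in>\<A>. L a \<le> r})"

definition closed_seminorm :: "'a::unital_cstar_algebra set \<Rightarrow> ('a \<Rightarrow> real) \<Rightarrow> bool" where
  "closed_seminorm \<A> L \<longleftrightarrow> (\<exists>r>0. closed {a\<in>\<A>. L a \<le> r})"

text \<open>Lipschitz seminorms are not required to satisfy \<open>L (star a) = L a\<close>. Since \<open>dist_L\<close> below
  only sees the real parts \<open>(a + star a) / 2\<close> of the elements \<open>a\<close> with \<open>L a \<le> 1\<close>, it does not
  control a seminorm without this symmetry. The seminorm of a spectral triple always has it.\<close>

definition star_invariant_seminorm ::
    "'a::unital_cstar_algebra set \<Rightarrow> ('a \<Rightarrow> real) \<Rightarrow> bool" where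
  "star_invariant_seminorm \<A> L \<longleftrightarrow> (\<forall>a\<in>\<A>. L (star a) = L a)"

definition edist_L :: "'a::unital_cstar_algebra set \<Rightarrow> ('a \<Rightarrow> real) \<Rightarrow>
    ('a \<Rightarrow> complex) \<Rightarrow> ('a \<Rightarrow> complex) \<Rightarrow> ennreal" where
  "edist_L \<A> L \<omega>\<^sub>1 \<omega>\<^sub>2 = (SUP a\<in>{a\<in>\<A>. L a \<le> 1}. ennreal (cmod (\<omega>\<^sub>1 a - \<omega>\<^sub>2 a)))"

text \<open>The supremum may be infinite, and \<open>enn2real \<infinity> = 0\<close>; \<open>dist_L\<close> is meaningful only in the
  presence of the finiteness condition included in \<open>compact_quantum_metric_space\<close>.\<close>

definition dist_L :: "'a::unital_cstar_algebra set \<Rightarrow> ('a \<Rightarrow> real) \<Rightarrow>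
    ('a \<Rightarrow> complex) \<Rightarrow> ('a \<Rightarrow> complex) \<Rightarrow> real" where
  "dist_L \<A> L \<omega>\<^sub>1 \<omega>\<^sub>2 = enn2real (edist_L \<A> L \<omega>\<^sub>1 \<omega>\<^sub>2)"

definition compact_quantum_metric_space ::
    "'a::unital_cstar_algebra set \<Rightarrow> ('a \<Rightarrow> real) \<Rightarrow> bool" where
  "compact_quantum_metric_space \<A> L \<longleftrightarrow>
     (\<forall>\<omega>\<^sub>1\<in>state_space. \<forall>\<omega>\<^sub>2\<in>state_space. edist_L \<A> L \<omega>\<^sub>1 \<omega>\<^sub>2 < \<infinity>) \<and>
     Metric_space state_space (dist_L \<A> L) \<and>
     Metric_space.mtopology state_space (dist_L \<A> L) = weak_star_topology"

definition equivalent_metrics :: "'s set \<Rightarrow> ('s \<Rightarrow> 's \<Rightarrow> real) \<Rightarrow> ('s \<Rightarrow> 's \<Rightarrow> real) \<Rightarrow> bool" where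
  "equivalent_metrics S d d' \<longleftrightarrow>
     (\<exists>C>0. \<forall>x\<in>S. \<forall>y\<in>S. 1 / C * d x y \<le> d' x y \<and> d' x y \<le> C * d x y)"

section \<open>Actions\<close>

definition cstar_action ::
    "('g, 'm) monoid_scheme \<Rightarrow> ('g \<Rightarrow> 'a::unital_cstar_algebra \<Rightarrow> 'a) \<Rightarrow> bool" where
  "cstar_action \<Gamma> \<alpha> \<longleftrightarrow>
     (\<forall>g\<in>carrier \<Gamma>. star_automorphism (\<alpha> g)) \<and>
     (\<forall>g\<in>carrier \<Gamma>. \<forall>h\<in>carrier \<Gamma>. \<alpha> (g \<otimes>\<^bsub>\<Gamma>\<^esub> h) = \<alpha> g \<circ> \<alpha> h)"

definition smooth_action ::
    "('g, 'm) monoid_scheme \<Rightarrow> ('g \<Rightarrow> 'a \<Rightarrow> 'a) \<Rightarrow> 'a::unital_cstar_algebra set \<Rightarrow> bool" where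
  "smooth_action \<Gamma> \<alpha> \<A> \<longleftrightarrow> (\<forall>g\<in>carrier \<Gamma>. \<alpha> g ` \<A> = \<A>)"

definition metrically_equicontinuous ::
    "('g, 'm) monoid_scheme \<Rightarrow> ('g \<Rightarrow> 'a \<Rightarrow> 'a) \<Rightarrow> 'a::unital_cstar_algebra set \<Rightarrow>
     ('a \<Rightarrow> real) \<Rightarrow> bool" where
  "metrically_equicontinuous \<Gamma> \<alpha> \<A> L \<longleftrightarrow>
     smooth_action \<Gamma> \<alpha> \<A> \<and> (\<forall>a\<in>\<A>. bdd_above ((\<lambda>g. L (\<alpha> g a)) ` carrier \<Gamma>))"

definition isometric_action ::
    "('g, 'm) monoid_scheme \<Rightarrow> ('g \<Rightarrow> 'a \<Rightarrow> 'a) \<Rightarrow> 'a::unital_cstar_algebra set \<Rightarrow>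
     ('a \<Rightarrow> real) \<Rightarrow> bool" where
  "isometric_action \<Gamma> \<alpha> \<A> L \<longleftrightarrow>
     smooth_action \<Gamma> \<alpha> \<A> \<and> (\<forall>g\<in>carrier \<Gamma>. \<forall>a\<in>\<A>. L (\<alpha> g a) = L a)"

definition dual_action ::
    "('g, 'm) monoid_scheme \<Rightarrow> ('g \<Rightarrow> 'a \<Rightarrow> 'a) \<Rightarrow> 'g \<Rightarrow> ('a \<Rightarrow> complex) \<Rightarrow> ('a \<Rightarrow> complex)" where
  "dual_action \<Gamma> \<alpha> g \<phi> = \<phi> \<circ> \<alpha> (inv\<^bsub>\<Gamma>\<^esub> g)"

definition has_equivalent_isometric_seminorm ::
    "('g, 'm) monoid_scheme \<Rightarrow> ('g \<Rightarrow> 'a \<Rightarrow> 'a) \<Rightarrow> 'a::unital_cstar_algebra set \<Rightarrow>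
     ('a \<Rightarrow> real) \<Rightarrow> bool" where
  "has_equivalent_isometric_seminorm \<Gamma> \<alpha> \<A> L \<longleftrightarrow>
     (\<exists>L' C. lipschitz_seminorm \<A> L' \<and> isometric_action \<Gamma> \<alpha> \<A> L' \<and> C > 0 \<and>
        (\<forall>a\<in>\<A>. L a \<le> L' a \<and> L' a \<le> C * L a))"

definition has_equivalent_invariant_metric ::
    "('g, 'm) monoid_scheme \<Rightarrow> ('g \<Rightarrow> 'a \<Rightarrow> 'a) \<Rightarrow> 'a::unital_cstar_algebra set \<Rightarrow>
     ('a \<Rightarrow> real) \<Rightarrow> bool" where
  "has_equivalent_invariant_metric \<Gamma> \<alpha> \<A> L \<longleftrightarrow>
     (\<exists>d. Metric_space state_space d \<and>
        (\<forall>g\<in>carrier \<Gamma>. \<forall>\<phi>\<in>state_space. \<forall>\<psi>\<in>state_space.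
           d (dual_action \<Gamma> \<alpha> g \<phi>) (dual_action \<Gamma> \<alpha> g \<psi>) = d \<phi> \<psi>) \<and>
        equivalent_metrics state_space (dist_L \<A> L) d)"

section \<open>Spectral triples\<close>

text \<open>Representations of unital algebras are unital.\<close>

definition representation ::
    "('a::unital_cstar_algebra \<Rightarrow> 'h::complex_hilbert \<Rightarrow> 'h) \<Rightarrow> bool" where
  "representation \<pi> \<longleftrightarrow>
     (\<forall>a. complex_linear (\<pi> a) \<and> bounded_linear (\<pi> a)) \<and>
     (\<forall>a b \<xi>. \<pi> (a + b) \<xi> = \<pi> a \<xi> + \<pi> b \<xi>) \<and> (\<forall>c a \<xi>. \<pi> (c *\<^sub>C a) \<xi> = c *\<^sub>C \<pi> a \<xi>) \<and>
     (\<forall>a b. \<pi> (a * b) = \<pi> a \<circ> \<pi> b) \<and> \<pi> 1 = id \<and>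
     (\<forall>a \<xi> \<eta>. cinner (\<pi> (star a) \<xi>) \<eta> = cinner \<xi> (\<pi> a \<eta>))"

text \<open>An unbounded operator is a function \<open>D\<close> together with its domain \<open>V\<close>; the values of \<open>D\<close>
  outside \<open>V\<close> are irrelevant.\<close>

definition densely_defined_operator ::
    "'h::complex_hilbert set \<Rightarrow> ('h \<Rightarrow> 'h) \<Rightarrow> bool" where
  "densely_defined_operator V D \<longleftrightarrow>
     0 \<in> V \<and> (\<forall>\<xi>\<in>V. \<forall>\<eta>\<in>V. \<xi> + \<eta> \<in> V \<and> D (\<xi> + \<eta>) = D \<xi> + D \<eta>) \<and>
     (\<forall>c. \<forall>\<xi>\<in>V. c *\<^sub>C \<xi> \<in> V \<and> D (c *\<^sub>C \<xi>) = c *\<^sub>C D \<xi>) \<and> closure V = UNIV"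

text \<open>The right-hand side says that \<open>(\<eta>, \<zeta>)\<close> lies in the graph of the adjoint of \<open>D\<close>.\<close>

definition self_adjoint_operator :: "'h::complex_hilbert set \<Rightarrow> ('h \<Rightarrow> 'h) \<Rightarrow> bool" where
  "self_adjoint_operator V D \<longleftrightarrow> densely_defined_operator V D \<and>
     (\<forall>\<eta> \<zeta>. \<eta> \<in> V \<and> \<zeta> = D \<eta> \<longleftrightarrow> (\<forall>\<xi>\<in>V. cinner (D \<xi>) \<eta> = cinner \<xi> \<zeta>))"

definition inverse_one_plus_square ::
    "'h::complex_hilbert set \<Rightarrow> ('h \<Rightarrow> 'h) \<Rightarrow> ('h \<Rightarrow> 'h) \<Rightarrow> bool" where
  "inverse_one_plus_square V D R \<longleftrightarrow>
     (\<forall>\<xi>. R \<xi> \<in> V \<and> D (R \<xi>) \<in> V \<and> R \<xi> + D (D (R \<xi>)) = \<xi>) \<and>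
     (\<forall>\<xi>\<in>V. D \<xi> \<in> V \<longrightarrow> R (\<xi> + D (D \<xi>)) = \<xi>)"

text \<open>\<open>(1 + D\<^sup>2)\<^bsup>-1/2\<^esup>\<close> is the positive square root \<open>T\<close> of the bounded operator
  \<open>(1 + D\<^sup>2)\<^bsup>-1\<^esup>\<close>.\<close>

definition compact_inverse_sqrt ::
    "'h::complex_hilbert set \<Rightarrow> ('h \<Rightarrow> 'h) \<Rightarrow> bool" where
  "compact_inverse_sqrt V D \<longleftrightarrow>
     (\<exists>T. complex_linear T \<and> bounded_linear T \<and> (\<forall>\<xi>. cinner (T \<xi>) \<xi> \<in> \<real>\<^sub>\<ge>\<^sub>0) \<and>
        inverse_one_plus_square V D (T \<circ> T) \<and> compact (closure (T ` cball 0 1)))"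

definition commutator :: "('h::complex_hilbert \<Rightarrow> 'h) \<Rightarrow> ('h \<Rightarrow> 'h) \<Rightarrow> 'h \<Rightarrow> 'h" where
  "commutator D T \<xi> = D (T \<xi>) - T (D \<xi>)"

definition lipschitz_algebra ::
    "('a::unital_cstar_algebra \<Rightarrow> 'h::complex_hilbert \<Rightarrow> 'h) \<Rightarrow> 'h set \<Rightarrow> ('h \<Rightarrow> 'h) \<Rightarrow> 'a set" where
  "lipschitz_algebra \<pi> V D =
     {a. \<pi> a ` V \<subseteq> V \<and> (\<exists>K. \<forall>\<xi>\<in>V. norm (commutator D (\<pi> a) \<xi>) \<le> K * norm \<xi>)}"

text \<open>Norm of the commutator as a bounded operator on the dense domain \<open>V\<close>, equivalently of its
  bounded extension; meaningful for \<open>a\<close> in the Lipschitz algebra.\<close>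

definition spectral_seminorm ::
    "('a::unital_cstar_algebra \<Rightarrow> 'h::complex_hilbert \<Rightarrow> 'h) \<Rightarrow> 'h set \<Rightarrow> ('h \<Rightarrow> 'h) \<Rightarrow> 'a \<Rightarrow> real" where
  "spectral_seminorm \<pi> V D a = (SUP \<xi>\<in>{\<xi>\<in>V. norm \<xi> \<le> 1}. norm (commutator D (\<pi> a) \<xi>))"

definition spectral_triple ::
    "('a::unital_cstar_algebra \<Rightarrow> 'h::complex_hilbert \<Rightarrow> 'h) \<Rightarrow> 'h set \<Rightarrow> ('h \<Rightarrow> 'h) \<Rightarrow> bool" where
  "spectral_triple \<pi> V D \<longleftrightarrow>
     representation \<pi> \<and> self_adjoint_operator V D \<and> compact_inverse_sqrt V D \<and>
     (\<exists>B. dense_star_subalgebra B \<and> B \<subseteq> lipschitz_algebra \<pi> V D)"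

end

theory Submission
  imports Defs
begin

text \<open>Write \<open>d\<close> for \<open>dist_L \<A> L\<close>.

  An isometric seminorm \<open>L'\<close> equivalent to \<open>L\<close> gives the invariant metric \<open>dist_L \<A> L'\<close>: each
  \<open>\<alpha> g\<close> permutes the unit ball of \<open>L'\<close>, and the unit balls of \<open>L\<close> and \<open>L'\<close> are comparable.

  Conversely, an invariant metric equivalent to \<open>d\<close> makes all maps \<open>\<phi> \<mapsto> \<phi> \<circ> \<alpha> g\<close> Lipschitz for
  \<open>d\<close> with a common constant, so for fixed \<open>a\<close> the differences \<open>\<phi> (\<alpha> g a) - \<psi> (\<alpha> g a)\<close> are at
  most a common multiple of \<open>d \<phi> \<psi>\<close>. That this bounds \<open>L (\<alpha> g a)\<close> is
  \<open>L_le_of_state_diff_le\<close>: for hermitian \<open>x\<close>, a lower semicontinuous and star-invariant \<open>L\<close> is recovered from \<open>d\<close> as the Lipschitz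
  constant of \<open>\<omega> \<mapsto> \<omega> x\<close> on the states. If \<open>L x > s\<close>, the Hahn-Banach theorem separates \<open>x\<close> from
  \<open>{a \<in> \<A>. L a \<le> s}\<close> by a bounded functional vanishing at \<open>1\<close>, and the Jordan decomposition
  writes this functional on hermitian elements as a multiple of the difference of two states.

  If the action is metrically equicontinuous, put \<open>L' a = (SUP g. L (\<alpha> g a))\<close>; only the bound
  \<open>L' \<le> C * L\<close> needs an argument. For closed \<open>L\<close> the space \<open>\<A>\<close> is complete in the norm
  \<open>norm a + L a\<close>, and the sets \<open>{a \<in> \<A>. L' a \<le> n}\<close> are closed and cover \<open>\<A>\<close>, so the
  Baire category theorem yields \<open>L' a \<le> M * (norm a + L a)\<close>. Since \<open>L'\<close> ignores scalars,
  \<open>norm a\<close> may be replaced by the distance from \<open>a\<close> to the scalars. Up to the factor \<open>2\<close> this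
  distance is at most the spread of the values of the states at \<open>a\<close>, hence at most a multiple
  of \<open>L a\<close>, because the compact state space has finite \<open>d\<close>-diameter.

  The C*-theory behind this is derived from the norm alone. A hermitian \<open>x\<close> is called positive
  if \<open>norm (s - x) \<le> s\<close> for some \<open>s \<ge> 0\<close>; the binomial series provides square roots of such
  elements, and the decisive fact is \<open>cstar_pos_star_mult\<close>, the positivity of \<open>star a * a\<close>.

  For a spectral triple everything rests on the identity
  \<open>\<langle>[D, \<pi> a] \<xi>, \<eta>\<rangle> = \<langle>\<pi> a \<xi>, D \<eta>\<rangle> - \<langle>D \<xi>, \<pi> (star a) \<eta>\<rangle>\<close> on the domain of \<open>D\<close>: its right-hand side
  is continuous in \<open>a\<close>, which gives lower semicontinuity, and together with the Riesz
  representation theorem and the self-adjointness of \<open>D\<close> it shows that the Lipschitz algebra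
  and its seminorm are invariant under the involution.\<close>

section \<open>Sublinear functionals and the Hahn-Banach theorem\<close>

text \<open>Subadditive and positively homogeneous functionals. Homogeneity is required only as an
  inequality for positive factors; the equality, and
  the value \<open>0\<close> at \<open>0\<close>, follow.\<close>

definition sublinear :: "('a::real_vector \<Rightarrow> real) \<Rightarrow> bool" where
  "sublinear p \<longleftrightarrow> (\<forall>x y. p (x + y) \<le> p x + p y) \<and> (\<forall>t>0. \<forall>x. p (t *\<^sub>R x) \<le> t * p x)"

lemma sublinear_add: "sublinear p \<Longrightarrow> p (x + y) \<le> p x + p y"
  by (simp add: sublinear_def)

lemma sublinear_scale_le: "sublinear p \<Longrightarrow> t > 0 \<Longrightarrow> p (t *\<^sub>R x) \<le> t * p x"
  by (simp add: sublinear_def)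

lemma sublinear_zero: assumes "sublinear p" shows "p 0 = 0"
proof -
  have "p 0 \<le> (1/2) * p 0" "p 0 \<le> 2 * p 0"
    using sublinear_scale_le[OF assms, of "1/2" 0] sublinear_scale_le[OF assms, of 2 0] by auto
  then show ?thesis by simp
qed

lemma sublinear_scale: assumes "sublinear p" "t \<ge> 0" shows "p (t *\<^sub>R x) = t * p x"
proof (cases "t = 0")
  case False
  then have t: "t > 0" using assms by simp
  have "p x = p ((1/t) *\<^sub>R (t *\<^sub>R x))" using t by simp
  also have "\<dots> \<le> (1/t) * p (t *\<^sub>R x)" by (rule sublinear_scale_le[OF assms(1)]) (use t in simp)
  finally have "t * p x \<le> p (t *\<^sub>R x)" using t by (simp add: field_simps)
  then show ?thesis using sublinear_scale_le[OF assms(1) t, of x] by simp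
qed (simp add: sublinear_zero[OF assms(1)])

lemma sublinear_lower: assumes "sublinear p" shows "- p (- x) \<le> p x"
  using sublinear_add[OF assms, of x "-x"] sublinear_zero[OF assms] by simp

text \<open>The largest functional below \<open>q\<close> that is sublinear and takes at \<open>- x\<close> a value at most \<open>- q x\<close>.
  A minimal \<open>q\<close> is therefore unchanged by this operation, which forces \<open>q\<close> to be additive.\<close>

definition lower_along :: "('a::real_vector \<Rightarrow> real) \<Rightarrow> 'a \<Rightarrow> 'a \<Rightarrow> real" where
  "lower_along q x y = (INF t\<in>{0..}. q (y + t *\<^sub>R x) - t * q x)"

lemma lower_along_bdd:
  assumes "sublinear q"
  shows "bdd_below ((\<lambda>t. q (y + t *\<^sub>R x) - t * q x) ` {0..})"
proof (rule bdd_belowI2)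
  fix t :: real assume "t \<in> {0..}"
  then have "t * q x = q ((y + t *\<^sub>R x) + - y)" using sublinear_scale[OF assms, of t x] by simp
  also have "\<dots> \<le> q (y + t *\<^sub>R x) + q (- y)" by (rule sublinear_add[OF assms])
  finally show "- q (- y) \<le> q (y + t *\<^sub>R x) - t * q x" by simp
qed

lemma lower_along_le:
  assumes "sublinear q" "t \<ge> 0"
  shows "lower_along q x y \<le> q (y + t *\<^sub>R x) - t * q x"
  unfolding lower_along_def using assms by (intro cINF_lower lower_along_bdd) auto

lemma lower_along_greatest:
  assumes "\<And>t. t \<ge> 0 \<Longrightarrow> c \<le> q (y + t *\<^sub>R x) - t * q x"
  shows "c \<le> lower_along q x y"
  unfolding lower_along_def using assms by (intro cINF_greatest) auto

lemma sublinear_lower_along: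
  assumes q: "sublinear q"
  shows "sublinear (lower_along q x)"
  unfolding sublinear_def
proof (intro conjI allI impI)
  fix y z
  have *: "lower_along q x (y + z) - (q (z + t *\<^sub>R x) - t * q x) \<le> q (y + s *\<^sub>R x) - s * q x"
    if "s \<ge> 0" "t \<ge> 0" for s t
  proof -
    have "lower_along q x (y + z) \<le> q ((y + z) + (s + t) *\<^sub>R x) - (s + t) * q x"
      by (rule lower_along_le[OF q]) (use that in simp)
    also have "(y + z) + (s + t) *\<^sub>R x = (y + s *\<^sub>R x) + (z + t *\<^sub>R x)"
      by (simp add: algebra_simps)
    finally show ?thesis
      using sublinear_add[OF q, of "y + s *\<^sub>R x" "z + t *\<^sub>R x"] by (simp add: algebra_simps)
  qed
  have "lower_along q x (y + z) - (q (z + t *\<^sub>R x) - t * q x) \<le> lower_along q x y"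
    if "t \<ge> 0" for t
    by (rule lower_along_greatest) (rule *[OF _ that])
  then have "lower_along q x (y + z) - lower_along q x y \<le> lower_along q x z"
    by (intro lower_along_greatest) (simp add: algebra_simps)
  then show "lower_along q x (y + z) \<le> lower_along q x y + lower_along q x z" by simp
next
  fix r :: real and y assume r: "r > 0"
  have "(1/r) * lower_along q x (r *\<^sub>R y) \<le> lower_along q x y"
  proof (rule lower_along_greatest)
    fix t :: real assume t: "t \<ge> 0"
    have "lower_along q x (r *\<^sub>R y) \<le> q (r *\<^sub>R y + (r * t) *\<^sub>R x) - (r * t) * q x"
      by (rule lower_along_le[OF q]) (use r t in simp)
    also have "r *\<^sub>R y + (r * t) *\<^sub>R x = r *\<^sub>R (y + t *\<^sub>R x)" by (simp add: algebra_simps)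
    also have "q \<dots> = r * q (y + t *\<^sub>R x)" using sublinear_scale[OF q] r by simp
    finally show "(1/r) * lower_along q x (r *\<^sub>R y) \<le> q (y + t *\<^sub>R x) - t * q x"
      using r by (simp add: field_simps)
  qed
  then show "lower_along q x (r *\<^sub>R y) \<le> r * lower_along q x y"
    using r by (simp add: field_simps)
qed

lemma exists_minimal_sublinear:
  assumes p: "sublinear p"
  obtains q where "sublinear q" "q \<le> p" "\<And>r. sublinear r \<Longrightarrow> r \<le> q \<Longrightarrow> r = q"
proof -
  define A where "A = {q. sublinear q \<and> q \<le> p}"
  have "\<exists>m\<in>A. \<forall>a\<in>A. a \<le> m \<longrightarrow> a = m"
  proof (rule predicate_Zorn)
    show "partial_order_on A (relation_of (\<lambda>f g. g \<le> f) A)"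
      by (rule partial_order_on_relation_ofI) auto
  next
    fix C assume C: "C \<in> Chains (relation_of (\<lambda>f g. g \<le> f) A)"
    show "\<exists>u\<in>A. \<forall>a\<in>C. u \<le> a"
    proof (cases "C = {}")
      case True
      then show ?thesis using p by (auto simp: A_def)
    next
      case False
      have CA: "C \<subseteq> A" and total: "\<And>f g. f \<in> C \<Longrightarrow> g \<in> C \<Longrightarrow> f \<le> g \<or> g \<le> f"
        using C by (auto simp: Chains_def relation_of_def)
      define u where "u x = (INF q\<in>C. q x)" for x
      have bdd: "bdd_below ((\<lambda>q. q x) ` C)" for x
      proof (rule bdd_belowI2)
        fix q assume "q \<in> C"
        then have "sublinear q" "q (- x) \<le> p (- x)" using CA by (auto simp: A_def le_fun_def)
        then show "- p (- x) \<le> q x" using sublinear_lower[of q x] by simp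
      qed
      have lower: "u x \<le> q x" if "q \<in> C" for q x
        unfolding u_def by (rule cINF_lower[OF bdd that])
      have greatest: "c \<le> u x" if "\<And>q. q \<in> C \<Longrightarrow> c \<le> q x" for c x
        unfolding u_def by (rule cINF_greatest[OF False that])
      have "sublinear u" unfolding sublinear_def
      proof (intro conjI allI impI)
        fix x y
        have *: "u (x + y) - q y \<le> r x" if "q \<in> C" "r \<in> C" for q r
        proof -
          obtain s where s: "s \<in> C" "s \<le> q" "s \<le> r" using total[of q r] \<open>q \<in> C\<close> \<open>r \<in> C\<close> by blast
          then have "u (x + y) \<le> s x + s y"
            using lower[of s "x+y"] sublinear_add[of s x y] CA by (force simp: A_def)
          moreover have "s y \<le> q y" "s x \<le> r x" using s by (auto simp: le_fun_def)
          ultimately show ?thesis by linarith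
        qed
        have "u (x + y) - q y \<le> u x" if "q \<in> C" for q
          by (rule greatest) (rule *[OF that])
        then have "u (x + y) - u x \<le> u y" by (intro greatest) (simp add: algebra_simps)
        then show "u (x + y) \<le> u x + u y" by simp
      next
        fix t :: real and x assume t: "t > 0"
        have "(1/t) * u (t *\<^sub>R x) \<le> u x"
        proof (rule greatest)
          fix q assume q: "q \<in> C"
          then have "u (t *\<^sub>R x) \<le> t * q x"
            using lower[OF q, of "t *\<^sub>R x"] sublinear_scale_le[of q t x] CA t
            by (force simp: A_def)
          then show "(1/t) * u (t *\<^sub>R x) \<le> q x" using t by (simp add: field_simps)
        qed
        then show "u (t *\<^sub>R x) \<le> t * u x" using t by (simp add: field_simps)
      qed
      moreover have "u \<le> p"
      proof -
        obtain q where "q \<in> C" using False by blast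
        then have "u \<le> q" "q \<le> p" using lower CA by (auto simp: le_fun_def A_def)
        then show ?thesis by (rule order_trans)
      qed
      ultimately show ?thesis using lower by (auto simp: A_def le_fun_def)
    qed
  qed
  then obtain m where m: "m \<in> A" "\<And>a. a \<in> A \<Longrightarrow> a \<le> m \<Longrightarrow> a = m" by blast
  show ?thesis
    by (rule that[of m]) (use m in \<open>auto simp: A_def intro: order_trans\<close>)
qed

text \<open>A minimal sublinear functional is linear. Lowering \<open>p\<close> along \<open>a\<close> beforehand ensures that the
  linear functional found below it still attains the value \<open>p a\<close> at \<open>a\<close>.\<close>

theorem Hahn_Banach_sublinear:
  fixes p :: "'a::real_vector \<Rightarrow> real"
  assumes p: "sublinear p"
  obtains f where "linear f" "\<And>x. f x \<le> p x" "f a = p a"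
proof -
  obtain q where q: "sublinear q" "q \<le> lower_along p a"
    and min: "\<And>r. sublinear r \<Longrightarrow> r \<le> q \<Longrightarrow> r = q"
    using exists_minimal_sublinear[OF sublinear_lower_along[OF p]] by blast
  have qp: "q x \<le> p x" for x
    using q(2) lower_along_le[OF p, of 0 a x] by (auto simp: le_fun_def intro: order_trans)
  have fixed: "lower_along q x = q" for x
    by (rule min[OF sublinear_lower_along[OF q(1)]])
       (use lower_along_le[OF q(1), of 0] in \<open>auto simp: le_fun_def\<close>)
  have add: "q (y + x) = q y + q x" for x y
    using lower_along_le[OF q(1), of 1 x y] fixed[of x] sublinear_add[OF q(1), of y x] by simp
  have neg: "q (- x) = - q x" for x
    using add[of x "- x"] sublinear_zero[OF q(1)] by simp
  have "linear q"
  proof (rule linearI)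
    fix r :: real and x
    show "q (r *\<^sub>R x) = r *\<^sub>R q x"
    proof (cases "r \<ge> 0")
      case True
      then show ?thesis using sublinear_scale[OF q(1)] by simp
    next
      case False
      then show ?thesis using sublinear_scale[OF q(1), of "-r" x] neg[of "(-r) *\<^sub>R x"] by simp
    qed
  qed (rule add)
  moreover have "q a = p a"
  proof -
    have "q (- a) \<le> lower_along p a (- a)" using q(2) by (simp add: le_fun_def)
    also have "\<dots> \<le> - p a"
      using lower_along_le[OF p, of 1 a "- a"] sublinear_zero[OF p] by simp
    finally show ?thesis using neg[of a] qp[of a] by simp
  qed
  ultimately show ?thesis using that qp by blast
qed

section \<open>Positive elements of a C*-algebra\<close>

lemma scaleC_zero_right [simp]: "c *\<^sub>C (0::'a::complex_banach) = 0"
  using norm_scaleC[of c "0::'a"] by simp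

lemma scaleC_one [simp]: "1 *\<^sub>C (x::'a::complex_banach) = x"
  using scaleC_of_real[of 1 x] by simp

lemma scaleC_minus1: "(- 1) *\<^sub>C (x::'a::complex_banach) = - x"
  using scaleC_of_real[of "-1" x] by simp

lemma scaleC_minus_right: "c *\<^sub>C (- x) = - (c *\<^sub>C (x::'a::complex_banach))"
  using scaleC_add_right[of c x "- x"] by (simp add: add_eq_0_iff)

lemma scaleC_minus_left: "(- c) *\<^sub>C (x::'a::complex_banach) = - (c *\<^sub>C x)"
  using scaleC_scaleC[of "-1" c x] by (simp add: scaleC_minus1)

lemma scaleC_diff_right: "c *\<^sub>C (x - y) = c *\<^sub>C x - c *\<^sub>C (y::'a::complex_banach)"
  using scaleC_add_right[of c x "- y"] by (simp add: scaleC_minus_right)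

lemma scaleC_scaleR: "c *\<^sub>C (r *\<^sub>R x) = r *\<^sub>R (c *\<^sub>C (x::'a::complex_banach))"
  by (simp only: scaleC_of_real[symmetric] scaleC_scaleC mult.commute)

lemma scaleC_decompose: "c *\<^sub>C x = Re c *\<^sub>R x + Im c *\<^sub>R (\<i> *\<^sub>C (x::'a::complex_banach))"
proof -
  have "c = complex_of_real (Re c) + complex_of_real (Im c) * \<i>"
    by (simp add: complex_eq_iff)
  then have "c *\<^sub>C x = (complex_of_real (Re c) + complex_of_real (Im c) * \<i>) *\<^sub>C x"
    by (rule arg_cong)
  then show ?thesis by (simp only: scaleC_add_left scaleC_scaleC[symmetric] scaleC_of_real)
qed

lemma star_minus: "star (- x) = - star (x::'a::unital_cstar_algebra)"
  using star_scaleC[of "-1" x] by (simp add: scaleC_minus1)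

lemma star_diff: "star (x - y) = star x - star (y::'a::unital_cstar_algebra)"
  using star_add[of x "- y"] by (simp add: star_minus)

lemma star_scaleR: "star (r *\<^sub>R x) = r *\<^sub>R star (x::'a::unital_cstar_algebra)"
  using star_scaleC[of "complex_of_real r" x] by (simp add: scaleC_of_real)

lemma star_one [simp]: "star (1::'a::unital_cstar_algebra) = 1"
  using star_mult[of "star 1" "1::'a"] by (simp add: star_star)

lemma star_zero [simp]: "star (0::'a::unital_cstar_algebra) = 0"
  using star_scaleR[of 0 "0::'a"] by simp

lemma norm_star [simp]: "norm (star x) = norm (x::'a::unital_cstar_algebra)"
proof -
  have *: "norm y \<le> norm (star y)" for y :: 'a
  proof (cases "norm y = 0")
    case False
    have "norm y * norm y \<le> norm (star y) * norm y"
      using norm_mult_ineq[of "star y" y] by (simp add: cstar_identity power2_eq_square)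
    then show ?thesis using False by simp
  qed simp
  show ?thesis using *[of x] *[of "star x"] by (simp add: star_star)
qed

lemma bounded_linear_star: "bounded_linear (star :: 'a::unital_cstar_algebra \<Rightarrow> 'a)"
  by (rule bounded_linear_intro[of _ 1]) (auto simp: star_add star_scaleR)

text \<open>The Taylor coefficients of \<open>sqrt (1 - w)\<close>. All but the first are nonpositive and the
  partial sums are nonnegative, so the series converges absolutely for \<open>norm w \<le> 1\<close>, boundary
  included.\<close>

definition sqrt_coeff :: "nat \<Rightarrow> real" where
  "sqrt_coeff n = ((1/2) gchoose n) * (- 1) ^ n"

lemma sqrt_coeff_0: "sqrt_coeff 0 = 1"
  by (simp add: sqrt_coeff_def)

lemma sqrt_coeff_Suc_nonpos: "sqrt_coeff (Suc n) \<le> 0"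
proof -
  have "sqrt_coeff (Suc n) = pochhammer (- 1/2) (Suc n) / fact (Suc n)"
    by (simp add: sqrt_coeff_def gbinomial_pochhammer flip: power_mult_distrib)
  also have "pochhammer (- 1/2) (Suc n) = (- 1/2) * pochhammer (1/2 :: real) n"
    by (simp add: pochhammer_rec)
  also have "\<dots> / fact (Suc n) \<le> 0"
    using pochhammer_nonneg[of "1/2::real" n] by (simp add: divide_le_0_iff del: fact_Suc)
  finally show ?thesis .
qed

lemma sum_sqrt_coeff_nonneg: "(\<Sum>k\<le>n. sqrt_coeff k) \<ge> 0"
proof -
  have "(\<Sum>k\<le>n. sqrt_coeff k) = (- 1) ^ n * ((- 1/2) gchoose n)"
    unfolding sqrt_coeff_def gbinomial_sum_lower_neg by simp
  also have "\<dots> = pochhammer (1/2) n / fact n"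
    by (simp add: gbinomial_pochhammer flip: power_mult_distrib)
  also have "\<dots> \<ge> 0" by (simp add: pochhammer_nonneg)
  finally show ?thesis .
qed

lemma sqrt_coeff_convolution:
  "(\<Sum>i\<le>n. sqrt_coeff i * sqrt_coeff (n - i)) = (if n = 0 then 1 else if n = 1 then - 1 else 0)"
proof -
  have "(\<Sum>i\<le>n. sqrt_coeff i * sqrt_coeff (n - i)) =
      (\<Sum>i\<le>n. (- 1) ^ n * (((1/2) gchoose i) * ((1/2) gchoose (n - i))))"
  proof (rule sum.cong)
    fix i assume "i \<in> {..n}"
    then have "(- 1::real) ^ n = (- 1) ^ i * (- 1) ^ (n - i)" by (simp flip: power_add)
    then show "sqrt_coeff i * sqrt_coeff (n - i) =
        (- 1) ^ n * (((1/2) gchoose i) * ((1/2) gchoose (n - i)))"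
      unfolding sqrt_coeff_def by (simp only: mult_ac)
  qed simp
  also have "\<dots> = (- 1) ^ n * ((1/2 + 1/2 :: real) gchoose n)"
    unfolding gbinomial_Vandermonde[symmetric] by (simp add: sum_distrib_left atMost_atLeast0)
  also have "((1/2 + 1/2 :: real) gchoose n) = of_nat (1 choose n)"
    by (simp add: binomial_gbinomial)
  also have "(- 1) ^ n * real (1 choose n) = (if n = 0 then 1 else if n = 1 then - 1 else 0)"
  proof -
    consider "n = 0" | "n = 1" | "n > 1" by linarith
    then show ?thesis by cases (simp_all add: binomial_eq_0)
  qed
  finally show ?thesis .
qed

lemma sqrt_coeff_abs_partial_sum: "(\<Sum>k<n. \<bar>sqrt_coeff (Suc k)\<bar>) \<le> 1"
proof -
  have "(\<Sum>k<n. \<bar>sqrt_coeff (Suc k)\<bar>) = - (\<Sum>k<n. sqrt_coeff (Suc k))"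
    by (simp add: abs_of_nonpos sqrt_coeff_Suc_nonpos sum_negf)
  also have "\<dots> = 1 - (\<Sum>k\<le>n. sqrt_coeff k)"
    by (simp add: sum.lessThan_Suc_shift sqrt_coeff_0 flip: lessThan_Suc_atMost
        del: sum.lessThan_Suc)
  finally show ?thesis using sum_sqrt_coeff_nonneg[of n] by simp
qed

lemma exists_sqrt_one_minus:
  fixes w :: "'a::unital_cstar_algebra"
  assumes w: "norm w \<le> 1"
  obtains s where "s * s = 1 - w" "norm (1 - s) \<le> 1" "star w = w \<Longrightarrow> star s = s"
    "\<And>y. w * y = y * w \<Longrightarrow> s * y = y * s"
proof -
  define f where "f n = sqrt_coeff n *\<^sub>R w ^ n" for n
  have norm_f: "norm (f n) \<le> \<bar>sqrt_coeff n\<bar>" for n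
  proof -
    have "norm (w ^ n) \<le> 1"
      using norm_power_ineq[of w n] power_le_one[OF norm_ge_zero w, of n] by linarith
    then have "\<bar>sqrt_coeff n\<bar> * norm (w ^ n) \<le> \<bar>sqrt_coeff n\<bar> * 1"
      by (rule mult_left_mono) simp
    then show ?thesis by (simp add: f_def)
  qed
  have bound: "(\<Sum>k<n. norm (f (Suc k))) \<le> 1" for n
    by (rule order_trans[OF sum_mono sqrt_coeff_abs_partial_sum]) (rule norm_f)
  have summ_Suc: "summable (\<lambda>k. norm (f (Suc k)))"
    by (rule summableI_nonneg_bounded[of _ 1]) (use bound in auto)
  then have summ_norm: "summable (\<lambda>k. norm (f k))" by (simp only: summable_Suc_iff[of "\<lambda>k. norm (f k)"])
  then have summ: "summable f" by (rule summable_norm_cancel)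
  define s where "s = suminf f"
  have sums: "f sums s" using summ by (simp add: s_def summable_sums)
  have "(\<lambda>k. \<Sum>i\<le>k. f i * f (k - i)) sums (s * s)"
    unfolding s_def by (rule Cauchy_product_sums[OF summ_norm summ_norm])
  moreover have "(\<Sum>i\<le>k. f i * f (k - i)) = (if k = 0 then 1 else if k = 1 then - w else 0)" for k
  proof -
    have "(\<Sum>i\<le>k. f i * f (k - i)) = (\<Sum>i\<le>k. (sqrt_coeff i * sqrt_coeff (k - i)) *\<^sub>R w ^ k)"
      by (rule sum.cong) (auto simp: f_def simp flip: power_add)
    then show ?thesis
      by (simp add: sqrt_coeff_convolution flip: scaleR_sum_left)
  qed
  ultimately have 1: "(\<lambda>k. if k = 0 then 1 else if k = 1 then - w else 0) sums (s * s)" by simp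
  have "(\<lambda>k. if k = 0 then 1 else if k = 1 then - w else 0) sums
      (\<Sum>k\<in>{0,1::nat}. if k = 0 then 1 else if k = 1 then - w else 0)"
    by (rule sums_finite) auto
  then have 2: "s * s = 1 - w" using sums_unique2[OF 1] by simp
  have "(\<lambda>n. f (Suc n)) sums (s - f 0)" using sums by (simp add: sums_Suc_iff)
  then have "suminf (\<lambda>n. f (Suc n)) = s - 1"
    by (simp add: f_def sqrt_coeff_0 sums_iff)
  moreover have "norm (suminf (\<lambda>n. f (Suc n))) \<le> (\<Sum>n. norm (f (Suc n)))"
    by (rule summable_norm[OF summ_Suc])
  moreover have "(\<Sum>n. norm (f (Suc n))) \<le> 1"
    by (rule suminf_le_const[OF summ_Suc bound])
  ultimately have 3: "norm (1 - s) \<le> 1" by (simp add: norm_minus_commute)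
  have 4: "star s = s" if "star w = w"
  proof -
    have "star (w ^ n) = w ^ n" for n
      by (induction n) (simp_all add: star_mult that power_commutes)
    then have "star (f n) = f n" for n by (simp add: f_def star_scaleR)
    then have "f sums star s" using bounded_linear.sums[OF bounded_linear_star sums] by simp
    then show ?thesis using sums sums_unique2 by blast
  qed
  have 5: "s * y = y * s" if "w * y = y * w" for y
  proof -
    have "w ^ n * y = y * w ^ n" for n using that by (rule power_commuting_commutes)
    then have "f n * y = y * f n" for n by (simp add: f_def)
    moreover have "(\<lambda>n. f n * y) sums (s * y)" "(\<lambda>n. y * f n) sums (y * s)"
      using sums by (auto intro: sums_mult sums_mult2)
    ultimately show ?thesis using sums_unique2 by fastforce
  qed
  show ?thesis using that 2 3 4 5 by blast
qed

text \<open>Positivity defined through the norm, without the spectrum: \<open>x\<close> is hermitian and lies in a ball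
  around a scalar \<open>s \<ge> 0\<close> whose radius is \<open>s\<close>.\<close>

definition cstar_pos :: "'a::unital_cstar_algebra \<Rightarrow> bool" where
  "cstar_pos x \<longleftrightarrow> star x = x \<and> (\<exists>s\<ge>0. norm (s *\<^sub>R 1 - x) \<le> s)"

lemma cstar_pos_hermitian: "cstar_pos x \<Longrightarrow> star x = x"
  by (simp add: cstar_pos_def)

lemma cstar_pos_add: assumes "cstar_pos x" "cstar_pos y" shows "cstar_pos (x + y)"
proof -
  obtain s t where s: "s \<ge> 0" "norm (s *\<^sub>R 1 - x) \<le> s" and t: "t \<ge> 0" "norm (t *\<^sub>R 1 - y) \<le> t"
    using assms by (auto simp: cstar_pos_def)
  have "norm ((s + t) *\<^sub>R 1 - (x + y)) = norm ((s *\<^sub>R 1 - x) + (t *\<^sub>R 1 - y))"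
    by (simp add: algebra_simps)
  also have "\<dots> \<le> s + t" using norm_triangle_ineq[of "s *\<^sub>R 1 - x" "t *\<^sub>R 1 - y"] s t by linarith
  finally have "norm ((s + t) *\<^sub>R 1 - (x + y)) \<le> s + t" .
  moreover have "s + t \<ge> 0" using s t by simp
  moreover have "star (x + y) = x + y" using assms by (simp add: cstar_pos_def star_add)
  ultimately show ?thesis unfolding cstar_pos_def by blast
qed

lemma cstar_pos_scaleR: assumes "cstar_pos x" "r \<ge> 0" shows "cstar_pos (r *\<^sub>R x)"
proof -
  obtain s where s: "s \<ge> 0" "norm (s *\<^sub>R 1 - x) \<le> s"
    using assms by (auto simp: cstar_pos_def)
  have "(r * s) *\<^sub>R 1 - r *\<^sub>R x = r *\<^sub>R (s *\<^sub>R 1 - x)" by (simp add: algebra_simps)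
  then have "norm ((r * s) *\<^sub>R 1 - r *\<^sub>R x) = r * norm (s *\<^sub>R 1 - x)" using assms by simp
  also have "\<dots> \<le> r * s" using s assms by (intro mult_left_mono) auto
  finally have "norm ((r * s) *\<^sub>R 1 - r *\<^sub>R x) \<le> r * s" .
  moreover have "r * s \<ge> 0" using s assms by simp
  moreover have "star (r *\<^sub>R x) = r *\<^sub>R x" using assms by (simp add: cstar_pos_def star_scaleR)
  ultimately show ?thesis unfolding cstar_pos_def by blast
qed

lemma cstar_pos_zero [simp]: "cstar_pos 0"
  unfolding cstar_pos_def by (intro conjI exI[of _ 0]) simp_all

lemma cstar_pos_const_diff:
  assumes "star x = x" "norm x \<le> t" shows "cstar_pos (t *\<^sub>R 1 - x)"
  using assms unfolding cstar_pos_def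
  by (auto simp: star_diff star_scaleR intro!: exI[of _ t] order_trans[OF norm_ge_zero[of x]])

lemma cstar_pos_const_add:
  assumes "star x = x" "norm x \<le> t" shows "cstar_pos (t *\<^sub>R 1 + x)"
  using cstar_pos_const_diff[of "- x" t] assms by (simp add: star_minus)

lemma cstar_pos_const: "cstar_pos (t *\<^sub>R 1) \<longleftrightarrow> t \<ge> 0"
proof
  assume "cstar_pos (t *\<^sub>R (1::'a))"
  then obtain s where s: "s \<ge> 0" "norm (s *\<^sub>R 1 - t *\<^sub>R (1::'a)) \<le> s"
    by (auto simp: cstar_pos_def)
  have "s *\<^sub>R 1 - t *\<^sub>R (1::'a) = (s - t) *\<^sub>R 1" by (simp add: algebra_simps)
  then show "t \<ge> 0" using s by simp
qed (use cstar_pos_const_diff[of 0] in simp)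

lemma cstar_pos_sqrt:
  assumes "cstar_pos x"
  obtains r where "cstar_pos r" "r * r = x" "\<And>y. x * y = y * x \<Longrightarrow> r * y = y * r"
proof -
  obtain s where s: "s \<ge> 0" "norm (s *\<^sub>R 1 - x) \<le> s" and x: "star x = x"
    using assms by (auto simp: cstar_pos_def)
  show ?thesis
  proof (cases "s = 0")
    case True
    then have "x = 0" using s by simp
    then show ?thesis using that[of 0] by simp
  next
    case False
    then have s0: "s > 0" using s by simp
    define w where "w = 1 - (1/s) *\<^sub>R x"
    have "norm w = norm ((1/s) *\<^sub>R (s *\<^sub>R 1 - x))" using s0 by (simp add: w_def algebra_simps)
    also have "\<dots> \<le> 1" using s s0 by simp
    finally have nw: "norm w \<le> 1" .
    have sw: "star w = w" by (simp add: w_def star_diff star_scaleR x)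
    obtain q where q: "q * q = 1 - w" "norm (1 - q) \<le> 1" "star q = q"
      and comm: "\<And>y. w * y = y * w \<Longrightarrow> q * y = y * q"
      using exists_sqrt_one_minus[OF nw] sw by blast
    have "cstar_pos q" unfolding cstar_pos_def using q by (auto intro!: exI[of _ 1])
    then have 1: "cstar_pos (sqrt s *\<^sub>R q)" using s by (intro cstar_pos_scaleR) auto
    have 2: "(sqrt s *\<^sub>R q) * (sqrt s *\<^sub>R q) = x" using q s0 by (simp add: w_def)
    have 3: "(sqrt s *\<^sub>R q) * y = y * (sqrt s *\<^sub>R q)" if "x * y = y * x" for y
      using comm[of y] that by (simp add: w_def algebra_simps)
    show ?thesis by (rule that[OF 1 2 3])
  qed
qed

text \<open>The element \<open>q + \<i> r\<close> is \<open>t\<close> times an isometry, and \<open>q\<close> is its hermitian part.\<close>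

lemma norm_le_of_sum_squares:
  fixes q r :: "'a::unital_cstar_algebra"
  assumes "star q = q" "star r = r" "q * r = r * q" "q * q + r * r = (t\<^sup>2) *\<^sub>R 1" "t \<ge> 0"
  shows "norm q \<le> t"
proof -
  define u where "u = q + \<i> *\<^sub>C r"
  have su: "star u = q - \<i> *\<^sub>C r"
    by (simp add: u_def star_add star_scaleC assms scaleC_minus_left)
  have "star u * u = q * q + r * r"
    unfolding su unfolding u_def
    by (simp add: algebra_simps scaleC_mult_left scaleC_mult_right scaleC_scaleC scaleC_minus1
        scaleC_diff_right scaleC_add_right assms(3))
  then have "(norm u)\<^sup>2 = t\<^sup>2" using cstar_identity[of u] assms(4) by simp
  then have nu: "norm u = t" using assms(5) by (simp add: power2_eq_iff_nonneg)
  have "2 *\<^sub>R q = u + star u" by (simp add: su) (simp add: u_def scaleR_2)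
  then have "2 * norm q \<le> 2 * t"
    using norm_triangle_ineq[of u "star u"] nu norm_scaleR[of 2 q] by simp
  then show ?thesis by simp
qed

lemma norm_square_hermitian:
  "star x = x \<Longrightarrow> norm (x * x) = (norm x)\<^sup>2" for x :: "'a::unital_cstar_algebra"
  using cstar_identity[of x] by simp

text \<open>With \<open>t = norm r\<close>, the square root \<open>q\<close> of \<open>t\<^sup>2 - r\<^sup>2\<close> commutes with \<open>r\<close>; hence \<open>norm q \<le> t\<close>,
  which says that \<open>r\<^sup>2\<close> lies in the ball of radius \<open>t\<^sup>2\<close> around \<open>t\<^sup>2\<close>.\<close>

lemma cstar_pos_square:
  assumes r: "star r = r" shows "cstar_pos (r * r)"
proof -
  have sr: "star (r * r) = r * r" by (simp add: star_mult r)
  define t where "t = norm r"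
  have "cstar_pos (t\<^sup>2 *\<^sub>R 1 - r * r)"
    by (rule cstar_pos_const_diff[OF sr]) (simp add: norm_square_hermitian r t_def)
  then obtain q where q: "cstar_pos q" "q * q = t\<^sup>2 *\<^sub>R 1 - r * r"
    and comm: "\<And>y. (t\<^sup>2 *\<^sub>R 1 - r * r) * y = y * (t\<^sup>2 *\<^sub>R 1 - r * r) \<Longrightarrow> q * y = y * q"
    using cstar_pos_sqrt by blast
  have qr: "q * r = r * q" by (rule comm) (simp add: algebra_simps)
  have "norm q \<le> t"
    by (rule norm_le_of_sum_squares[of q r]) (use q r qr cstar_pos_hermitian in \<open>auto simp: t_def\<close>)
  then have "norm (q * q) \<le> t\<^sup>2" using cstar_pos_hermitian[OF q(1)]
    by (simp add: norm_square_hermitian power_mono)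
  then show ?thesis using sr unfolding q(2) cstar_pos_def by (intro conjI exI[of _ "t\<^sup>2"]) auto
qed

lemma cstar_pos_le_const:
  assumes "cstar_pos x" "cstar_pos (t *\<^sub>R 1 - x)"
  shows "0 \<le> t" "norm x \<le> t"
proof -
  show t: "0 \<le> t" using cstar_pos_add[OF assms] by (simp add: cstar_pos_const)
  obtain r where r: "cstar_pos r" "r * r = x" and rc: "\<And>y. x * y = y * x \<Longrightarrow> r * y = y * r"
    using cstar_pos_sqrt[OF assms(1)] by blast
  obtain q where q: "cstar_pos q" "q * q = t *\<^sub>R 1 - x"
    and qc: "\<And>y. (t *\<^sub>R 1 - x) * y = y * (t *\<^sub>R 1 - x) \<Longrightarrow> q * y = y * q"
    using cstar_pos_sqrt[OF assms(2)] by blast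
  have "x * r = r * x" unfolding r(2)[symmetric] by (simp add: mult.assoc)
  then have "q * r = r * q" by (intro qc) (simp add: algebra_simps)
  then have "norm r \<le> sqrt t"
    by (intro norm_le_of_sum_squares[of r q])
       (use q r cstar_pos_hermitian t in auto)
  then have "(norm r)\<^sup>2 \<le> t" using t by (metis norm_ge_zero power_mono real_sqrt_pow2)
  then show "norm x \<le> t" using norm_square_hermitian[OF cstar_pos_hermitian[OF r(1)]] r(2) by simp
qed

lemma cstar_pos_mult_commuting:
  assumes "cstar_pos x" "cstar_pos y" "x * y = y * x"
  shows "cstar_pos (x * y)"
proof -
  obtain r where r: "cstar_pos r" "r * r = x" and rc: "\<And>y. x * y = y * x \<Longrightarrow> r * y = y * r"
    using cstar_pos_sqrt[OF assms(1)] by blast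
  obtain q where q: "cstar_pos q" "q * q = y" and qc: "\<And>z. y * z = z * y \<Longrightarrow> q * z = z * q"
    using cstar_pos_sqrt[OF assms(2)] by blast
  have "r * y = y * r" by (rule rc[OF assms(3)])
  then have qr: "q * r = r * q" by (intro qc) simp
  then have "star (r * q) = r * q"
    using cstar_pos_hermitian[OF r(1)] cstar_pos_hermitian[OF q(1)] by (simp add: star_mult)
  then have "cstar_pos ((r * q) * (r * q))" by (rule cstar_pos_square)
  moreover have "(r * q) * (r * q) = x * y"
  proof -
    have "(r * q) * (r * q) = r * (q * r) * q" by (simp only: mult.assoc)
    also have "\<dots> = (r * r) * (q * q)" unfolding qr by (simp only: mult.assoc)
    finally show ?thesis unfolding r q .
  qed
  ultimately show ?thesis by simp
qed

lemma norm_le_of_positive: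
  fixes x :: "'a::unital_cstar_algebra"
  assumes "cstar_pos (t *\<^sub>R 1 - x)" "cstar_pos (t *\<^sub>R 1 + x)"
  shows "norm x \<le> t"
proof -
  have "(t *\<^sub>R 1 - x) + (t *\<^sub>R 1 + x) = t *\<^sub>R 1 + t *\<^sub>R 1" by simp
  also have "\<dots> = (t + t) *\<^sub>R 1" by (rule scaleR_left_distrib[symmetric])
  finally have "(t *\<^sub>R 1 - x) + (t *\<^sub>R 1 + x) = (t + t) *\<^sub>R 1" .
  then have "cstar_pos ((t + t) *\<^sub>R (1::'a))" using cstar_pos_add[OF assms] by simp
  then have t: "t \<ge> 0" unfolding cstar_pos_const by simp
  have x: "star x = x"
    using cstar_pos_hermitian[OF assms(2)] by (simp add: star_add star_scaleR)
  have "cstar_pos ((t *\<^sub>R 1 - x) * (t *\<^sub>R 1 + x))"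
    by (rule cstar_pos_mult_commuting[OF assms]) (simp add: algebra_simps)
  then have "cstar_pos (t\<^sup>2 *\<^sub>R 1 - x * x)" by (simp add: algebra_simps power2_eq_square)
  then have "norm (x * x) \<le> t\<^sup>2" using cstar_pos_le_const(2) cstar_pos_square[OF x] by blast
  then show ?thesis using t by (simp add: norm_square_hermitian x power2_le_iff_abs_le)
qed

section \<open>States and the Jordan decomposition\<close>

text \<open>The hermitian elements \<open>re_part x\<close> and \<open>im_part x\<close> satisfy \<open>x = re_part x + \<i> im_part x\<close>.\<close>

definition re_part :: "'a::unital_cstar_algebra \<Rightarrow> 'a" where
  "re_part x = (1/2) *\<^sub>R (x + star x)"

definition im_part :: "'a::unital_cstar_algebra \<Rightarrow> 'a" where
  "im_part x = re_part ((- \<i>) *\<^sub>C x)"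

lemma linear_re_part: "linear re_part"
  by (rule linearI) (simp_all add: re_part_def star_add star_scaleR algebra_simps)

lemmas re_part_add = linear_add[OF linear_re_part]
  and re_part_scaleR = linear_scale[OF linear_re_part]
  and re_part_minus = linear_neg[OF linear_re_part]

lemma re_part_hermitian [simp]: "star x = x \<Longrightarrow> re_part x = x"
  by (simp add: re_part_def flip: scaleR_2)

lemma star_re_part [simp]: "star (re_part x) = re_part x"
  by (simp add: re_part_def star_add star_scaleR star_star add.commute)

lemma star_im_part [simp]: "star (im_part x) = im_part x"
  by (simp add: im_part_def)

lemma norm_re_part: "norm (re_part x) \<le> norm x"
  using norm_triangle_ineq[of x "star x"] by (simp add: re_part_def)

lemma norm_im_part: "norm (im_part x) \<le> norm x"
  using norm_re_part[of "(- \<i>) *\<^sub>C x"] by (simp add: im_part_def norm_scaleC)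

lemma re_part_scaleC: "re_part (c *\<^sub>C x) = Re c *\<^sub>R re_part x - Im c *\<^sub>R im_part x"
  by (subst scaleC_decompose)
     (simp add: re_part_add re_part_scaleR im_part_def scaleC_minus_left re_part_minus)

lemma im_part_scaleC: "im_part (c *\<^sub>C x) = Re c *\<^sub>R im_part x + Im c *\<^sub>R re_part x"
  unfolding im_part_def[of "c *\<^sub>C x"] scaleC_scaleC re_part_scaleC by simp

lemma im_part_add: "im_part (x + y) = im_part x + im_part y"
  by (simp add: im_part_def scaleC_add_right re_part_add)

lemma im_part_alt: "im_part x = (1/2) *\<^sub>R (\<i> *\<^sub>C (star x - x))"
  by (simp add: im_part_def re_part_def star_scaleC star_minus scaleC_diff_right scaleC_minus_left)

lemma re_part_im_part: "re_part x + \<i> *\<^sub>C im_part x = x"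
proof -
  have "\<i> *\<^sub>C im_part x = (1/2) *\<^sub>R (x - star x)"
    by (simp add: im_part_alt scaleC_scaleR scaleC_scaleC scaleC_minus1)
  then show ?thesis by (simp add: re_part_def flip: scaleR_right_distrib scaleR_2)
qed

lemma im_part_hermitian: "star x = x \<Longrightarrow> im_part x = 0"
  by (simp add: im_part_alt)

lemma sum_star_mult:
  "x * star x + star x * x = 2 *\<^sub>R (re_part x * re_part x + im_part x * im_part x)"
proof -
  define a b where "a = re_part x" and "b = im_part x"
  have x: "x = a + \<i> *\<^sub>C b" by (simp add: a_def b_def re_part_im_part)
  have sx: "star x = a - \<i> *\<^sub>C b"
    by (subst x) (simp add: star_add star_scaleC scaleC_minus_left a_def b_def)
  have "x * star x + star x * x = 2 *\<^sub>R (a * a + b * b)"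
    unfolding sx unfolding x
    by (simp add: algebra_simps scaleC_mult_left scaleC_mult_right scaleC_scaleC scaleC_minus1
        scaleC_diff_right scaleC_add_right scaleR_2)
  then show ?thesis by (simp add: a_def b_def)
qed

text \<open>With \<open>q = b * star b\<close>, \<open>z = - (star b * b)\<close> and \<open>m = norm b ^ 2\<close>, the intertwining relation
  \<open>q * b = - (b * z)\<close> and \<open>norm (m - z) \<le> m\<close> give \<open>norm (m q + q\<^sup>2) \<le> m\<^sup>2\<close>. For \<open>q \<ge> 0\<close> of norm \<open>m\<close>
  the left-hand side is \<open>2 m\<^sup>2\<close>, so \<open>m = 0\<close>. Completing the square avoids spectral mapping.\<close>

lemma zero_of_opposite_signs:
  fixes b :: "'a::unital_cstar_algebra"
  assumes q: "cstar_pos (b * star b)" and z: "cstar_pos (- (star b * b))"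
  shows "b = 0"
proof -
  define q where "q = b * star b"
  define z where "z = - (star b * b)"
  define m where "m = (norm b)\<^sup>2"
  have nq: "norm q = m" using cstar_identity[of "star b"] by (simp add: q_def m_def star_star)
  have nz: "norm z = m" using cstar_identity[of b] by (simp add: z_def m_def)
  have pq: "cstar_pos q" and pz: "cstar_pos z" using assms by (simp_all add: q_def z_def)
  have "cstar_pos (m *\<^sub>R 1 - z)"
    by (rule cstar_pos_const_diff) (simp_all add: cstar_pos_hermitian[OF pz] nz)
  then have nmz: "norm (m *\<^sub>R 1 - z) \<le> m"
    by (rule cstar_pos_le_const(2)) (simp add: pz)
  have "m *\<^sub>R q + q * q = b * (m *\<^sub>R 1 - z) * star b"
    by (simp add: q_def z_def algebra_simps)
  then have "norm (m *\<^sub>R q + q * q) \<le> norm (b * (m *\<^sub>R 1 - z)) * norm (star b)"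
    by (simp only: norm_mult_ineq)
  also have "\<dots> \<le> norm b * norm (m *\<^sub>R 1 - z) * norm (star b)"
    by (intro mult_right_mono norm_mult_ineq norm_ge_zero)
  also have "\<dots> \<le> norm b * m * norm b"
    by (simp add: mult_left_mono mult_right_mono nmz)
  also have "\<dots> = m\<^sup>2" by (simp add: m_def power2_eq_square)
  finally have 1: "norm (m *\<^sub>R q + q * q) \<le> m\<^sup>2" .
  define y where "y = q + (m/2) *\<^sub>R 1"
  have sy: "star y = y" by (simp add: y_def star_add star_scaleR cstar_pos_hermitian[OF pq])
  have "y * y = (m *\<^sub>R q + q * q) + (m/2 * (m/2)) *\<^sub>R 1"
  proof -
    have "(m/2) *\<^sub>R q + (m/2) *\<^sub>R q = m *\<^sub>R q" by (simp flip: scaleR_left_distrib)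
    then show ?thesis by (simp add: y_def algebra_simps)
  qed
  then have "norm (y * y) \<le> m\<^sup>2 + m/2 * (m/2)"
    using norm_triangle_ineq[of "m *\<^sub>R q + q * q" "(m/2 * (m/2)) *\<^sub>R 1"] 1 by simp
  then have 2: "(norm y)\<^sup>2 \<le> 5/4 * m\<^sup>2"
    by (simp add: norm_square_hermitian sy power2_eq_square)
  have "cstar_pos (norm y *\<^sub>R 1 - y)" by (rule cstar_pos_const_diff[OF sy]) simp
  then have "cstar_pos ((norm y - m/2) *\<^sub>R 1 - q)" by (simp add: y_def algebra_simps)
  then have "norm q \<le> norm y - m/2" by (rule cstar_pos_le_const(2)[OF pq])
  then have "3/2 * m \<le> norm y" by (simp add: nq)
  then have "(3/2 * m)\<^sup>2 \<le> (norm y)\<^sup>2" by (rule power_mono) (simp add: m_def)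
  with 2 have "9/4 * m\<^sup>2 \<le> 5/4 * m\<^sup>2" by (simp add: power_mult_distrib power2_eq_square)
  then have "m = 0" by simp
  then show ?thesis by (simp add: m_def)
qed

text \<open>With \<open>h = star a * a\<close>, its absolute value \<open>k\<close> and its negative part \<open>n = (k - h) / 2\<close>, the
  element \<open>b = a * n\<close> satisfies \<open>star b * b = - n\<^sup>3 \<le> 0\<close>. Since \<open>b * star b + star b * b\<close> is a sum of
  squares of hermitian elements, \<open>b * star b\<close> is positive, hence \<open>b = 0\<close>, \<open>n = 0\<close> and \<open>h = k\<close>.\<close>

theorem cstar_pos_star_mult: "cstar_pos (star a * a)"
proof -
  define h where "h = star a * a"
  have h: "star h = h" by (simp add: h_def star_mult star_star)
  obtain k where k: "cstar_pos k" "k * k = h * h"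
    and comm: "\<And>y. (h * h) * y = y * (h * h) \<Longrightarrow> k * y = y * k"
    using cstar_pos_sqrt[OF cstar_pos_square[OF h]] by blast
  have kh: "k * h = h * k" by (rule comm) (simp add: mult.assoc)
  define n where "n = (1/2) *\<^sub>R (k - h)"
  have n: "star n = n" by (simp add: n_def star_diff star_scaleR h cstar_pos_hermitian[OF k(1)])
  have kn: "k * n = n * k" by (simp add: n_def algebra_simps kh)
  have hn: "h * n = - (k * n)" by (simp add: n_def algebra_simps kh k)
  have nn: "n * n = k * n"
  proof -
    have "n * n = (1/2) *\<^sub>R (k * n - h * n)" by (simp add: n_def algebra_simps)
    then show ?thesis by (simp add: hn flip: scaleR_2)
  qed
  define b where "b = a * n"
  have sbb: "star b * b = - (n * n * n)"
  proof -
    have "star b * b = n * (h * n)" by (simp add: b_def h_def star_mult n mult.assoc)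
    also have "\<dots> = - (n * (n * n))" by (simp add: hn nn)
    finally show ?thesis by (simp add: mult.assoc)
  qed
  \<comment> \<open>\<open>n\<^sup>3 = k n\<^sup>2\<close> is positive although \<open>n\<close> is not yet known to be.\<close>
  have "cstar_pos (k * (n * n))"
    by (rule cstar_pos_mult_commuting[OF k(1) cstar_pos_square[OF n]]) (metis kn mult.assoc)
  also have "k * (n * n) = n * n * n" by (simp add: nn mult.assoc flip: kn)
  finally have n3: "cstar_pos (- (star b * b))" by (simp add: sbb)
  have "cstar_pos (2 *\<^sub>R (re_part b * re_part b + im_part b * im_part b) + - (star b * b))"
    by (intro cstar_pos_add cstar_pos_scaleR cstar_pos_square n3) auto
  also have "2 *\<^sub>R (re_part b * re_part b + im_part b * im_part b) + - (star b * b) = b * star b"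
    by (simp flip: sum_star_mult)
  finally have "b = 0" using n3 by (rule zero_of_opposite_signs)
  then have "n * n * n = 0" using sbb by simp
  then have "(n * n) * (n * n) = 0" by (simp add: mult.assoc)
  then have "n * n = 0" using norm_square_hermitian[of "n * n"] by (simp add: star_mult n)
  then have "n = 0" using norm_square_hermitian[OF n] by simp
  then have "k = h" by (simp add: n_def)
  then show ?thesis using k by (simp add: h_def)
qed

lemma state_of_positive_functional:
  fixes g :: "'a::unital_cstar_algebra \<Rightarrow> real"
  assumes g: "linear g" and pos: "\<And>x. cstar_pos x \<Longrightarrow> 0 \<le> g x" and one: "g 1 = 1"
  obtains \<omega> where "\<omega> \<in> state_space" "\<And>x. star x = x \<Longrightarrow> \<omega> x = complex_of_real (g x)"
proof -
  define \<omega> where "\<omega> x = Complex (g (re_part x)) (g (im_part x))" for x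
  have herm: "\<omega> x = complex_of_real (g x)" if "star x = x" for x
    using that by (simp add: \<omega>_def im_part_hermitian linear_0[OF g] complex_of_real_def)
  have "\<omega> \<in> state_space" unfolding state_space_def
  proof (intro CollectI conjI allI)
    show "\<omega> (a + b) = \<omega> a + \<omega> b" for a b
      by (simp add: \<omega>_def re_part_add im_part_add linear_add[OF g] complex_eq_iff)
    show "\<omega> (c *\<^sub>C a) = c * \<omega> a" for c a
      by (simp add: \<omega>_def re_part_scaleC im_part_scaleC linear_add[OF g] linear_diff[OF g]
          linear_scale[OF g] complex_eq_iff)
    show "\<omega> (star a * a) \<in> \<real>\<^sub>\<ge>\<^sub>0" for a
      using herm[of "star a * a"] pos[OF cstar_pos_star_mult[of a]]
      by (simp add: star_mult star_star)
    show "\<omega> 1 = 1" using herm[of 1] one by simp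
  qed
  then show ?thesis using that herm by blast
qed

lemma state_add: "\<omega> \<in> state_space \<Longrightarrow> \<omega> (a + b) = \<omega> a + \<omega> b"
  and state_scaleC: "\<omega> \<in> state_space \<Longrightarrow> \<omega> (c *\<^sub>C a) = c * \<omega> a"
  and state_star_mult: "\<omega> \<in> state_space \<Longrightarrow> \<omega> (star a * a) \<in> \<real>\<^sub>\<ge>\<^sub>0"
  and state_one: "\<omega> \<in> state_space \<Longrightarrow> \<omega> 1 = 1"
  by (simp_all add: state_space_def)

lemma state_scaleR: "\<omega> \<in> state_space \<Longrightarrow> \<omega> (r *\<^sub>R a) = complex_of_real r * \<omega> a"
  using state_scaleC[of \<omega> "complex_of_real r" a] by (simp add: scaleC_of_real)

lemma state_diff: "\<omega> \<in> state_space \<Longrightarrow> \<omega> (a - b) = \<omega> a - \<omega> b"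
  using state_add[of \<omega> a "- b"] state_scaleR[of \<omega> "-1" b] by simp

lemma state_pos:
  assumes "\<omega> \<in> state_space" "cstar_pos x" shows "\<omega> x \<in> \<real>\<^sub>\<ge>\<^sub>0"
  using cstar_pos_sqrt[OF assms(2)] state_star_mult[OF assms(1)] cstar_pos_hermitian by metis

lemma state_hermitian:
  assumes \<omega>: "\<omega> \<in> state_space" and x: "star x = x"
  shows "Im (\<omega> x) = 0" "\<bar>Re (\<omega> x)\<bar> \<le> norm x"
proof -
  have 1: "\<omega> (norm x *\<^sub>R 1 - x) \<in> \<real>\<^sub>\<ge>\<^sub>0" "\<omega> (norm x *\<^sub>R 1 + x) \<in> \<real>\<^sub>\<ge>\<^sub>0"
    by (intro state_pos[OF \<omega>] cstar_pos_const_diff cstar_pos_const_add x order_refl)+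
  then show "Im (\<omega> x) = 0" "\<bar>Re (\<omega> x)\<bar> \<le> norm x"
    by (auto simp: complex_nonneg_Reals_iff state_diff[OF \<omega>] state_add[OF \<omega>] state_scaleR[OF \<omega>]
        state_one[OF \<omega>])
qed

lemma state_decompose:
  assumes "\<omega> \<in> state_space"
  shows "Re (\<omega> a) = Re (\<omega> (re_part a))" "Im (\<omega> a) = Re (\<omega> (im_part a))"
proof -
  have "\<omega> a = \<omega> (re_part a) + \<i> * \<omega> (im_part a)"
    using state_add[OF assms, of "re_part a" "\<i> *\<^sub>C im_part a"] state_scaleC[OF assms]
    by (simp add: re_part_im_part)
  then show "Re (\<omega> a) = Re (\<omega> (re_part a))" "Im (\<omega> a) = Re (\<omega> (im_part a))"
    using state_hermitian(1)[OF assms] by simp_all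
qed

text \<open>The constant \<open>2\<close> is not optimal; any bound serves for compactness of the state space.\<close>

lemma state_norm_le:
  assumes "\<omega> \<in> state_space" shows "norm (\<omega> a) \<le> 2 * norm a"
proof -
  have "norm (\<omega> a) \<le> \<bar>Re (\<omega> a)\<bar> + \<bar>Im (\<omega> a)\<bar>" by (rule cmod_le)
  also have "\<dots> \<le> norm (re_part a) + norm (im_part a)"
    using state_hermitian(2)[OF assms star_re_part, of a]
      state_hermitian(2)[OF assms star_im_part, of a] state_decompose[OF assms, of a] by linarith
  also have "\<dots> \<le> 2 * norm a" using norm_re_part[of a] norm_im_part[of a] by simp
  finally show ?thesis .
qed

text \<open>A linear \<open>g\<close> with \<open>g \<ge> 0\<close>, \<open>g \<ge> f\<close> and \<open>g 1 = c\<close> satisfies \<open>g b \<le> s * c - f v\<close> for hermitian \<open>b\<close>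
  whenever \<open>v \<ge> 0\<close> and \<open>b + v \<le> s\<close>. Conversely every linear functional below the infimum \<open>q\<close> of
  these bounds is of this kind, and \<open>q\<close> is sublinear. The last clause says that \<open>g a\<close> is not
  smaller than this infimum.\<close>

lemma positive_majorant:
  fixes f :: "'a::unital_cstar_algebra \<Rightarrow> real"
  assumes f: "linear f" and bound: "\<And>x. f x \<le> c * norm x"
  obtains g where "linear g" "\<And>x. cstar_pos x \<Longrightarrow> 0 \<le> g x" "\<And>x. cstar_pos x \<Longrightarrow> f x \<le> g x"
    "g 1 = c"
    "\<And>t. g a < t \<Longrightarrow> \<exists>s v. cstar_pos v \<and> cstar_pos (s *\<^sub>R 1 - v - re_part a) \<and> s * c - f v < t"
proof -
  define S where "S b = {(s, v). cstar_pos v \<and> cstar_pos (s *\<^sub>R 1 - v - re_part b)}" for b :: 'a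
  define q where "q b = (INF (s, v)\<in>S b. s * c - f v)" for b
  have c: "c \<ge> 0" using bound[of 1] bound[of "-1"] linear_neg[OF f, of 1] by simp
  have ne: "S b \<noteq> {}" for b
  proof -
    have "(norm (re_part b), 0) \<in> S b" by (auto simp: S_def intro: cstar_pos_const_diff)
    then show ?thesis by blast
  qed
  have low: "- c * norm b \<le> s * c - f v" if "(s, v) \<in> S b" for s v b
  proof -
    define m where "m = norm (re_part b)"
    have "cstar_pos (m *\<^sub>R 1 + re_part b)"
      by (rule cstar_pos_const_add) (simp_all add: m_def)
    then have "cstar_pos ((s *\<^sub>R 1 - v - re_part b) + (m *\<^sub>R 1 + re_part b))"
      using that by (intro cstar_pos_add[of "s *\<^sub>R 1 - v - re_part b"]) (simp_all add: S_def)
    moreover have "(s *\<^sub>R 1 - v - re_part b) + (m *\<^sub>R 1 + re_part b) = (s + m) *\<^sub>R 1 - v"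
      by (simp add: algebra_simps)
    ultimately have "norm v \<le> s + m"
      using that cstar_pos_le_const(2)[of v "s + m"] by (auto simp: S_def)
    then have "c * norm v \<le> c * (s + norm b)"
      using norm_re_part[of b] c by (intro mult_left_mono) (auto simp: m_def)
    then show ?thesis using bound[of v] by (simp add: algebra_simps)
  qed
  then have bdd: "bdd_below ((\<lambda>(s, v). s * c - f v) ` S b)" for b
    by (intro bdd_belowI2[of _ "- c * norm b"]) auto
  have lower: "q b \<le> s * c - f v" if "cstar_pos v" "cstar_pos (s *\<^sub>R 1 - v - re_part b)" for b s v
    using cINF_lower[OF bdd, of "(s, v)" b] that by (auto simp: q_def S_def)
  have greatest: "r \<le> q b"
    if "\<And>s v. cstar_pos v \<Longrightarrow> cstar_pos (s *\<^sub>R 1 - v - re_part b) \<Longrightarrow> r \<le> s * c - f v" for r b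
    unfolding q_def by (rule cINF_greatest[OF ne]) (use that in \<open>auto simp: S_def\<close>)
  have "sublinear q" unfolding sublinear_def
  proof (intro conjI allI impI)
    fix x y
    have *: "q (x + y) - (s * c - f v) \<le> s' * c - f v'"
      if v: "cstar_pos v" "cstar_pos (s *\<^sub>R 1 - v - re_part y)"
        and v': "cstar_pos v'" "cstar_pos (s' *\<^sub>R 1 - v' - re_part x)" for s v s' v'
    proof -
      have "cstar_pos ((s *\<^sub>R 1 - v - re_part y) + (s' *\<^sub>R 1 - v' - re_part x))"
        using v v' by (intro cstar_pos_add)
      moreover have "(s *\<^sub>R 1 - v - re_part y) + (s' *\<^sub>R 1 - v' - re_part x) =
          (s + s') *\<^sub>R 1 - (v + v') - re_part (x + y)"
        by (simp add: re_part_add algebra_simps)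
      ultimately have "q (x + y) \<le> (s + s') * c - f (v + v')"
        using v v' by (intro lower cstar_pos_add) auto
      then show ?thesis by (simp add: linear_add[OF f] algebra_simps)
    qed
    have "q (x + y) - (s * c - f v) \<le> q x"
      if "cstar_pos v" "cstar_pos (s *\<^sub>R 1 - v - re_part y)" for s v
      by (rule greatest) (rule *[OF that])
    then have "q (x + y) - q x \<le> q y" by (intro greatest) (simp add: algebra_simps)
    then show "q (x + y) \<le> q x + q y" by simp
  next
    fix t :: real and x assume t: "t > 0"
    have "(1/t) * q (t *\<^sub>R x) \<le> q x"
    proof (rule greatest)
      fix s v assume v: "cstar_pos v" "cstar_pos (s *\<^sub>R 1 - v - re_part x)"
      have "cstar_pos (t *\<^sub>R (s *\<^sub>R 1 - v - re_part x))"
        using v t by (intro cstar_pos_scaleR) auto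
      then have "q (t *\<^sub>R x) \<le> (t * s) * c - f (t *\<^sub>R v)"
        using v t by (intro lower cstar_pos_scaleR) (auto simp: re_part_scaleR algebra_simps)
      then show "(1/t) * q (t *\<^sub>R x) \<le> s * c - f v"
        using t by (simp add: linear_scale[OF f] field_simps)
    qed
    then show "q (t *\<^sub>R x) \<le> t * q x" using t by (simp add: field_simps)
  qed
  then obtain g where g: "linear g" "\<And>x. g x \<le> q x" "g a = q a"
    using Hahn_Banach_sublinear by blast
  have neg: "- g x \<le> q (- x)" for x using g(2)[of "- x"] linear_neg[OF g(1)] by simp
  have 1: "0 \<le> g x" if "cstar_pos x" for x
    using neg[of x] lower[of 0 0 "- x"] that cstar_pos_hermitian[OF that] linear_0[OF f]
    by (simp add: re_part_minus)
  have 2: "f x \<le> g x" if "cstar_pos x" for x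
    using neg[of x] lower[of x 0 "- x"] that cstar_pos_hermitian[OF that]
    by (simp add: re_part_minus)
  have "g 1 \<le> c" using g(2)[of 1] lower[of 0 1 1] linear_0[OF f] by simp
  moreover have "- g 1 \<le> - c"
    using neg[of 1] lower[of 0 "-1" "- 1"] linear_0[OF f] by (simp add: re_part_minus)
  ultimately have 3: "g 1 = c" by simp
  have 4: "\<exists>s v. cstar_pos v \<and> cstar_pos (s *\<^sub>R 1 - v - re_part a) \<and> s * c - f v < t" if "g a < t" for t
  proof -
    have "(INF (s, v)\<in>S a. s * c - f v) < t" using that g(3) by (simp add: q_def)
    then obtain x where "x \<in> S a" "(case x of (s, v) \<Rightarrow> s * c - f v) < t"
      using cINF_less_iff[OF ne bdd] by blast
    then show ?thesis by (auto simp: S_def)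
  qed
  show ?thesis by (rule that[OF g(1) 1 2 3 4])
qed

text \<open>Both \<open>g\<close> and \<open>g - f\<close> are positive with value \<open>c\<close> at \<open>1\<close>, where \<open>g\<close> is a positive majorant of \<open>f\<close>.
  The functional \<open>f\<close> is real linear, so only its values on hermitian elements are described.\<close>

theorem Jordan_decomposition_states:
  fixes f :: "'a::unital_cstar_algebra \<Rightarrow> real"
  assumes f: "linear f" and bound: "\<And>x. f x \<le> c * norm x" and c: "c > 0" and f1: "f 1 = 0"
  obtains \<phi> \<psi> where "\<phi> \<in> state_space" "\<psi> \<in> state_space"
    "\<And>x. star x = x \<Longrightarrow> f x = c * Re (\<phi> x - \<psi> x)"
proof -
  obtain g where g: "linear g" "\<And>x. cstar_pos x \<Longrightarrow> 0 \<le> g x" "\<And>x. cstar_pos x \<Longrightarrow> f x \<le> g x"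
    "g 1 = c"
    using positive_majorant[OF f bound] by metis
  have lin: "linear (\<lambda>x. g x / c)" "linear (\<lambda>x. (g x - f x) / c)"
    by (auto intro!: linearI simp: linear_add[OF g(1)] linear_add[OF f] linear_scale[OF g(1)]
        linear_scale[OF f] add_divide_distrib diff_divide_distrib algebra_simps)
  obtain \<phi> where \<phi>: "\<phi> \<in> state_space" "\<And>x. star x = x \<Longrightarrow> \<phi> x = complex_of_real (g x / c)"
    using state_of_positive_functional[OF lin(1)] g c by auto
  obtain \<psi> where \<psi>: "\<psi> \<in> state_space" "\<And>x. star x = x \<Longrightarrow> \<psi> x = complex_of_real ((g x - f x) / c)"
    using state_of_positive_functional[OF lin(2)] g c f1 by auto
  have "f x = c * Re (\<phi> x - \<psi> x)" if "star x = x" for x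
    using \<phi>(2)[OF that] \<psi>(2)[OF that] c by (simp add: diff_divide_distrib)
  then show ?thesis using that \<phi>(1) \<psi>(1) by blast
qed

text \<open>Some state takes at \<open>x\<close> the value \<open>Inf {t. x \<le> t}\<close>; it comes from a positive majorant of \<open>0\<close>.\<close>

lemma state_attaining_upper_bound:
  assumes x: "star x = x"
  obtains \<omega> where "\<omega> \<in> state_space" "\<And>t. Re (\<omega> x) < t \<Longrightarrow> cstar_pos (t *\<^sub>R 1 - x)"
proof -
  obtain g where g: "linear g" "\<And>y. cstar_pos y \<Longrightarrow> 0 \<le> g y" "g 1 = 1"
    and gx: "\<And>t. g x < t \<Longrightarrow> \<exists>s v. cstar_pos v \<and> cstar_pos (s *\<^sub>R 1 - v - re_part x) \<and> s * 1 - (0::real) < t"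
    using positive_majorant[of "\<lambda>_. 0" 1 x] by (auto simp: linear_zero)
  obtain \<omega> where \<omega>: "\<omega> \<in> state_space" "\<And>x. star x = x \<Longrightarrow> \<omega> x = complex_of_real (g x)"
    using state_of_positive_functional[OF g] by blast
  have "cstar_pos (t *\<^sub>R 1 - x)" if "Re (\<omega> x) < t" for t
  proof -
    have "g x < t" using that \<omega>(2)[OF x] by simp
    then have "\<exists>s v. cstar_pos v \<and> cstar_pos (s *\<^sub>R 1 - v - x) \<and> s < t"
      using gx[of t] x by simp
    then obtain s v where v: "cstar_pos v" "cstar_pos (s *\<^sub>R 1 - v - x)" "s < t"
      by blast
    have "cstar_pos ((s *\<^sub>R 1 - v - x) + v + (t - s) *\<^sub>R 1)"
      using v by (intro cstar_pos_add) (auto simp: cstar_pos_const)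
    moreover have "(s *\<^sub>R 1 - v - x) + v + (t - s) *\<^sub>R 1 = t *\<^sub>R 1 - x" by (simp add: algebra_simps)
    ultimately show ?thesis by (simp only:)
  qed
  then show ?thesis using that \<omega>(1) by blast
qed

lemma norm_diff_scalar_le_spread:
  fixes x :: "'a::unital_cstar_algebra"
  assumes x: "star x = x"
    and spread: "\<And>\<phi> \<psi>. \<phi> \<in> state_space \<Longrightarrow> \<psi> \<in> state_space \<Longrightarrow> Re (\<phi> x - \<psi> x) \<le> \<delta>"
  obtains l :: real where "norm (x - l *\<^sub>R 1) \<le> \<delta>"
proof -
  have mx: "star (- x) = - x" by (simp add: star_minus x)
  obtain \<phi> where \<phi>: "\<phi> \<in> state_space" "\<And>t. Re (\<phi> x) < t \<Longrightarrow> cstar_pos (t *\<^sub>R 1 - x)"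
    using state_attaining_upper_bound[OF x] by blast
  obtain \<psi> where \<psi>: "\<psi> \<in> state_space" "\<And>t. Re (\<psi> (- x)) < t \<Longrightarrow> cstar_pos (t *\<^sub>R 1 - (- x))"
    using state_attaining_upper_bound[OF mx] by blast
  have neg: "Re (\<psi> (- x)) = - Re (\<psi> x)" using state_scaleR[OF \<psi>(1), of "-1" x] by simp
  define l where "l = Re (\<phi> x)"
  have \<delta>: "0 \<le> \<delta>" using spread[OF \<phi>(1) \<phi>(1)] by simp
  have \<phi>\<psi>: "l - Re (\<psi> x) \<le> \<delta>" using spread[OF \<phi>(1) \<psi>(1)] by (simp add: l_def)
  have "norm (x - l *\<^sub>R 1) \<le> \<delta> + \<epsilon>" if \<epsilon>: "\<epsilon> > 0" for \<epsilon>
  proof (rule norm_le_of_positive)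
    have "cstar_pos ((l + (\<delta> + \<epsilon>)) *\<^sub>R 1 - x)" by (rule \<phi>(2)) (use \<epsilon> \<delta> in \<open>simp add: l_def\<close>)
    then show "cstar_pos ((\<delta> + \<epsilon>) *\<^sub>R 1 - (x - l *\<^sub>R 1))" by (simp add: algebra_simps)
    have "cstar_pos ((\<delta> + \<epsilon> - l) *\<^sub>R 1 - (- x))" by (rule \<psi>(2)) (use \<epsilon> \<phi>\<psi> neg in simp)
    then show "cstar_pos ((\<delta> + \<epsilon>) *\<^sub>R 1 + (x - l *\<^sub>R 1))" by (simp add: algebra_simps)
  qed
  then have "norm (x - l *\<^sub>R 1) \<le> \<delta>" by (rule field_le_epsilon)
  then show ?thesis by (rule that)
qed

lemma norm_diff_complex_scalar_le_spread:
  fixes a :: "'a::unital_cstar_algebra"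
  assumes spread: "\<And>\<phi> \<psi>. \<phi> \<in> state_space \<Longrightarrow> \<psi> \<in> state_space \<Longrightarrow> cmod (\<phi> a - \<psi> a) \<le> \<delta>"
  obtains c where "norm (a - c *\<^sub>C 1) \<le> 2 * \<delta>"
proof -
  have "Re (\<phi> (re_part a) - \<psi> (re_part a)) \<le> \<delta>" "Re (\<phi> (im_part a) - \<psi> (im_part a)) \<le> \<delta>"
    if "\<phi> \<in> state_space" "\<psi> \<in> state_space" for \<phi> \<psi>
    using spread[OF that] abs_Re_le_cmod[of "\<phi> a - \<psi> a"] abs_Im_le_cmod[of "\<phi> a - \<psi> a"]
    by (simp_all add: state_decompose[OF that(1), of a] state_decompose[OF that(2), of a])
  then obtain l m :: real where 1: "norm (re_part a - l *\<^sub>R 1) \<le> \<delta>" "norm (im_part a - m *\<^sub>R 1) \<le> \<delta>"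
    using norm_diff_scalar_le_spread[OF star_re_part] norm_diff_scalar_le_spread[OF star_im_part]
    by metis
  have "a - Complex l m *\<^sub>C 1 = (re_part a - l *\<^sub>R 1) + \<i> *\<^sub>C (im_part a - m *\<^sub>R 1)"
    by (subst re_part_im_part[of a, symmetric], subst scaleC_decompose)
       (simp add: scaleC_diff_right scaleC_scaleR)
  then have "norm (a - Complex l m *\<^sub>C 1) \<le> 2 * \<delta>"
    using 1 norm_triangle_ineq[of "re_part a - l *\<^sub>R 1" "\<i> *\<^sub>C (im_part a - m *\<^sub>R 1)"]
    by (simp add: norm_scaleC)
  then show ?thesis by (rule that)
qed

lemma compact_state_space: "compact (state_space :: ('a::unital_cstar_algebra \<Rightarrow> complex) set)"
proof -
  let ?K = "PiE UNIV (\<lambda>a::'a. cball (0::complex) (2 * norm a))"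
  have "compactin (product_topology (\<lambda>_. euclidean) UNIV) ?K"
    by (subst compactin_PiE) (auto simp: compactin_euclidean_iff)
  then have K: "compact ?K" by (simp add: euclidean_product_topology flip: compactin_euclidean_iff)
  have cont: "continuous_on UNIV (\<lambda>\<omega>::'a \<Rightarrow> complex. \<omega> a)" for a
    by (rule continuous_on_product_coordinates)
  have "state_space = {\<omega>::'a \<Rightarrow> complex. \<forall>a b. \<omega> (a + b) = \<omega> a + \<omega> b} \<inter>
      {\<omega>. \<forall>c a. \<omega> (c *\<^sub>C a) = c * \<omega> a} \<inter>
      {\<omega>. \<forall>a. 0 \<le> Re (\<omega> (star a * a)) \<and> Im (\<omega> (star a * a)) = 0} \<inter> {\<omega>. \<omega> 1 = 1}"
    by (auto simp: state_space_def complex_nonneg_Reals_iff)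
  moreover have "closed \<dots>"
    by (intro closed_Int closed_Collect_all closed_Collect_eq closed_Collect_conj closed_Collect_le
        continuous_intros cont)
  ultimately have "closed (state_space :: ('a \<Rightarrow> complex) set)" by simp
  moreover have "state_space \<subseteq> ?K" using state_norm_le by (auto simp: PiE_def)
  ultimately show ?thesis using K by (metis compact_Int_closed inf.absorb_iff2)
qed

section \<open>Lipschitz seminorms and isometric actions\<close>

text \<open>A dense unital *-subalgebra with a Lipschitz seminorm on it. Lower semicontinuity, closedness
  and star-invariance are hypotheses of the individual results.\<close>

locale lipschitz_space =
  fixes \<A> :: "'a::unital_cstar_algebra set" and L :: "'a \<Rightarrow> real"
  assumes subalgebra: "dense_unital_star_subalgebra \<A>"
    and seminorm: "lipschitz_seminorm \<A> L"
begin

lemma zero_mem [simp]: "0 \<in> \<A>"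
  and one_mem [simp]: "1 \<in> \<A>"
  and add_mem: "a \<in> \<A> \<Longrightarrow> b \<in> \<A> \<Longrightarrow> a + b \<in> \<A>"
  and scaleC_mem: "a \<in> \<A> \<Longrightarrow> c *\<^sub>C a \<in> \<A>"
  and star_mem: "a \<in> \<A> \<Longrightarrow> star a \<in> \<A>"
  using subalgebra
  by (auto simp: dense_unital_star_subalgebra_def dense_star_subalgebra_def star_subalgebra_def)

lemma scaleR_mem: "a \<in> \<A> \<Longrightarrow> r *\<^sub>R a \<in> \<A>"
  using scaleC_mem[of a "complex_of_real r"] by (simp add: scaleC_of_real)

lemma minus_mem: "a \<in> \<A> \<Longrightarrow> - a \<in> \<A>"
  using scaleR_mem[of a "-1"] by simp

lemma diff_mem: "a \<in> \<A> \<Longrightarrow> b \<in> \<A> \<Longrightarrow> a - b \<in> \<A>"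
  using add_mem[of a "- b"] minus_mem by simp

lemma re_part_mem: "a \<in> \<A> \<Longrightarrow> re_part a \<in> \<A>"
  by (simp add: re_part_def scaleR_mem add_mem star_mem)

lemma im_part_mem: "a \<in> \<A> \<Longrightarrow> im_part a \<in> \<A>"
  by (simp add: im_part_def re_part_mem scaleC_mem)

lemma L_nonneg: "a \<in> \<A> \<Longrightarrow> 0 \<le> L a"
  and L_add: "a \<in> \<A> \<Longrightarrow> b \<in> \<A> \<Longrightarrow> L (a + b) \<le> L a + L b"
  and L_scaleC: "a \<in> \<A> \<Longrightarrow> L (c *\<^sub>C a) = cmod c * L a"
  and L_one [simp]: "L 1 = 0"
  using seminorm by (auto simp: lipschitz_seminorm_def)

lemma L_scaleR: "a \<in> \<A> \<Longrightarrow> L (r *\<^sub>R a) = \<bar>r\<bar> * L a"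
  using L_scaleC[of a "complex_of_real r"] by (simp add: scaleC_of_real)

lemma L_zero [simp]: "L 0 = 0"
  using L_scaleR[of 0 0] by simp

lemma L_minus: "a \<in> \<A> \<Longrightarrow> L (- a) = L a"
  using L_scaleR[of a "-1"] by simp

lemma L_diff: "a \<in> \<A> \<Longrightarrow> b \<in> \<A> \<Longrightarrow> L (a - b) \<le> L a + L b"
  using L_add[of a "- b"] by (simp add: minus_mem L_minus)

lemma L_re_part:
  assumes "star_invariant_seminorm \<A> L" "a \<in> \<A>" shows "L (re_part a) \<le> L a"
  using L_add[of a "star a"] assms
  by (simp add: re_part_def L_scaleR add_mem star_mem star_invariant_seminorm_def)

lemma dist_L_ge:
  assumes "edist_L \<A> L \<phi> \<psi> < \<infinity>" "a \<in> \<A>" "L a \<le> 1"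
  shows "cmod (\<phi> a - \<psi> a) \<le> dist_L \<A> L \<phi> \<psi>"
proof -
  have "ennreal (cmod (\<phi> a - \<psi> a)) \<le> edist_L \<A> L \<phi> \<psi>"
    unfolding edist_L_def using assms by (intro SUP_upper) auto
  then have "enn2real (ennreal (cmod (\<phi> a - \<psi> a))) \<le> dist_L \<A> L \<phi> \<psi>"
    unfolding dist_L_def using assms by (intro enn2real_mono) auto
  then show ?thesis by simp
qed

lemma dist_L_le:
  assumes "\<And>a. a \<in> \<A> \<Longrightarrow> L a \<le> 1 \<Longrightarrow> cmod (\<phi> a - \<psi> a) \<le> r"
  shows "dist_L \<A> L \<phi> \<psi> \<le> r"
proof -
  have r: "0 \<le> r" using order_trans[OF norm_ge_zero assms[of 0]] by simp
  have "edist_L \<A> L \<phi> \<psi> \<le> ennreal r"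
    unfolding edist_L_def using assms by (intro SUP_least) (auto intro: ennreal_leI)
  then have "enn2real (edist_L \<A> L \<phi> \<psi>) \<le> enn2real (ennreal r)"
    by (intro enn2real_mono) auto
  then show ?thesis using r by (simp add: dist_L_def)
qed

lemma dist_L_nonneg: "0 \<le> dist_L \<A> L \<phi> \<psi>"
  by (simp add: dist_L_def)

lemma state_diff_le_dist_L:
  assumes fin: "edist_L \<A> L \<phi> \<psi> < \<infinity>" and a: "a \<in> \<A>"
    and states: "\<phi> \<in> state_space" "\<psi> \<in> state_space"
  shows "cmod (\<phi> a - \<psi> a) \<le> L a * dist_L \<A> L \<phi> \<psi>"
proof -
  let ?d = "dist_L \<A> L \<phi> \<psi>"
  have *: "cmod (\<phi> a - \<psi> a) \<le> r * ?d" if r: "r > L a" for r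
  proof -
    have r0: "r > 0" using L_nonneg[OF a] r by simp
    have "cmod (\<phi> ((1/r) *\<^sub>R a) - \<psi> ((1/r) *\<^sub>R a)) \<le> ?d"
      by (rule dist_L_ge[OF fin scaleR_mem[OF a]]) (use a r r0 in \<open>simp add: L_scaleR\<close>)
    also have "\<phi> ((1/r) *\<^sub>R a) - \<psi> ((1/r) *\<^sub>R a) = complex_of_real (1/r) * (\<phi> a - \<psi> a)"
      by (simp add: state_scaleR states right_diff_distrib del: of_real_divide)
    finally have "(1/r) * cmod (\<phi> a - \<psi> a) \<le> ?d"
      using r0 by (simp add: norm_mult del: of_real_divide)
    then show ?thesis using r0 by (simp add: field_simps)
  qed
  show ?thesis
  proof (rule field_le_epsilon)
    fix e :: real assume e: "e > 0"
    define r where "r = L a + e / (?d + 1)"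
    have d1: "?d + 1 > 0" using dist_L_nonneg[of \<phi> \<psi>] by linarith
    then have "r > L a" using e by (simp add: r_def)
    then have "cmod (\<phi> a - \<psi> a) \<le> r * ?d" by (rule *)
    also have "\<dots> = L a * ?d + e * (?d / (?d + 1))" by (simp add: r_def algebra_simps)
    also have "\<dots> \<le> L a * ?d + e * 1"
      using e d1 by (intro add_left_mono mult_left_mono) (auto simp: divide_le_eq)
    finally show "cmod (\<phi> a - \<psi> a) \<le> L a * ?d + e" by simp
  qed
qed

lemma lsc_separation:
  assumes lsc: "lsc_seminorm \<A> L" and a: "a \<in> \<A>" and s: "0 < s" "s < L a"
  obtains \<eta> where "\<eta> > 0" "\<And>b. b \<in> \<A> \<Longrightarrow> L b \<le> s \<Longrightarrow> \<eta> \<le> norm (a - b)"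
proof -
  obtain r where r: "r > 0" "closedin (top_of_set \<A>) {a\<in>\<A>. L a \<le> r}"
    using lsc by (auto simp: lsc_seminorm_def)
  define t where "t = r / s"
  have t: "t > 0" using r s by (simp add: t_def)
  obtain T where T: "closed T" "{a\<in>\<A>. L a \<le> r} = \<A> \<inter> T"
    using r(2) by (auto simp: closedin_closed)
  have T_iff: "b \<in> T \<longleftrightarrow> L b \<le> r" if "b \<in> \<A>" for b
    using T(2) that by blast
  have "L (t *\<^sub>R a) > r" using a t s r by (simp add: L_scaleR t_def field_simps)
  then have "t *\<^sub>R a \<notin> T" using T_iff[OF scaleR_mem[OF a]] by simp
  then obtain \<epsilon> where \<epsilon>: "\<epsilon> > 0" "\<And>y. dist y (t *\<^sub>R a) < \<epsilon> \<Longrightarrow> y \<notin> T"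
    using T(1) unfolding closed_def open_dist by blast
  have "\<epsilon> / t \<le> norm (a - b)" if b: "b \<in> \<A>" "L b \<le> s" for b
  proof (rule ccontr)
    assume "\<not> \<epsilon> / t \<le> norm (a - b)"
    then have "t * norm (b - a) < \<epsilon>"
      using t by (simp add: norm_minus_commute[of b a] field_simps)
    then have "dist (t *\<^sub>R b) (t *\<^sub>R a) < \<epsilon>"
      using t by (simp add: dist_norm flip: scaleR_diff_right)
    then have "t *\<^sub>R b \<notin> T" by (rule \<epsilon>(2))
    then have "L (t *\<^sub>R b) > r" using T_iff[OF scaleR_mem[OF b(1)]] by simp
    moreover have "t * L b \<le> t * s" using b t by (intro mult_left_mono) auto
    ultimately show False using b t s r by (simp add: L_scaleR t_def)
  qed
  then show ?thesis using that[of "\<epsilon> / t"] \<epsilon>(1) t by simp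
qed

text \<open>The functional is found below the infimal convolution of \<open>L\<close> and \<open>c\<close> times the norm.\<close>

lemma separating_functional:
  assumes a: "a \<in> \<A>" and c: "c \<ge> 0" and far: "\<And>b. b \<in> \<A> \<Longrightarrow> s \<le> L b + c * norm (a - b)"
  obtains f where "linear f" "\<And>x. f x \<le> c * norm x" "\<And>b. b \<in> \<A> \<Longrightarrow> f b \<le> L b" "s \<le> f a"
proof -
  define p where "p x = (INF b\<in>\<A>. L b + c * norm (x - b))" for x
  have ne: "\<A> \<noteq> {}" using zero_mem by blast
  have bdd: "bdd_below ((\<lambda>b. L b + c * norm (x - b)) ` \<A>)" for x
    by (rule bdd_belowI2[of _ 0]) (use L_nonneg c in simp)
  have lower: "p x \<le> L b + c * norm (x - b)" if "b \<in> \<A>" for x b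
    unfolding p_def by (rule cINF_lower[OF bdd that])
  have greatest: "r \<le> p x" if "\<And>b. b \<in> \<A> \<Longrightarrow> r \<le> L b + c * norm (x - b)" for r x
    unfolding p_def by (rule cINF_greatest[OF ne that])
  have "sublinear p" unfolding sublinear_def
  proof (intro conjI allI impI)
    fix x y
    have *: "p (x + y) - (L b + c * norm (y - b)) \<le> L b' + c * norm (x - b')"
      if "b \<in> \<A>" "b' \<in> \<A>" for b b'
    proof -
      have "p (x + y) \<le> L (b + b') + c * norm ((y - b) + (x - b'))"
        using lower[of "b + b'" "x + y"] that by (simp add: add_mem algebra_simps)
      also have "\<dots> \<le> (L b + L b') + c * (norm (y - b) + norm (x - b'))"
        using that c by (intro add_mono L_add mult_left_mono norm_triangle_ineq)
      finally show ?thesis by (simp add: algebra_simps)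
    qed
    have "p (x + y) - (L b + c * norm (y - b)) \<le> p x" if "b \<in> \<A>" for b
      by (rule greatest) (rule *[OF that])
    then have "p (x + y) - p x \<le> p y" by (intro greatest) (simp add: algebra_simps)
    then show "p (x + y) \<le> p x + p y" by simp
  next
    fix t :: real and x assume t: "t > 0"
    have "(1/t) * p (t *\<^sub>R x) \<le> p x"
    proof (rule greatest)
      fix b assume b: "b \<in> \<A>"
      have "norm (t *\<^sub>R x - t *\<^sub>R b) = t * norm (x - b)"
        using t by (simp flip: scaleR_diff_right)
      then have "p (t *\<^sub>R x) \<le> L (t *\<^sub>R b) + c * (t * norm (x - b))"
        using lower[OF scaleR_mem[OF b, of t], of "t *\<^sub>R x"] by simp
      then show "(1/t) * p (t *\<^sub>R x) \<le> L b + c * norm (x - b)"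
        using t b by (simp add: L_scaleR field_simps)
    qed
    then show "p (t *\<^sub>R x) \<le> t * p x" using t by (simp add: field_simps)
  qed
  then obtain f where f: "linear f" "\<And>x. f x \<le> p x" "f a = p a"
    using Hahn_Banach_sublinear by blast
  have 1: "f x \<le> c * norm x" for x using f(2)[of x] lower[of 0 x] by simp
  have 2: "f b \<le> L b" if "b \<in> \<A>" for b using f(2)[of b] lower[OF that, of b] by simp
  have 3: "s \<le> f a" unfolding f(3) by (rule greatest[OF far])
  show ?thesis by (rule that[OF f(1) 1 2 3])
qed

text \<open>On hermitian elements \<open>L\<close> is dominated by the Lipschitz constant with respect to \<open>dist_L\<close> of the
  function that \<open>x\<close> induces on the state space.\<close>

theorem L_le_of_state_diff_le:
  assumes lsc: "lsc_seminorm \<A> L" and inv: "star_invariant_seminorm \<A> L"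
    and x: "x \<in> \<A>" "star x = x" and s: "0 \<le> s"
    and le: "\<And>\<phi> \<psi>. \<phi> \<in> state_space \<Longrightarrow> \<psi> \<in> state_space \<Longrightarrow>
      Re (\<phi> x - \<psi> x) \<le> s * dist_L \<A> L \<phi> \<psi>"
  shows "L x \<le> s"
proof (rule ccontr)
  assume "\<not> L x \<le> s"
  then obtain s' where s': "s < s'" "s' < L x" using dense[of s "L x"] by auto
  then have s'0: "s' > 0" using s by simp
  obtain \<eta> where \<eta>: "\<eta> > 0" "\<And>b. b \<in> \<A> \<Longrightarrow> L b \<le> s' \<Longrightarrow> \<eta> \<le> norm (x - b)"
    using lsc_separation[OF lsc x(1) s'0 s'(2)] by blast
  \<comment> \<open>With this \<open>c\<close>, an element \<open>b\<close> with \<open>L b \<le> s'\<close> is far enough from \<open>x\<close> to satisfy \<open>far\<close>.\<close>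
  define c where "c = s' / \<eta>"
  have c: "c > 0" using s'0 \<eta> by (simp add: c_def)
  have far: "s' \<le> L b + c * norm (x - b)" if b: "b \<in> \<A>" for b
  proof (cases "L b \<le> s'")
    case True
    then have "c * \<eta> \<le> c * norm (x - b)" using \<eta>(2)[OF b] c by (intro mult_left_mono) auto
    then show ?thesis using L_nonneg[OF b] \<eta>(1) by (simp add: c_def)
  next
    case False
    then show ?thesis using c by (simp add: add_increasing2)
  qed
  obtain f where f: "linear f" "\<And>y. f y \<le> c * norm y" "\<And>b. b \<in> \<A> \<Longrightarrow> f b \<le> L b" "s' \<le> f x"
    using separating_functional[OF x(1) less_imp_le[OF c] far] by blast
  have "f 1 \<le> 0" "- f 1 \<le> 0"
    using f(3)[of 1] f(3)[of "- 1"] linear_neg[OF f(1), of 1] by (simp_all add: minus_mem L_minus)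
  then have f1: "f 1 = 0" by simp
  obtain \<phi> \<psi> where st: "\<phi> \<in> state_space" "\<psi> \<in> state_space"
    and f_eq: "\<And>y. star y = y \<Longrightarrow> f y = c * Re (\<phi> y - \<psi> y)"
    using Jordan_decomposition_states[OF f(1,2) c f1] by blast
  have "dist_L \<A> L \<phi> \<psi> \<le> 1 / c"
  proof (rule dist_L_le)
    fix a assume a: "a \<in> \<A>" "L a \<le> 1"
    define z where "z = \<phi> a - \<psi> a"
    \<comment> \<open>A rotation makes \<open>z\<close> real, so that the hermitian part of \<open>u a\<close> detects its modulus.\<close>
    define u where "u = cnj (sgn z)"
    define y where "y = re_part (u *\<^sub>C a)"
    have uz: "u * z = complex_of_real (cmod z)"
    proof (cases "z = 0")
      case False
      have "cnj z * z = complex_of_real (cmod z) * complex_of_real (cmod z)"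
        using complex_norm_square[of z] by (simp add: power2_eq_square mult.commute)
      then show ?thesis using False by (simp add: u_def sgn_eq)
    qed simp
    have "L y \<le> cmod u * L a"
      using L_re_part[OF inv scaleC_mem[OF a(1)]] a by (simp add: y_def L_scaleC)
    also have "\<dots> \<le> 1 * 1"
      using a L_nonneg by (intro mult_mono) (auto simp: u_def norm_sgn)
    finally have "f y \<le> 1" using f(3)[of y] a by (simp add: y_def re_part_mem scaleC_mem)
    moreover have "f y = c * Re (\<phi> y - \<psi> y)" by (rule f_eq) (simp add: y_def)
    moreover have "Re (\<phi> y - \<psi> y) = Re (u * z)"
      using state_decompose(1)[OF st(1), of "u *\<^sub>C a"] state_decompose(1)[OF st(2), of "u *\<^sub>C a"]
      by (simp add: y_def z_def state_scaleC st algebra_simps)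
    ultimately have "c * cmod z \<le> 1" using uz by simp
    then show "cmod (\<phi> a - \<psi> a) \<le> 1 / c" using c by (simp add: z_def field_simps)
  qed
  then have "s * dist_L \<A> L \<phi> \<psi> \<le> s * (1 / c)" using s by (rule mult_left_mono)
  then have "Re (\<phi> x - \<psi> x) \<le> s / c" using le[OF st] by simp
  then have "c * Re (\<phi> x - \<psi> x) \<le> s" using c by (simp add: field_simps)
  then show False using f(4) f_eq[OF x(2)] s' by simp
qed

lemma compact_quantum_metric_space_bounded:
  assumes "compact_quantum_metric_space \<A> L"
  obtains B where "B \<ge> 0"
    "\<And>\<phi> \<psi>. \<phi> \<in> state_space \<Longrightarrow> \<psi> \<in> state_space \<Longrightarrow> dist_L \<A> L \<phi> \<psi> \<le> B"
proof -
  interpret Metric_space state_space "dist_L \<A> L"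
    using assms by (simp add: compact_quantum_metric_space_def)
  have "mtopology = subtopology euclidean state_space"
    using assms by (simp add: compact_quantum_metric_space_def weak_star_topology_def)
  then have "compactin mtopology state_space"
    by (simp add: compactin_subtopology compact_state_space)
  then have "mbounded state_space" by (rule compactin_imp_mbounded)
  then obtain B where "\<And>\<phi> \<psi>. \<phi> \<in> state_space \<Longrightarrow> \<psi> \<in> state_space \<Longrightarrow> dist_L \<A> L \<phi> \<psi> \<le> B"
    by (auto simp: mbounded_alt)
  then show ?thesis using that[of "max B 0"] by (meson max.cobounded1 max.cobounded2 order_trans)
qed

end

lemma star_automorphism_add: "star_automorphism f \<Longrightarrow> f (x + y) = f x + f y"
  and star_automorphism_scaleC: "star_automorphism f \<Longrightarrow> f (c *\<^sub>C x) = c *\<^sub>C f x"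
  and star_automorphism_mult: "star_automorphism f \<Longrightarrow> f (x * y) = f x * f y"
  and star_automorphism_star: "star_automorphism f \<Longrightarrow> f (star x) = star (f x)"
  and star_automorphism_bij: "star_automorphism f \<Longrightarrow> bij f"
  by (simp_all add: star_automorphism_def complex_linear_def)

lemma star_automorphism_scaleR: "star_automorphism f \<Longrightarrow> f (r *\<^sub>R x) = r *\<^sub>R f x"
  using star_automorphism_scaleC[of f "complex_of_real r" x] by (simp add: scaleC_of_real)

lemma star_automorphism_diff: "star_automorphism f \<Longrightarrow> f (x - y) = f x - f y"
  using star_automorphism_add[of f x "- y"] star_automorphism_scaleR[of f "-1" y] by simp

lemma star_automorphism_one: assumes f: "star_automorphism f" shows "f 1 = 1"
proof -
  obtain y where y: "f y = 1" using star_automorphism_bij[OF f] by (metis bij_pointE)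
  then show ?thesis using star_automorphism_mult[OF f, of 1 y] by simp
qed

lemma star_automorphism_pos:
  assumes f: "star_automorphism f" and x: "cstar_pos x" shows "cstar_pos (f x)"
proof -
  obtain r where r: "cstar_pos r" "r * r = x" using cstar_pos_sqrt[OF x] by blast
  have "star (f r) = f r"
    using star_automorphism_star[OF f, of r] cstar_pos_hermitian[OF r(1)] by simp
  then have "cstar_pos (f r * f r)" by (rule cstar_pos_square)
  then show ?thesis using star_automorphism_mult[OF f, of r r] r by simp
qed

text \<open>Automorphisms preserve positivity, hence the order bounds \<open>- norm y \<le> y \<le> norm y\<close> of a hermitian
  element \<open>y\<close>.\<close>

lemma star_automorphism_norm_le:
  assumes f: "star_automorphism f" shows "norm (f x) \<le> norm x"
proof -
  have herm: "norm (f y) \<le> norm y" if y: "star y = y" for y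
  proof (rule norm_le_of_positive)
    have "cstar_pos (f (norm y *\<^sub>R 1 - y))"
      by (intro star_automorphism_pos[OF f] cstar_pos_const_diff y order_refl)
    then show "cstar_pos (norm y *\<^sub>R 1 - f y)"
      by (simp add: star_automorphism_diff f star_automorphism_scaleR star_automorphism_one)
    have "cstar_pos (f (norm y *\<^sub>R 1 + y))"
      by (intro star_automorphism_pos[OF f] cstar_pos_const_add y order_refl)
    then show "cstar_pos (norm y *\<^sub>R 1 + f y)"
      by (simp add: star_automorphism_add f star_automorphism_scaleR star_automorphism_one)
  qed
  have "(norm (f x))\<^sup>2 = norm (f (star x * x))"
    by (simp add: star_automorphism_mult f star_automorphism_star cstar_identity)
  also have "\<dots> \<le> norm (star x * x)" by (rule herm) (simp add: star_mult star_star)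
  also have "\<dots> = (norm x)\<^sup>2" by (rule cstar_identity)
  finally show ?thesis by (rule power2_le_imp_le) simp
qed

lemma continuous_star_automorphism:
  assumes f: "star_automorphism f" shows "continuous_on S f"
proof -
  have "bounded_linear f"
    by (rule bounded_linear_intro[of _ 1])
       (simp_all add: star_automorphism_add f star_automorphism_scaleR star_automorphism_norm_le)
  then show ?thesis by (rule linear_continuous_on)
qed

lemma state_comp_star_automorphism:
  assumes f: "star_automorphism f" and \<omega>: "\<omega> \<in> state_space" shows "\<omega> \<circ> f \<in> state_space"
  unfolding state_space_def
  using state_add[OF \<omega>] state_scaleC[OF \<omega>] state_star_mult[OF \<omega>] state_one[OF \<omega>]
  by (simp add: star_automorphism_add f star_automorphism_scaleC star_automorphism_mult
      star_automorphism_star star_automorphism_one)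

lemma cstar_action_automorphism: "cstar_action \<Gamma> \<alpha> \<Longrightarrow> g \<in> carrier \<Gamma> \<Longrightarrow> star_automorphism (\<alpha> g)"
  and cstar_action_mult: "cstar_action \<Gamma> \<alpha> \<Longrightarrow> g \<in> carrier \<Gamma> \<Longrightarrow> h \<in> carrier \<Gamma> \<Longrightarrow>
    \<alpha> (g \<otimes>\<^bsub>\<Gamma>\<^esub> h) = \<alpha> g \<circ> \<alpha> h"
  by (simp_all add: cstar_action_def)

lemma cstar_action_one:
  assumes "group \<Gamma>" "cstar_action \<Gamma> \<alpha>" shows "\<alpha> \<one>\<^bsub>\<Gamma>\<^esub> x = x"
proof -
  interpret group \<Gamma> by fact
  have "\<alpha> \<one>\<^bsub>\<Gamma>\<^esub> (\<alpha> \<one>\<^bsub>\<Gamma>\<^esub> x) = \<alpha> \<one>\<^bsub>\<Gamma>\<^esub> x"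
    using cstar_action_mult[OF assms(2), of "\<one>\<^bsub>\<Gamma>\<^esub>" "\<one>\<^bsub>\<Gamma>\<^esub>"] by (simp add: fun_eq_iff)
  moreover have "inj (\<alpha> \<one>\<^bsub>\<Gamma>\<^esub>)"
    using star_automorphism_bij[OF cstar_action_automorphism[OF assms(2)]] by (simp add: bij_def)
  ultimately show ?thesis by (simp add: inj_eq)
qed

context lipschitz_space
begin

text \<open>The invariant metric is the one induced by the isometric seminorm.\<close>

theorem invariant_metric_of_isometric_seminorm:
  fixes \<Gamma> :: "('g, 'm) monoid_scheme"
  assumes "group \<Gamma>" "compact_quantum_metric_space \<A> L"
    and "has_equivalent_isometric_seminorm \<Gamma> \<alpha> \<A> L"
  shows "has_equivalent_invariant_metric \<Gamma> \<alpha> \<A> L"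
proof -
  interpret group \<Gamma> by fact
  obtain L' C where L': "lipschitz_seminorm \<A> L'" and iso: "isometric_action \<Gamma> \<alpha> \<A> L'" and C: "C > 0"
    and comp: "\<And>a. a \<in> \<A> \<Longrightarrow> L a \<le> L' a \<and> L' a \<le> C * L a"
    using assms(3) by (auto simp: has_equivalent_isometric_seminorm_def)
  interpret L': lipschitz_space \<A> L' by unfold_locales (rule subalgebra L')+
  interpret dL: Metric_space state_space "dist_L \<A> L"
    using assms(2) by (simp add: compact_quantum_metric_space_def)
  \<comment> \<open>\<open>C\<close> may be less than \<open>1\<close>, in which case \<open>L\<close> vanishes; \<open>K\<close> has to work for both inequalities.\<close>
  define K where "K = max 1 C"
  have K: "K \<ge> 1" "C \<le> K" by (simp_all add: K_def)
  have fin: "edist_L \<A> L \<phi> \<psi> < \<infinity>" if "\<phi> \<in> state_space" "\<psi> \<in> state_space" for \<phi> \<psi>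
    using assms(2) that by (simp add: compact_quantum_metric_space_def)
  have fin': "edist_L \<A> L' \<phi> \<psi> < \<infinity>" if "\<phi> \<in> state_space" "\<psi> \<in> state_space" for \<phi> \<psi>
  proof -
    have "edist_L \<A> L' \<phi> \<psi> \<le> edist_L \<A> L \<phi> \<psi>"
      unfolding edist_L_def using comp by (intro SUP_subset_mono) (auto intro: order_trans)
    then show ?thesis using fin[OF that] by (rule le_less_trans)
  qed
  have 1: "dist_L \<A> L' \<phi> \<psi> \<le> dist_L \<A> L \<phi> \<psi>" if "\<phi> \<in> state_space" "\<psi> \<in> state_space" for \<phi> \<psi>
    using comp by (intro L'.dist_L_le dist_L_ge fin that) (auto intro: order_trans)
  have 2: "dist_L \<A> L \<phi> \<psi> \<le> K * dist_L \<A> L' \<phi> \<psi>" if "\<phi> \<in> state_space" "\<psi> \<in> state_space" for \<phi> \<psi>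
  proof (rule dist_L_le)
    fix a assume a: "a \<in> \<A>" "L a \<le> 1"
    have "L' a \<le> C * 1" using comp[OF a(1)] a C mult_left_mono[of "L a" 1 C] by linarith
    then have "L' a \<le> K" using K by simp
    have "cmod (\<phi> a - \<psi> a) \<le> L' a * dist_L \<A> L' \<phi> \<psi>"
      by (rule L'.state_diff_le_dist_L[OF fin'[OF that] a(1) that])
    also have "\<dots> \<le> K * dist_L \<A> L' \<phi> \<psi>"
      by (rule mult_right_mono[OF \<open>L' a \<le> K\<close> L'.dist_L_nonneg])
    finally show "cmod (\<phi> a - \<psi> a) \<le> K * dist_L \<A> L' \<phi> \<psi>" .
  qed
  have metric: "Metric_space state_space (dist_L \<A> L')"
  proof
    show "0 \<le> dist_L \<A> L' \<phi> \<psi>" for \<phi> \<psi> by (rule L'.dist_L_nonneg)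
    show "dist_L \<A> L' \<phi> \<psi> = dist_L \<A> L' \<psi> \<phi>" for \<phi> \<psi>
      by (simp add: dist_L_def edist_L_def norm_minus_commute)
    show "dist_L \<A> L' \<phi> \<psi> = 0 \<longleftrightarrow> \<phi> = \<psi>" if "\<phi> \<in> state_space" "\<psi> \<in> state_space" for \<phi> \<psi>
    proof -
      have "dist_L \<A> L' \<phi> \<psi> = 0 \<longleftrightarrow> dist_L \<A> L \<phi> \<psi> = 0"
        using 1[OF that] 2[OF that] L'.dist_L_nonneg[of \<phi> \<psi>] dist_L_nonneg[of \<phi> \<psi>]
        by (metis antisym mult_zero_right)
      then show ?thesis using that by simp
    qed
    show "dist_L \<A> L' \<phi> \<rho> \<le> dist_L \<A> L' \<phi> \<psi> + dist_L \<A> L' \<psi> \<rho>"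
      if "\<phi> \<in> state_space" "\<psi> \<in> state_space" "\<rho> \<in> state_space" for \<phi> \<psi> \<rho>
    proof (rule L'.dist_L_le)
      fix a assume a: "a \<in> \<A>" "L' a \<le> 1"
      have "cmod (\<phi> a - \<rho> a) \<le> cmod (\<phi> a - \<psi> a) + cmod (\<psi> a - \<rho> a)"
        using norm_triangle_ineq[of "\<phi> a - \<psi> a" "\<psi> a - \<rho> a"] by simp
      also have "\<dots> \<le> dist_L \<A> L' \<phi> \<psi> + dist_L \<A> L' \<psi> \<rho>"
        by (intro add_mono L'.dist_L_ge fin' that a)
      finally show "cmod (\<phi> a - \<rho> a) \<le> dist_L \<A> L' \<phi> \<psi> + dist_L \<A> L' \<psi> \<rho>" .
    qed
  qed
  have inv: "dist_L \<A> L' (dual_action \<Gamma> \<alpha> g \<phi>) (dual_action \<Gamma> \<alpha> g \<psi>) = dist_L \<A> L' \<phi> \<psi>"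
    if g: "g \<in> carrier \<Gamma>" for g \<phi> \<psi>
  proof -
    let ?\<beta> = "\<alpha> (inv\<^bsub>\<Gamma>\<^esub> g)"
    have \<beta>: "?\<beta> ` \<A> = \<A>" "\<And>a. a \<in> \<A> \<Longrightarrow> L' (?\<beta> a) = L' a"
      using iso g by (auto simp: isometric_action_def smooth_action_def)
    have "{a\<in>\<A>. L' a \<le> 1} = ?\<beta> ` {a\<in>\<A>. L' a \<le> 1}"
    proof (intro equalityI subsetI)
      fix a assume a: "a \<in> {a\<in>\<A>. L' a \<le> 1}"
      then obtain b where "b \<in> \<A>" "a = ?\<beta> b" using \<beta>(1) by blast
      then show "a \<in> ?\<beta> ` {a\<in>\<A>. L' a \<le> 1}" using a \<beta>(2) by auto
    qed (use \<beta> in auto)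
    then have "edist_L \<A> L' \<phi> \<psi> =
        (SUP a\<in>?\<beta> ` {a\<in>\<A>. L' a \<le> 1}. ennreal (cmod (\<phi> a - \<psi> a)))"
      unfolding edist_L_def by simp
    also have "\<dots> = edist_L \<A> L' (dual_action \<Gamma> \<alpha> g \<phi>) (dual_action \<Gamma> \<alpha> g \<psi>)"
      by (simp add: edist_L_def dual_action_def image_image)
    finally show ?thesis by (simp add: dist_L_def)
  qed
  have "equivalent_metrics state_space (dist_L \<A> L) (dist_L \<A> L')"
    unfolding equivalent_metrics_def
  proof (intro exI[of _ K] conjI ballI)
    fix \<phi> \<psi> :: "'a \<Rightarrow> complex" assume st: "\<phi> \<in> state_space" "\<psi> \<in> state_space"
    show "1 / K * dist_L \<A> L \<phi> \<psi> \<le> dist_L \<A> L' \<phi> \<psi>"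
      using 2[OF st] K by (simp add: field_simps)
    show "dist_L \<A> L' \<phi> \<psi> \<le> K * dist_L \<A> L \<phi> \<psi>"
      using 1[OF st] mult_right_mono[OF K(1) dist_L_nonneg[of \<phi> \<psi>]] by simp
  qed (use K in simp)
  then show ?thesis using metric inv unfolding has_equivalent_invariant_metric_def by blast
qed

theorem metrically_equicontinuous_of_invariant_metric:
  fixes \<Gamma> :: "('g, 'm) monoid_scheme"
  assumes "group \<Gamma>" and act: "cstar_action \<Gamma> \<alpha>" and smooth: "smooth_action \<Gamma> \<alpha> \<A>"
    and cqms: "compact_quantum_metric_space \<A> L"
    and lsc: "lsc_seminorm \<A> L" and sinv: "star_invariant_seminorm \<A> L"
    and "has_equivalent_invariant_metric \<Gamma> \<alpha> \<A> L"
  shows "metrically_equicontinuous \<Gamma> \<alpha> \<A> L"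
proof -
  interpret group \<Gamma> by fact
  obtain d C where dinv: "\<And>g \<phi> \<psi>. g \<in> carrier \<Gamma> \<Longrightarrow> \<phi> \<in> state_space \<Longrightarrow> \<psi> \<in> state_space \<Longrightarrow>
      d (dual_action \<Gamma> \<alpha> g \<phi>) (dual_action \<Gamma> \<alpha> g \<psi>) = d \<phi> \<psi>"
    and C: "C > 0" and equiv: "\<And>\<phi> \<psi>. \<phi> \<in> state_space \<Longrightarrow> \<psi> \<in> state_space \<Longrightarrow>
      1 / C * dist_L \<A> L \<phi> \<psi> \<le> d \<phi> \<psi> \<and> d \<phi> \<psi> \<le> C * dist_L \<A> L \<phi> \<psi>"
    using assms(7) unfolding has_equivalent_invariant_metric_def equivalent_metrics_def by metis
  have fin: "edist_L \<A> L \<phi> \<psi> < \<infinity>" if "\<phi> \<in> state_space" "\<psi> \<in> state_space" for \<phi> \<psi>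
    using cqms that by (simp add: compact_quantum_metric_space_def)
  have mem: "\<alpha> g a \<in> \<A>" if "g \<in> carrier \<Gamma>" "a \<in> \<A>" for g a
    using smooth that by (auto simp: smooth_action_def)
  have herm: "L (\<alpha> g a) \<le> L a * C\<^sup>2" if g: "g \<in> carrier \<Gamma>" and a: "a \<in> \<A>" "star a = a" for g a
  proof (rule L_le_of_state_diff_le[OF lsc sinv])
    show "\<alpha> g a \<in> \<A>" by (rule mem[OF g a(1)])
    show "star (\<alpha> g a) = \<alpha> g a"
      using star_automorphism_star[OF cstar_action_automorphism[OF act g], of a] a by simp
    show "0 \<le> L a * C\<^sup>2" using L_nonneg[OF a(1)] by simp
    fix \<phi> \<psi> :: "'a \<Rightarrow> complex" assume st: "\<phi> \<in> state_space" "\<psi> \<in> state_space"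
    have st': "\<phi> \<circ> \<alpha> g \<in> state_space" "\<psi> \<circ> \<alpha> g \<in> state_space"
      by (intro state_comp_star_automorphism cstar_action_automorphism[OF act g] st)+
    have "dist_L \<A> L (\<phi> \<circ> \<alpha> g) (\<psi> \<circ> \<alpha> g) \<le> C * d (\<phi> \<circ> \<alpha> g) (\<psi> \<circ> \<alpha> g)"
      using equiv[OF st'] C by (simp add: field_simps)
    also have "d (\<phi> \<circ> \<alpha> g) (\<psi> \<circ> \<alpha> g) = d \<phi> \<psi>"
      using dinv[of "inv\<^bsub>\<Gamma>\<^esub> g", OF _ st] g by (simp add: dual_action_def)
    also have "C * d \<phi> \<psi> \<le> C * (C * dist_L \<A> L \<phi> \<psi>)"
      using equiv[OF st] C by (intro mult_left_mono) auto
    finally have le: "dist_L \<A> L (\<phi> \<circ> \<alpha> g) (\<psi> \<circ> \<alpha> g) \<le> C\<^sup>2 * dist_L \<A> L \<phi> \<psi>"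
      by (simp add: power2_eq_square comp_def mult.assoc)
    have "Re (\<phi> (\<alpha> g a) - \<psi> (\<alpha> g a)) \<le> cmod ((\<phi> \<circ> \<alpha> g) a - (\<psi> \<circ> \<alpha> g) a)"
      by (simp only: o_apply complex_Re_le_cmod)
    also have "\<dots> \<le> L a * dist_L \<A> L (\<phi> \<circ> \<alpha> g) (\<psi> \<circ> \<alpha> g)"
      by (rule state_diff_le_dist_L[OF fin[OF st'] a(1) st'])
    also have "\<dots> \<le> L a * (C\<^sup>2 * dist_L \<A> L \<phi> \<psi>)"
      by (rule mult_left_mono[OF le L_nonneg[OF a(1)]])
    finally show "Re (\<phi> (\<alpha> g a) - \<psi> (\<alpha> g a)) \<le> L a * C\<^sup>2 * dist_L \<A> L \<phi> \<psi>"
      by (simp add: mult.assoc)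
  qed
  have "L (\<alpha> g a) \<le> L (re_part a) * C\<^sup>2 + L (im_part a) * C\<^sup>2"
    if g: "g \<in> carrier \<Gamma>" and a: "a \<in> \<A>" for g a
  proof -
    note aut = cstar_action_automorphism[OF act g]
    have "\<alpha> g a = \<alpha> g (re_part a) + \<i> *\<^sub>C \<alpha> g (im_part a)"
      by (simp add: re_part_im_part flip: star_automorphism_add[OF aut] star_automorphism_scaleC[OF aut])
    then have "L (\<alpha> g a) \<le> L (\<alpha> g (re_part a)) + L (\<alpha> g (im_part a))"
      using L_add[of "\<alpha> g (re_part a)" "\<i> *\<^sub>C \<alpha> g (im_part a)"] L_scaleC[of "\<alpha> g (im_part a)" \<i>]
        mem[OF g re_part_mem[OF a]] mem[OF g im_part_mem[OF a]] by (simp add: scaleC_mem)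
    then show ?thesis
      using herm[OF g re_part_mem[OF a]] herm[OF g im_part_mem[OF a]] by simp
  qed
  then show ?thesis
    unfolding metrically_equicontinuous_def using smooth by (auto intro!: bdd_aboveI2)
qed

lemma closed_sublevel:
  assumes cl: "closed_seminorm \<A> L" and s: "s > 0"
  shows "closed {a\<in>\<A>. L a \<le> s}"
proof -
  obtain r where r: "r > 0" "closed {a\<in>\<A>. L a \<le> r}"
    using cl by (auto simp: closed_seminorm_def)
  define t where "t = s / r"
  have t: "t > 0" using r s by (simp add: t_def)
  have "{a\<in>\<A>. L a \<le> s} = (\<lambda>a. t *\<^sub>R a) ` {a\<in>\<A>. L a \<le> r}"
  proof (intro equalityI subsetI)
    fix a assume "a \<in> {a\<in>\<A>. L a \<le> s}"
    then have "(1/t) *\<^sub>R a \<in> {a\<in>\<A>. L a \<le> r}" "a = t *\<^sub>R ((1/t) *\<^sub>R a)"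
      using t r s by (auto simp: scaleR_mem L_scaleR t_def field_simps)
    then show "a \<in> (\<lambda>a. t *\<^sub>R a) ` {a\<in>\<A>. L a \<le> r}" by blast
  next
    fix a assume "a \<in> (\<lambda>a. t *\<^sub>R a) ` {a\<in>\<A>. L a \<le> r}"
    then show "a \<in> {a\<in>\<A>. L a \<le> s}"
      using t r s by (auto simp: scaleR_mem L_scaleR t_def field_simps)
  qed
  then show ?thesis using closed_scaling[OF r(2)] by simp
qed

text \<open>The metric of the norm \<open>norm a + L a\<close> on \<open>\<A>\<close>. It is extended by \<open>0\<close> since \<open>L\<close> is not controlled
  outside \<open>\<A>\<close>, while a metric in the sense of \<open>Metric_space\<close> is nonnegative and symmetric on
  the whole type.\<close>

definition graph_dist :: "'a \<Rightarrow> 'a \<Rightarrow> real" where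
  "graph_dist a b = (if a \<in> \<A> \<and> b \<in> \<A> then norm (a - b) + L (a - b) else 0)"

lemma Metric_space_graph_dist: "Metric_space \<A> graph_dist"
proof
  show "0 \<le> graph_dist a b" for a b by (simp add: graph_dist_def L_nonneg diff_mem)
  show "graph_dist a b = graph_dist b a" for a b
    using L_minus[OF diff_mem, of a b] by (auto simp: graph_dist_def norm_minus_commute)
  show "graph_dist a b = 0 \<longleftrightarrow> a = b" if "a \<in> \<A>" "b \<in> \<A>" for a b
    using L_nonneg[OF diff_mem[OF that]] that by (auto simp: graph_dist_def add_nonneg_eq_0_iff)
  show "graph_dist a c \<le> graph_dist a b + graph_dist b c" if "a \<in> \<A>" "b \<in> \<A>" "c \<in> \<A>" for a b c
    using norm_triangle_ineq[of "a - b" "b - c"]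
      L_add[OF diff_mem[OF that(1,2)] diff_mem[OF that(2,3)]] that
    by (simp add: graph_dist_def)
qed

sublocale graph: Metric_space \<A> graph_dist
  by (rule Metric_space_graph_dist)

lemma limitin_graph_imp_tendsto:
  assumes "limitin graph.mtopology \<sigma> a sequentially" shows "\<sigma> \<longlonglongrightarrow> a"
proof (rule LIMSEQ_I)
  fix e :: real assume "e > 0"
  then obtain N where "\<And>n. n \<ge> N \<Longrightarrow> \<sigma> n \<in> \<A> \<and> graph_dist (\<sigma> n) a < e" and "a \<in> \<A>"
    using assms unfolding graph.limit_metric_sequentially by blast
  then have "norm (\<sigma> n - a) < e" if "n \<ge> N" for n
    using that L_nonneg[OF diff_mem, of "\<sigma> n" a] by (force simp: graph_dist_def)
  then show "\<exists>N. \<forall>n\<ge>N. norm (\<sigma> n - a) < e" by blast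
qed

lemma mcomplete_graph_dist:
  assumes cl: "closed_seminorm \<A> L" shows "graph.mcomplete"
  unfolding graph.mcomplete_def
proof (intro allI impI)
  fix \<sigma> :: "nat \<Rightarrow> 'a" assume C: "graph.MCauchy \<sigma>"
  then have mem: "\<sigma> n \<in> \<A>" for n by (auto simp: graph.MCauchy_def)
  have C': "\<exists>N. \<forall>m\<ge>N. \<forall>n\<ge>N. norm (\<sigma> m - \<sigma> n) + L (\<sigma> m - \<sigma> n) < e" if "e > 0" for e
    using C that mem by (auto simp: graph.MCauchy_def graph_dist_def)
  have "Cauchy \<sigma>"
  proof (rule CauchyI)
    fix e :: real assume "e > 0"
    then obtain N where N: "\<And>m n. m \<ge> N \<Longrightarrow> n \<ge> N \<Longrightarrow> norm (\<sigma> m - \<sigma> n) + L (\<sigma> m - \<sigma> n) < e"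
      using C' by blast
    have "norm (\<sigma> m - \<sigma> n) < e" if "m \<ge> N" "n \<ge> N" for m n
      using N[OF that] L_nonneg[OF diff_mem[OF mem mem], of m n] by linarith
    then show "\<exists>M. \<forall>m\<ge>M. \<forall>n\<ge>M. norm (\<sigma> m - \<sigma> n) < e" by blast
  qed
  then obtain a where a: "\<sigma> \<longlonglongrightarrow> a" using Cauchy_convergent_iff convergent_def by blast
  have tail: "\<exists>N. \<forall>n\<ge>N. \<sigma> n - a \<in> {b\<in>\<A>. L b \<le> e}" if "e > 0" for e
  proof -
    obtain N where N: "\<And>m n. m \<ge> N \<Longrightarrow> n \<ge> N \<Longrightarrow> norm (\<sigma> m - \<sigma> n) + L (\<sigma> m - \<sigma> n) < e"
      using C'[OF \<open>e > 0\<close>] by blast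
    have "\<sigma> n - a \<in> {b\<in>\<A>. L b \<le> e}" if n: "n \<ge> N" for n
    proof (rule Lim_in_closed_set[OF closed_sublevel[OF cl \<open>e > 0\<close>]])
      show "\<forall>\<^sub>F m in sequentially. \<sigma> n - \<sigma> m \<in> {b\<in>\<A>. L b \<le> e}"
        using eventually_ge_at_top[of N]
      proof eventually_elim
        case (elim m)
        then have "L (\<sigma> n - \<sigma> m) \<le> e" using N[OF n elim] norm_ge_zero[of "\<sigma> n - \<sigma> m"] by linarith
        then show ?case using diff_mem[OF mem mem] by simp
      qed
      show "(\<lambda>m. \<sigma> n - \<sigma> m) \<longlonglongrightarrow> \<sigma> n - a" by (intro tendsto_intros a)
    qed simp
    then show ?thesis by blast
  qed
  have aA: "a \<in> \<A>"
  proof -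
    obtain n where "\<sigma> n - a \<in> \<A>" using tail[of 1] by auto
    then show ?thesis using diff_mem[OF mem[of n], of "\<sigma> n - a"] by simp
  qed
  have "limitin graph.mtopology \<sigma> a sequentially"
    unfolding graph.limit_metric_sequentially
  proof (intro conjI allI impI aA)
    fix e :: real assume e: "e > 0"
    obtain N where N: "\<And>n. n \<ge> N \<Longrightarrow> L (\<sigma> n - a) \<le> e / 2" using tail[of "e/2"] e by auto
    obtain M where M: "\<And>n. n \<ge> M \<Longrightarrow> norm (\<sigma> n - a) < e / 2" using LIMSEQ_D[OF a, of "e/2"] e by auto
    have "graph_dist (\<sigma> n) a < e" if "n \<ge> max M N" for n
      using N[of n] M[of n] that mem aA by (simp add: graph_dist_def)
    then show "\<exists>N. \<forall>n\<ge>N. \<sigma> n \<in> \<A> \<and> graph_dist (\<sigma> n) a < e" using mem by blast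
  qed
  then show "\<exists>a. limitin graph.mtopology \<sigma> a sequentially" by blast
qed

text \<open>By the Baire category theorem some sublevel set of \<open>L'\<close> has an interior point \<open>x\<close>; translating
  by \<open>x\<close> bounds \<open>L'\<close> on a ball around \<open>0\<close>.\<close>

lemma seminorm_bounded_by_graph_norm:
  assumes cl: "closed_seminorm \<A> L" and L': "lipschitz_seminorm \<A> L'"
    and closed: "\<And>n::nat. n > 0 \<Longrightarrow> closed {a\<in>\<A>. L' a \<le> real n}"
  obtains M where "M \<ge> 0" "\<And>a. a \<in> \<A> \<Longrightarrow> L' a \<le> M * (norm a + L a)"
proof -
  interpret L': lipschitz_space \<A> L' by unfold_locales (rule subalgebra L')+
  define F where "F n = {a\<in>\<A>. L' a \<le> real (Suc n)}" for n
  have F_closed: "closedin graph.mtopology (F n)" for n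
    unfolding graph.metric_closedin_iff_sequentially_closed
  proof (intro conjI allI impI)
    fix \<sigma> a assume \<sigma>: "range \<sigma> \<subseteq> F n \<and> limitin graph.mtopology \<sigma> a sequentially"
    then show "a \<in> F n"
      using closed_sequentially[OF closed[of "Suc n"], of \<sigma> a] limitin_graph_imp_tendsto[of \<sigma> a]
      by (auto simp: F_def)
  qed (auto simp: F_def)
  have "\<Union>(range F) = \<A>"
  proof (intro equalityI subsetI)
    fix a assume "a \<in> \<A>"
    moreover obtain n where "L' a \<le> real n" using real_arch_simple by blast
    ultimately have "a \<in> F n" by (simp add: F_def)
    then show "a \<in> \<Union>(range F)" by blast
  qed (auto simp: F_def)
  then have "graph.mtopology interior_of \<Union>(range F) = \<A>"
    using interior_of_topspace[of graph.mtopology] by simp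
  then have "graph.mtopology interior_of \<Union>(range F) \<noteq> {}" using zero_mem by blast
  moreover have "countable (range F)" by simp
  ultimately have "\<exists>n. graph.mtopology interior_of F n \<noteq> {}"
    using graph.metric_Baire_category_alt[OF mcomplete_graph_dist[OF cl], of "range F"] F_closed
    by blast
  then obtain n x where x: "x \<in> graph.mtopology interior_of F n" by blast
  moreover have "openin graph.mtopology (graph.mtopology interior_of F n)"
    by (rule openin_interior_of)
  ultimately obtain r where r: "r > 0" "graph.mball x r \<subseteq> graph.mtopology interior_of F n"
    unfolding graph.openin_mtopology by blast
  have r_F: "graph.mball x r \<subseteq> F n" by (rule subset_trans[OF r(2) interior_of_subset])
  have xF: "x \<in> F n" by (rule subsetD[OF interior_of_subset x])
  then have xA: "x \<in> \<A>" by (simp add: F_def)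
  have small: "L' y \<le> 2 * real (Suc n)" if y: "y \<in> \<A>" "norm y + L y < r" for y
  proof -
    have "graph_dist x (x + y) < r"
      using y xA by (simp add: graph_dist_def add_mem L_minus)
    then have "x + y \<in> F n" using r_F xA y by (auto simp: add_mem)
    then have "L' (x + y) \<le> real (Suc n)" "L' x \<le> real (Suc n)" using xF by (auto simp: F_def)
    then show ?thesis using L'.L_diff[OF add_mem[OF xA y(1)] xA] by simp
  qed
  define M where "M = 2 * real (Suc n) / r"
  have M: "M \<ge> 0" using r by (simp add: M_def)
  have "L' y \<le> M * (norm y + L y)" if y: "y \<in> \<A>" for y
  proof -
    have *: "L' y \<le> M * t" if t: "t > norm y + L y" for t
    proof -
      have t0: "t > 0" using t L_nonneg[OF y] norm_ge_zero[of y] by linarith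
      have "norm ((r/t) *\<^sub>R y) + L ((r/t) *\<^sub>R y) = (r/t) * (norm y + L y)"
        using y r t0 by (simp add: L_scaleR distrib_left)
      also have "\<dots> < (r/t) * t" using t t0 r by (intro mult_strict_left_mono) auto
      finally have "L' ((r/t) *\<^sub>R y) \<le> 2 * real (Suc n)"
        using t0 by (intro small scaleR_mem y) simp
      then show ?thesis using t0 r y by (simp add: L'.L_scaleR M_def field_simps)
    qed
    show ?thesis
    proof (rule field_le_epsilon)
      fix e :: real assume e: "e > 0"
      have "L' y \<le> M * (norm y + L y + e / (M + 1))" by (rule *) (use e M in simp)
      also have "\<dots> = M * (norm y + L y) + e * (M / (M + 1))" by (simp add: algebra_simps)
      also have "\<dots> \<le> M * (norm y + L y) + e * 1"
        using e M by (intro add_left_mono mult_left_mono) (auto simp: divide_le_eq)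
      finally show "L' y \<le> M * (norm y + L y) + e" by simp
    qed
  qed
  then show ?thesis using that M by blast
qed

text \<open>\<open>L\<close> and \<open>L'\<close> do not change if a scalar is subtracted from \<open>a\<close>, and by the finite diameter of the
  state space some scalar is within a multiple of \<open>L a\<close> from \<open>a\<close>.\<close>

lemma seminorm_le_of_graph_norm:
  assumes cqms: "compact_quantum_metric_space \<A> L" and L': "lipschitz_seminorm \<A> L'"
    and M: "M \<ge> 0" "\<And>a. a \<in> \<A> \<Longrightarrow> L' a \<le> M * (norm a + L a)"
  obtains C where "C > 0" "\<And>a. a \<in> \<A> \<Longrightarrow> L' a \<le> C * L a"
proof -
  interpret L': lipschitz_space \<A> L' by unfold_locales (rule subalgebra L')+
  obtain B where B: "B \<ge> 0"
    "\<And>\<phi> \<psi>. \<phi> \<in> state_space \<Longrightarrow> \<psi> \<in> state_space \<Longrightarrow> dist_L \<A> L \<phi> \<psi> \<le> B"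
    using compact_quantum_metric_space_bounded[OF cqms] by blast
  have "L' a \<le> (M * (2 * B + 1) + 1) * L a" if a: "a \<in> \<A>" for a
  proof -
    have "cmod (\<phi> a - \<psi> a) \<le> L a * B" if "\<phi> \<in> state_space" "\<psi> \<in> state_space" for \<phi> \<psi>
    proof -
      have "cmod (\<phi> a - \<psi> a) \<le> L a * dist_L \<A> L \<phi> \<psi>"
        by (rule state_diff_le_dist_L[OF _ a that])
           (use cqms that in \<open>simp add: compact_quantum_metric_space_def\<close>)
      also have "\<dots> \<le> L a * B" by (rule mult_left_mono[OF B(2)[OF that] L_nonneg[OF a]])
      finally show ?thesis .
    qed
    then obtain c where c: "norm (a - c *\<^sub>C 1) \<le> 2 * (L a * B)"
      using norm_diff_complex_scalar_le_spread by blast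
    have c1: "c *\<^sub>C 1 \<in> \<A>" by (simp add: scaleC_mem)
    have zero: "L (c *\<^sub>C 1) = 0" "L' (c *\<^sub>C 1) = 0" by (simp_all add: L_scaleC L'.L_scaleC)
    have "L' a \<le> L' (a - c *\<^sub>C 1)"
      using L'.L_add[OF diff_mem[OF a c1] c1] zero by simp
    also have "\<dots> \<le> M * (norm (a - c *\<^sub>C 1) + L (a - c *\<^sub>C 1))" by (rule M(2)[OF diff_mem[OF a c1]])
    also have "\<dots> \<le> M * (2 * (L a * B) + L a)"
      using c L_diff[OF a c1] zero M(1) by (intro mult_left_mono add_mono) auto
    also have "\<dots> \<le> (M * (2 * B + 1) + 1) * L a" using L_nonneg[OF a] by (simp add: algebra_simps)
    finally show ?thesis .
  qed
  moreover have "M * (2 * B + 1) + 1 > 0" using M(1) B(1) by (simp add: add_nonneg_pos)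
  ultimately show ?thesis using that by blast
qed

text \<open>The isometric seminorm is the supremum of \<open>L\<close> along the orbits.\<close>

theorem isometric_seminorm_of_metrically_equicontinuous:
  fixes \<Gamma> :: "('g, 'm) monoid_scheme"
  assumes grp: "group \<Gamma>" and act: "cstar_action \<Gamma> \<alpha>"
    and cqms: "compact_quantum_metric_space \<A> L" and cl: "closed_seminorm \<A> L"
    and equi: "metrically_equicontinuous \<Gamma> \<alpha> \<A> L"
  shows "has_equivalent_isometric_seminorm \<Gamma> \<alpha> \<A> L"
proof -
  interpret group \<Gamma> by fact
  have smooth: "smooth_action \<Gamma> \<alpha> \<A>"
    and bdd: "\<And>a. a \<in> \<A> \<Longrightarrow> bdd_above ((\<lambda>g. L (\<alpha> g a)) ` carrier \<Gamma>)"
    using equi by (auto simp: metrically_equicontinuous_def)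
  have mem: "\<alpha> g a \<in> \<A>" if "g \<in> carrier \<Gamma>" "a \<in> \<A>" for g a
    using smooth that by (auto simp: smooth_action_def)
  have mem_iff: "\<alpha> g a \<in> \<A> \<longleftrightarrow> a \<in> \<A>" if g: "g \<in> carrier \<Gamma>" for g a
  proof
    assume "\<alpha> g a \<in> \<A>"
    then have "\<alpha> (inv\<^bsub>\<Gamma>\<^esub> g) (\<alpha> g a) \<in> \<A>" using g by (intro mem[of "inv\<^bsub>\<Gamma>\<^esub> g"]) auto
    moreover have "\<alpha> (inv\<^bsub>\<Gamma>\<^esub> g) (\<alpha> g a) = a"
      using cstar_action_mult[OF act, of "inv\<^bsub>\<Gamma>\<^esub> g" g] cstar_action_one[OF grp act, of a] g
      by (simp add: fun_eq_iff)
    ultimately show "a \<in> \<A>" by simp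
  qed (rule mem[OF g])
  define L' where "L' a = (SUP g\<in>carrier \<Gamma>. L (\<alpha> g a))" for a
  have upper: "L (\<alpha> g a) \<le> L' a" if "g \<in> carrier \<Gamma>" "a \<in> \<A>" for g a
    unfolding L'_def by (rule cSUP_upper[OF that(1) bdd[OF that(2)]])
  have least: "L' a \<le> r" if "\<And>g. g \<in> carrier \<Gamma> \<Longrightarrow> L (\<alpha> g a) \<le> r" for a r
    unfolding L'_def by (rule cSUP_least) (use that in auto)
  have LL': "L a \<le> L' a" if "a \<in> \<A>" for a
    using upper[OF one_closed that] cstar_action_one[OF grp act, of a] by simp
  have scale_le: "L' (c *\<^sub>C a) \<le> cmod c * L' a" if "a \<in> \<A>" for c a
  proof (rule least)
    fix g assume g: "g \<in> carrier \<Gamma>"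
    show "L (\<alpha> g (c *\<^sub>C a)) \<le> cmod c * L' a"
      using mult_left_mono[OF upper[OF g that], of "cmod c"] mem[OF g that]
      by (simp add: star_automorphism_scaleC[OF cstar_action_automorphism[OF act g]] L_scaleC)
  qed
  have L': "lipschitz_seminorm \<A> L'" unfolding lipschitz_seminorm_def
  proof (intro conjI ballI allI)
    show "0 \<le> L' a" if "a \<in> \<A>" for a using LL'[OF that] L_nonneg[OF that] by simp
    show "L' (a + b) \<le> L' a + L' b" if "a \<in> \<A>" "b \<in> \<A>" for a b
    proof (rule least)
      fix g assume g: "g \<in> carrier \<Gamma>"
      have "L (\<alpha> g (a + b)) \<le> L (\<alpha> g a) + L (\<alpha> g b)"
        using L_add[OF mem[OF g that(1)] mem[OF g that(2)]]
        by (simp add: star_automorphism_add[OF cstar_action_automorphism[OF act g]])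
      then show "L (\<alpha> g (a + b)) \<le> L' a + L' b" using upper[OF g that(1)] upper[OF g that(2)] by simp
    qed
    show "L' (c *\<^sub>C a) = cmod c * L' a" if a: "a \<in> \<A>" for c a
    proof (cases "c = 0")
      case True
      have "L' 0 \<le> 0" using scale_le[of 0 0] by simp
      moreover have "0 \<le> L' 0" using LL'[of 0] by simp
      moreover have "0 *\<^sub>C a = 0" using norm_scaleC[of 0 a] by simp
      ultimately show ?thesis using True by simp
    next
      case False
      have "L' ((1/c) *\<^sub>C (c *\<^sub>C a)) \<le> cmod (1/c) * L' (c *\<^sub>C a)"
        by (rule scale_le[OF scaleC_mem[OF a]])
      then have "cmod c * L' a \<le> L' (c *\<^sub>C a)"
        using False by (simp add: scaleC_scaleC norm_divide field_simps)
      then show ?thesis using scale_le[OF a, of c] by simp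
    qed
    have "L' 1 \<le> 0"
      by (rule least) (simp add: star_automorphism_one[OF cstar_action_automorphism[OF act]])
    then show "L' 1 = 0" using LL'[of 1] by simp
  qed
  have iso: "isometric_action \<Gamma> \<alpha> \<A> L'"
  proof -
    have le: "L' (\<alpha> g a) \<le> L' a" if g: "g \<in> carrier \<Gamma>" and a: "a \<in> \<A>" for g a
    proof (rule least)
      fix h assume h: "h \<in> carrier \<Gamma>"
      show "L (\<alpha> h (\<alpha> g a)) \<le> L' a"
        using upper[OF m_closed[OF h g] a] cstar_action_mult[OF act h g] by simp
    qed
    have "L' (\<alpha> g a) = L' a" if g: "g \<in> carrier \<Gamma>" and a: "a \<in> \<A>" for g a
    proof (rule antisym[OF le[OF g a]])
      have "\<alpha> (inv\<^bsub>\<Gamma>\<^esub> g) (\<alpha> g a) = a"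
        using cstar_action_mult[OF act, of "inv\<^bsub>\<Gamma>\<^esub> g" g] cstar_action_one[OF grp act, of a] g
        by (simp add: fun_eq_iff)
      then show "L' a \<le> L' (\<alpha> g a)" using le[OF inv_closed[OF g] mem[OF g a]] by simp
    qed
    then show ?thesis using smooth by (simp add: isometric_action_def)
  qed
  have "closed {a\<in>\<A>. L' a \<le> real n}" if n: "n > 0" for n :: nat
  proof -
    \<comment> \<open>The preimage may be taken in the whole algebra because \<open>\<alpha> g a \<in> \<A>\<close> implies \<open>a \<in> \<A>\<close>.\<close>
    have "{a\<in>\<A>. L' a \<le> real n} = (\<Inter>g\<in>carrier \<Gamma>. \<alpha> g -` {a\<in>\<A>. L a \<le> real n})"
    proof (intro equalityI subsetI)
      fix a assume "a \<in> (\<Inter>g\<in>carrier \<Gamma>. \<alpha> g -` {a\<in>\<A>. L a \<le> real n})"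
      then show "a \<in> {a\<in>\<A>. L' a \<le> real n}"
        using mem_iff[OF one_closed] by (auto intro!: least)
    qed (auto intro: mem order_trans[OF upper])
    moreover have "closed (\<alpha> g -` {a\<in>\<A>. L a \<le> real n})" if g: "g \<in> carrier \<Gamma>" for g
      using closed_vimage[OF closed_sublevel[OF cl]
          continuous_star_automorphism[OF cstar_action_automorphism[OF act g]]] n by simp
    ultimately show ?thesis by (simp add: closed_INT)
  qed
  then obtain M where M: "M \<ge> 0" "\<And>a. a \<in> \<A> \<Longrightarrow> L' a \<le> M * (norm a + L a)"
    using seminorm_bounded_by_graph_norm[OF cl L'] by blast
  obtain C where "C > 0" "\<And>a. a \<in> \<A> \<Longrightarrow> L' a \<le> C * L a"
    using seminorm_le_of_graph_norm[OF cqms L' M] by blast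
  then show ?thesis
    unfolding has_equivalent_isometric_seminorm_def using L' iso LL' by blast
qed

end

section \<open>The Lipschitz algebra of a spectral triple\<close>

lemma cinner_add_right: "cinner x (y + z) = cinner x y + cinner x (z::'h::complex_hilbert)"
  by (subst (1 2 3) cinner_commute) (simp add: cinner_add_left)

lemma cinner_scaleC_right: "cinner x (c *\<^sub>C y) = cnj c * cinner x (y::'h::complex_hilbert)"
  by (subst (1 2) cinner_commute) (simp add: cinner_scaleC_left)

lemma cinner_minus_left: "cinner (- x) y = - cinner x (y::'h::complex_hilbert)"
  using cinner_scaleC_left[of "-1" x y] by (simp add: scaleC_minus1)

lemma cinner_minus_right: "cinner x (- y) = - cinner x (y::'h::complex_hilbert)"
  using cinner_scaleC_right[of x "-1" y] by (simp add: scaleC_minus1)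

lemma cinner_diff_left: "cinner (x - y) z = cinner x z - cinner y (z::'h::complex_hilbert)"
  using cinner_add_left[of x "- y" z] by (simp add: cinner_minus_left)

lemma cinner_scaleR_left: "cinner (r *\<^sub>R x) y = complex_of_real r * cinner x (y::'h::complex_hilbert)"
  using cinner_scaleC_left[of "complex_of_real r" x y] by (simp add: scaleC_of_real)

lemma cinner_scaleR_right: "cinner x (r *\<^sub>R y) = complex_of_real r * cinner x (y::'h::complex_hilbert)"
  using cinner_scaleC_right[of x "complex_of_real r" y] by (simp add: scaleC_of_real)

lemma norm_add_square:
  "(norm (x + y))\<^sup>2 = (norm x)\<^sup>2 + 2 * Re (cinner x y) + (norm (y::'h::complex_hilbert))\<^sup>2"
proof -
  have "cinner (x + y) (x + y) = cinner x x + cinner x y + cnj (cinner x y) + cinner y y"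
    using cinner_commute[of y x] by (simp add: cinner_add_left cinner_add_right)
  then have "Re (cinner (x + y) (x + y)) = Re (cinner x x) + 2 * Re (cinner x y) + Re (cinner y y)"
    by simp
  then show ?thesis by (simp add: cinner_self)
qed

text \<open>The Cauchy-Schwarz inequality, here a consequence of the triangle inequality of the given norm.\<close>

lemma norm_cinner_le: "cmod (cinner x y) \<le> norm x * norm (y::'h::complex_hilbert)"
proof -
  have re: "Re (cinner u y) \<le> norm u * norm y" for u
  proof -
    have "(norm (u + y))\<^sup>2 \<le> (norm u + norm y)\<^sup>2"
      by (intro power_mono norm_triangle_ineq) simp
    then show ?thesis by (simp add: norm_add_square power2_sum)
  qed
  define u where "u = cnj (sgn (cinner x y))"
  have "u * cinner x y = complex_of_real (cmod (cinner x y))"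
  proof (cases "cinner x y = 0")
    case False
    have "cnj (cinner x y) * cinner x y = complex_of_real (cmod (cinner x y)) * complex_of_real (cmod (cinner x y))"
      using complex_norm_square[of "cinner x y"] by (simp add: power2_eq_square mult.commute)
    then show ?thesis using False by (simp add: u_def sgn_eq)
  qed simp
  then have "cmod (cinner x y) = Re (cinner (u *\<^sub>C x) y)" by (simp add: cinner_scaleC_left)
  also have "\<dots> \<le> cmod u * norm x * norm y" using re[of "u *\<^sub>C x"] by (simp add: norm_scaleC)
  also have "\<dots> \<le> 1 * norm x * norm y"
    by (intro mult_right_mono) (auto simp: u_def norm_sgn)
  finally show ?thesis by simp
qed

lemma bounded_linear_cinner_left: "bounded_linear (\<lambda>x. cinner x (y::'h::complex_hilbert))"
  by (rule bounded_linear_intro[of _ "norm y"])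
     (simp_all add: cinner_add_left cinner_scaleR_left scaleR_conv_of_real norm_cinner_le)

lemma bounded_linear_cinner_right: "bounded_linear (\<lambda>y. cinner (x::'h::complex_hilbert) y)"
  by (rule bounded_linear_intro[of _ "norm x"])
     (simp_all add: cinner_add_right cinner_scaleR_right scaleR_conv_of_real norm_cinner_le mult.commute[of _ "norm x"])

lemma linear_coeff_zero:
  fixes a b :: real
  assumes b: "b \<ge> 0" and ge: "\<And>t. 0 \<le> 2 * t * a + t\<^sup>2 * b"
  shows "a = 0"
proof -
  define t where "t = - a / (b + 1)"
  have a: "a = - (t * (b + 1))" using b by (simp add: t_def)
  have "0 \<le> 2 * t * a + t\<^sup>2 * b" by (rule ge)
  also have "\<dots> = - (t\<^sup>2 * (b + 2))" unfolding a by (simp add: algebra_simps power2_eq_square)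
  finally have "t\<^sup>2 * (b + 2) \<le> 0" by simp
  then have "t = 0" using b by (simp add: mult_le_0_iff)
  then show ?thesis using a by simp
qed

text \<open>The subspace need not be closed: a minimizing sequence in \<open>V\<close> of \<open>norm x ^ 2 - 2 * Re (l x)\<close> is
  Cauchy by the parallelogram law, and its limit, possibly outside \<open>V\<close>, represents \<open>l\<close>.\<close>

lemma Riesz_representation_subspace:
  fixes V :: "'h::complex_hilbert set" and l :: "'h \<Rightarrow> complex"
  assumes zero: "0 \<in> V" and add: "\<And>x y. x \<in> V \<Longrightarrow> y \<in> V \<Longrightarrow> x + y \<in> V"
    and scale: "\<And>c x. x \<in> V \<Longrightarrow> c *\<^sub>C x \<in> V"
    and l_add: "\<And>x y. x \<in> V \<Longrightarrow> y \<in> V \<Longrightarrow> l (x + y) = l x + l y"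
    and l_scale: "\<And>c x. x \<in> V \<Longrightarrow> l (c *\<^sub>C x) = c * l x"
    and bound: "\<And>x. x \<in> V \<Longrightarrow> cmod (l x) \<le> M * norm x"
  obtains z where "\<And>x. x \<in> V \<Longrightarrow> cinner x z = l x"
proof -
  have scaleR: "r *\<^sub>R x \<in> V" "l (r *\<^sub>R x) = complex_of_real r * l x" if "x \<in> V" for r x
    using scale[OF that, of "complex_of_real r"] l_scale[OF that, of "complex_of_real r"]
    by (simp_all add: scaleC_of_real)
  define F where "F x = (norm x)\<^sup>2 - 2 * Re (l x)" for x
  define m where "m = (INF x\<in>V. F x)"
  have "- M\<^sup>2 \<le> F x" if "x \<in> V" for x
  proof -
    have "Re (l x) \<le> M * norm x" using bound[OF that] complex_Re_le_cmod[of "l x"] by simp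
    moreover have "0 \<le> (norm x - M)\<^sup>2" by simp
    ultimately show ?thesis by (simp add: F_def power2_diff algebra_simps)
  qed
  then have bdd: "bdd_below (F ` V)" by (intro bdd_belowI2)
  have m_le: "m \<le> F x" if "x \<in> V" for x unfolding m_def by (rule cINF_lower[OF bdd that])
  have "\<exists>x\<in>V. F x < m + inverse (real (Suc n))" for n
  proof -
    have "V \<noteq> {}" using zero by blast
    moreover have "(INF x\<in>V. F x) < m + inverse (real (Suc n))" by (simp add: m_def)
    ultimately show ?thesis using cINF_less_iff[OF _ bdd] by blast
  qed
  then obtain x where xV: "\<And>n. x n \<in> V" and Fx: "\<And>n. F (x n) < m + inverse (real (Suc n))"
    by metis
  have parallelogram: "(norm (u - v))\<^sup>2 \<le> 2 * (F u - m) + 2 * (F v - m)" if uv: "u \<in> V" "v \<in> V" for u v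
  proof -
    define w where "w = (1/2) *\<^sub>R (u + v)"
    have wV: "w \<in> V" unfolding w_def by (intro scaleR(1) add uv)
    have lw: "Re (l w) = (Re (l u) + Re (l v)) / 2"
      unfolding w_def scaleR(2)[OF add[OF uv]] l_add[OF uv] by simp
    have nw: "(norm w)\<^sup>2 = (norm (u + v))\<^sup>2 / 4" by (simp add: w_def power_divide)
    have "(norm (u - v))\<^sup>2 = (norm u)\<^sup>2 - 2 * Re (cinner u v) + (norm v)\<^sup>2"
      using norm_add_square[of u "- v"] by (simp add: cinner_minus_right)
    also have "\<dots> = 2 * F u + 2 * F v - 4 * F w"
      by (simp add: F_def lw nw norm_add_square field_simps)
    finally show ?thesis using m_le[OF wV] by simp
  qed
  have "Cauchy x"
  proof (rule CauchyI)
    fix e :: real assume e: "e > 0"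
    obtain N where N: "inverse (real (Suc N)) < e\<^sup>2 / 4" using reals_Archimedean[of "e\<^sup>2 / 4"] e by auto
    have small: "F (x n) - m < e\<^sup>2 / 4" if "n \<ge> N" for n
    proof -
      have "inverse (real (Suc n)) \<le> inverse (real (Suc N))" using that by (intro le_imp_inverse_le) auto
      then show ?thesis using Fx[of n] N by linarith
    qed
    have "norm (x i - x j) < e" if "i \<ge> N" "j \<ge> N" for i j
    proof -
      have "(norm (x i - x j))\<^sup>2 < e\<^sup>2"
        using parallelogram[OF xV xV, of i j] small[OF that(1)] small[OF that(2)] by simp
      then show ?thesis using e by (intro power2_less_imp_less[of _ e]) auto
    qed
    then show "\<exists>N. \<forall>i\<ge>N. \<forall>j\<ge>N. norm (x i - x j) < e" by blast
  qed
  then obtain z where z: "x \<longlonglongrightarrow> z" using Cauchy_convergent_iff convergent_def by blast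
  have re: "Re (cinner z y) = Re (l y)" if y: "y \<in> V" for y
  proof -
    have "0 \<le> 2 * t * (Re (cinner z y) - Re (l y)) + t\<^sup>2 * (norm y)\<^sup>2" for t
    proof -
      have "- inverse (real (Suc n)) \<le> 2 * t * (Re (cinner (x n) y) - Re (l y)) + t\<^sup>2 * (norm y)\<^sup>2" for n
      proof -
        have "m \<le> F (x n + t *\<^sub>R y)" by (intro m_le add xV scaleR(1) y)
        also have "\<dots> = F (x n) + (2 * t * (Re (cinner (x n) y) - Re (l y)) + t\<^sup>2 * (norm y)\<^sup>2)"
          by (simp add: F_def norm_add_square cinner_scaleR_right l_add[OF xV scaleR(1)[OF y]]
              scaleR(2)[OF y] power_mult_distrib algebra_simps)
        finally show ?thesis using Fx[of n] by simp
      qed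
      moreover have "(\<lambda>n. - inverse (real (Suc n))) \<longlonglongrightarrow> - 0"
        by (intro tendsto_minus LIMSEQ_inverse_real_of_nat)
      moreover have "(\<lambda>n. 2 * t * (Re (cinner (x n) y) - Re (l y)) + t\<^sup>2 * (norm y)\<^sup>2) \<longlonglongrightarrow>
          2 * t * (Re (cinner z y) - Re (l y)) + t\<^sup>2 * (norm y)\<^sup>2"
        by (intro tendsto_intros bounded_linear.tendsto[OF bounded_linear_cinner_left z])
      ultimately show ?thesis using LIMSEQ_le by fastforce
    qed
    then have "Re (cinner z y) - Re (l y) = 0" by (rule linear_coeff_zero[rotated]) simp
    then show ?thesis by simp
  qed
  have "cinner y z = l y" if y: "y \<in> V" for y
  proof -
    have 1: "Re (cinner y z) = Re (l y)" using re[OF y] cinner_commute[of y z] by simp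
    have "Re (cinner (\<i> *\<^sub>C y) z) = Re (l (\<i> *\<^sub>C y))"
      using re[OF scale[OF y]] cinner_commute[of "\<i> *\<^sub>C y" z] by simp
    then have "Im (cinner y z) = Im (l y)" by (simp add: cinner_scaleC_left l_scale[OF y])
    with 1 show ?thesis by (simp add: complex_eq_iff)
  qed
  then show ?thesis by (rule that)
qed

lemma norm_le_of_cinner_le_dense:
  fixes v :: "'h::complex_hilbert"
  assumes dense: "closure V = UNIV" and K: "0 \<le> K"
    and le: "\<And>x. x \<in> V \<Longrightarrow> cmod (cinner v x) \<le> K * norm x"
  shows "norm v \<le> K"
proof -
  obtain x where x: "\<And>n. x n \<in> V" "x \<longlonglongrightarrow> v"
    using dense closure_sequential[of v V] by auto
  have "(\<lambda>n. cmod (cinner v (x n))) \<longlonglongrightarrow> cmod (cinner v v)"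
    by (intro tendsto_norm bounded_linear.tendsto[OF bounded_linear_cinner_right x(2)])
  moreover have "(\<lambda>n. K * norm (x n)) \<longlonglongrightarrow> K * norm v" by (intro tendsto_intros x(2))
  ultimately have "cmod (cinner v v) \<le> K * norm v" using le x(1) by (intro LIMSEQ_le) auto
  then have "norm v * norm v \<le> K * norm v" by (simp add: cinner_self power2_eq_square norm_mult)
  then show ?thesis using K by (cases "v = 0") auto
qed

locale spectral_data =
  fixes \<pi> :: "'a::unital_cstar_algebra \<Rightarrow> 'h::complex_hilbert \<Rightarrow> 'h" and V :: "'h set"
    and D :: "'h \<Rightarrow> 'h"
  assumes triple: "spectral_triple \<pi> V D"
begin

lemma rep: "representation \<pi>" and self_adjoint: "self_adjoint_operator V D"
  using triple by (simp_all add: spectral_triple_def)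

lemma rep_add: "\<pi> (a + b) \<xi> = \<pi> a \<xi> + \<pi> b \<xi>"
  and rep_scaleC: "\<pi> (c *\<^sub>C a) \<xi> = c *\<^sub>C \<pi> a \<xi>"
  and rep_mult: "\<pi> (a * b) \<xi> = \<pi> a (\<pi> b \<xi>)"
  and rep_one: "\<pi> 1 \<xi> = \<xi>"
  and rep_star: "cinner (\<pi> (star a) \<xi>) \<eta> = cinner \<xi> (\<pi> a \<eta>)"
  and rep_vec_add: "\<pi> a (\<xi> + \<eta>) = \<pi> a \<xi> + \<pi> a \<eta>"
  and rep_vec_scaleC: "\<pi> a (c *\<^sub>C \<xi>) = c *\<^sub>C \<pi> a \<xi>"
  using rep by (simp_all add: representation_def complex_linear_def)

lemma rep_scaleR: "\<pi> (r *\<^sub>R a) \<xi> = r *\<^sub>R \<pi> a \<xi>"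
  using rep_scaleC[of "complex_of_real r"] by (simp add: scaleC_of_real)

lemma rep_diff: "\<pi> (a - b) \<xi> = \<pi> a \<xi> - \<pi> b \<xi>"
  using rep_add[of a "- b" \<xi>] rep_scaleR[of "-1" b \<xi>] by simp

lemma rep_vec_minus: "\<pi> a (- \<xi>) = - \<pi> a \<xi>"
  using rep_vec_scaleC[of a "-1" \<xi>] by (simp add: scaleC_minus1)

lemma rep_vec_diff: "\<pi> a (\<xi> - \<eta>) = \<pi> a \<xi> - \<pi> a \<eta>"
  using rep_vec_add[of a \<xi> "- \<eta>"] by (simp add: rep_vec_minus)

lemma V_zero: "0 \<in> V"
  and V_add: "\<xi> \<in> V \<Longrightarrow> \<eta> \<in> V \<Longrightarrow> \<xi> + \<eta> \<in> V"
  and V_scaleC: "\<xi> \<in> V \<Longrightarrow> c *\<^sub>C \<xi> \<in> V"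
  and V_dense: "closure V = UNIV"
  and D_add: "\<xi> \<in> V \<Longrightarrow> \<eta> \<in> V \<Longrightarrow> D (\<xi> + \<eta>) = D \<xi> + D \<eta>"
  and D_scaleC: "\<xi> \<in> V \<Longrightarrow> D (c *\<^sub>C \<xi>) = c *\<^sub>C D \<xi>"
  using self_adjoint by (auto simp: self_adjoint_operator_def densely_defined_operator_def)

lemma D_symmetric: "\<xi> \<in> V \<Longrightarrow> \<eta> \<in> V \<Longrightarrow> cinner (D \<xi>) \<eta> = cinner \<xi> (D \<eta>)"
  using self_adjoint by (auto simp: self_adjoint_operator_def)

lemma mem_domain_adjoint:
  assumes "\<And>\<xi>. \<xi> \<in> V \<Longrightarrow> cinner (D \<xi>) \<eta> = cinner \<xi> \<zeta>" shows "\<eta> \<in> V"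
  using self_adjoint assms unfolding self_adjoint_operator_def by blast

text \<open>Representations are contractive: \<open>norm a ^ 2 - star a * a = star r * r\<close> for some \<open>r\<close>.\<close>

lemma rep_norm_le: "norm (\<pi> a \<xi>) \<le> norm a * norm \<xi>"
proof -
  have sa: "star (star a * a) = star a * a" by (simp add: star_mult star_star)
  have "cstar_pos ((norm a)\<^sup>2 *\<^sub>R 1 - star a * a)"
    by (rule cstar_pos_const_diff[OF sa]) (simp add: cstar_identity)
  then obtain r where r: "cstar_pos r" "r * r = (norm a)\<^sup>2 *\<^sub>R 1 - star a * a"
    using cstar_pos_sqrt by blast
  have "star r * r = (norm a)\<^sup>2 *\<^sub>R 1 - star a * a" using r(2) cstar_pos_hermitian[OF r(1)] by simp
  have sq: "cinner (\<pi> (star b * b) \<xi>) \<xi> = complex_of_real ((norm (\<pi> b \<xi>))\<^sup>2)" for b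
    by (simp add: rep_mult rep_star cinner_self)
  have "complex_of_real ((norm (\<pi> r \<xi>))\<^sup>2) = cinner (\<pi> ((norm a)\<^sup>2 *\<^sub>R 1 - star a * a) \<xi>) \<xi>"
    using sq[of r] \<open>star r * r = _\<close> by simp
  also have "\<dots> = complex_of_real ((norm a)\<^sup>2 * (norm \<xi>)\<^sup>2 - (norm (\<pi> a \<xi>))\<^sup>2)"
    unfolding rep_diff cinner_diff_left sq
    by (simp add: rep_scaleR rep_one cinner_scaleR_left cinner_self)
  finally have "(norm (\<pi> r \<xi>))\<^sup>2 = (norm a)\<^sup>2 * (norm \<xi>)\<^sup>2 - (norm (\<pi> a \<xi>))\<^sup>2"
    by (simp only: of_real_eq_iff)
  then have "(norm (\<pi> a \<xi>))\<^sup>2 \<le> (norm a * norm \<xi>)\<^sup>2"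
    using zero_le_power2[of "norm (\<pi> r \<xi>)"] by (simp add: power_mult_distrib)
  then show ?thesis by (rule power2_le_imp_le) simp
qed

abbreviation "Lip \<equiv> lipschitz_algebra \<pi> V D"
abbreviation "N \<equiv> spectral_seminorm \<pi> V D"

lemma Lip_domain: "a \<in> Lip \<Longrightarrow> \<xi> \<in> V \<Longrightarrow> \<pi> a \<xi> \<in> V"
  by (auto simp: lipschitz_algebra_def)

lemma LipI:
  assumes "\<And>\<xi>. \<xi> \<in> V \<Longrightarrow> \<pi> a \<xi> \<in> V" "\<And>\<xi>. \<xi> \<in> V \<Longrightarrow> norm (commutator D (\<pi> a) \<xi>) \<le> K * norm \<xi>"
  shows "a \<in> Lip"
  using assms by (auto simp: lipschitz_algebra_def)

lemma commutator_scaleC: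
  assumes "a \<in> Lip" "\<xi> \<in> V"
  shows "commutator D (\<pi> a) (c *\<^sub>C \<xi>) = c *\<^sub>C commutator D (\<pi> a) \<xi>"
  using assms by (simp add: commutator_def rep_vec_scaleC D_scaleC Lip_domain scaleC_diff_right)

lemma commutator_le:
  assumes a: "a \<in> Lip" and \<xi>: "\<xi> \<in> V"
  shows "norm (commutator D (\<pi> a) \<xi>) \<le> N a * norm \<xi>"
proof (cases "\<xi> = 0")
  case True
  then show ?thesis using commutator_scaleC[OF a \<xi>, of 0] norm_scaleC[of 0 "commutator D (\<pi> a) \<xi>"]
    by simp
next
  case False
  obtain K where K: "\<And>\<xi>. \<xi> \<in> V \<Longrightarrow> norm (commutator D (\<pi> a) \<xi>) \<le> K * norm \<xi>"
    using a by (auto simp: lipschitz_algebra_def)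
  have bdd: "bdd_above ((\<lambda>\<xi>. norm (commutator D (\<pi> a) \<xi>)) ` {\<xi>\<in>V. norm \<xi> \<le> 1})"
  proof (rule bdd_aboveI2)
    fix \<eta> assume \<eta>: "\<eta> \<in> {\<xi>\<in>V. norm \<xi> \<le> 1}"
    then have "norm (commutator D (\<pi> a) \<eta>) \<le> K * norm \<eta>" using K by simp
    also have "\<dots> \<le> \<bar>K\<bar> * 1" using \<eta> by (intro mult_mono) auto
    finally show "norm (commutator D (\<pi> a) \<eta>) \<le> \<bar>K\<bar>" by simp
  qed
  define c where "c = complex_of_real (1 / norm \<xi>)"
  have c: "cmod c = 1 / norm \<xi>" by (simp add: c_def norm_divide)
  have "norm (commutator D (\<pi> a) (c *\<^sub>C \<xi>)) \<le> N a"
    unfolding spectral_seminorm_def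
    by (rule cSUP_upper[OF _ bdd]) (use False \<xi> c in \<open>auto simp: V_scaleC norm_scaleC\<close>)
  then show ?thesis using False by (simp add: commutator_scaleC[OF a \<xi>] norm_scaleC c field_simps)
qed

lemma N_le:
  assumes "K \<ge> 0" "\<And>\<xi>. \<xi> \<in> V \<Longrightarrow> norm (commutator D (\<pi> a) \<xi>) \<le> K * norm \<xi>"
  shows "N a \<le> K"
  unfolding spectral_seminorm_def
proof (rule cSUP_least)
  show "{\<xi>\<in>V. norm \<xi> \<le> 1} \<noteq> {}" using V_zero by force
  fix \<xi> assume \<xi>: "\<xi> \<in> {\<xi>\<in>V. norm \<xi> \<le> 1}"
  then have "norm (commutator D (\<pi> a) \<xi>) \<le> K * norm \<xi>" using assms(2) by simp
  also have "\<dots> \<le> K * 1" using \<xi> assms(1) by (intro mult_left_mono) auto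
  finally show "norm (commutator D (\<pi> a) \<xi>) \<le> K" by simp
qed

lemma N_nonneg:
  assumes a: "a \<in> Lip" shows "0 \<le> N a"
proof (cases "\<exists>\<xi>\<in>V. \<xi> \<noteq> 0")
  case True
  then obtain \<xi> where \<xi>: "\<xi> \<in> V" "\<xi> \<noteq> 0" by blast
  have "0 \<le> N a * norm \<xi>" using commutator_le[OF a \<xi>(1)] norm_ge_zero order_trans by blast
  then show ?thesis using \<xi> by (simp add: zero_le_mult_iff)
next
  case False
  then have "{\<xi>\<in>V. norm \<xi> \<le> 1} = {0}" using V_zero by auto
  then show ?thesis by (simp add: spectral_seminorm_def)
qed

lemma commutator_add:
  assumes "a \<in> Lip" "b \<in> Lip" "\<xi> \<in> V"
  shows "commutator D (\<pi> (a + b)) \<xi> = commutator D (\<pi> a) \<xi> + commutator D (\<pi> b) \<xi>"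
  using assms by (simp add: commutator_def rep_add D_add Lip_domain)

lemma commutator_alg_scaleC:
  assumes "a \<in> Lip" "\<xi> \<in> V"
  shows "commutator D (\<pi> (c *\<^sub>C a)) \<xi> = c *\<^sub>C commutator D (\<pi> a) \<xi>"
  using assms by (simp add: commutator_def rep_scaleC D_scaleC Lip_domain scaleC_diff_right)

lemma commutator_mult:
  assumes "b \<in> Lip" "\<xi> \<in> V"
  shows "commutator D (\<pi> (a * b)) \<xi> = commutator D (\<pi> a) (\<pi> b \<xi>) + \<pi> a (commutator D (\<pi> b) \<xi>)"
  by (simp add: commutator_def rep_mult rep_vec_diff)

lemma cinner_commutator:
  assumes "\<pi> a \<xi> \<in> V" "\<eta> \<in> V"
  shows "cinner (commutator D (\<pi> a) \<xi>) \<eta> = cinner (\<pi> a \<xi>) (D \<eta>) - cinner (D \<xi>) (\<pi> (star a) \<eta>)"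
  using D_symmetric[OF assms] rep_star[of "star a" "D \<xi>" \<eta>]
  by (simp add: commutator_def cinner_diff_left star_star)

text \<open>The functional \<open>\<xi> \<mapsto> \<langle>D \<xi>, \<pi> (star a) \<eta>\<rangle>\<close> is bounded on \<open>V\<close> because the commutator with \<open>\<pi> a\<close> is, so
  \<open>\<pi> (star a) \<eta>\<close> lies in the domain of the adjoint of \<open>D\<close>, which is \<open>V\<close>.\<close>

lemma star_domain:
  assumes a: "a \<in> Lip" and \<eta>: "\<eta> \<in> V"
  shows "\<pi> (star a) \<eta> \<in> V"
proof -
  have "cmod (cinner (D \<xi>) (\<pi> (star a) \<eta>)) \<le> (norm a * norm (D \<eta>) + N a * norm \<eta>) * norm \<xi>"
    if \<xi>: "\<xi> \<in> V" for \<xi>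
  proof -
    have "cinner (D \<xi>) (\<pi> (star a) \<eta>) =
        cinner (\<pi> a \<xi>) (D \<eta>) - cinner (commutator D (\<pi> a) \<xi>) \<eta>"
      using cinner_commutator[OF Lip_domain[OF a \<xi>] \<eta>] by simp
    then have "cmod (cinner (D \<xi>) (\<pi> (star a) \<eta>)) \<le>
        cmod (cinner (\<pi> a \<xi>) (D \<eta>)) + cmod (cinner (commutator D (\<pi> a) \<xi>) \<eta>)"
      by (simp only: norm_triangle_ineq4)
    also have "\<dots> \<le> norm (\<pi> a \<xi>) * norm (D \<eta>) + norm (commutator D (\<pi> a) \<xi>) * norm \<eta>"
      by (intro add_mono norm_cinner_le)
    also have "\<dots> \<le> (norm a * norm \<xi>) * norm (D \<eta>) + (N a * norm \<xi>) * norm \<eta>"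
      by (intro add_mono mult_right_mono rep_norm_le commutator_le a \<xi> norm_ge_zero)
    finally show ?thesis by (simp add: algebra_simps)
  qed
  then obtain \<zeta> where "\<And>\<xi>. \<xi> \<in> V \<Longrightarrow> cinner \<xi> \<zeta> = cinner (D \<xi>) (\<pi> (star a) \<eta>)"
    using Riesz_representation_subspace[of V "\<lambda>\<xi>. cinner (D \<xi>) (\<pi> (star a) \<eta>)"
        "norm a * norm (D \<eta>) + N a * norm \<eta>"]
    by (auto simp: V_zero V_add V_scaleC D_add D_scaleC cinner_add_left cinner_scaleC_left)
  then show ?thesis by (intro mem_domain_adjoint[of _ \<zeta>]) simp
qed

lemma commutator_star_le:
  assumes a: "a \<in> Lip" and \<eta>: "\<eta> \<in> V"
  shows "norm (commutator D (\<pi> (star a)) \<eta>) \<le> N a * norm \<eta>"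
proof (rule norm_le_of_cinner_le_dense[OF V_dense])
  fix \<xi> assume \<xi>: "\<xi> \<in> V"
  have "cinner (commutator D (\<pi> (star a)) \<eta>) \<xi> =
      cinner (\<pi> (star a) \<eta>) (D \<xi>) - cinner (D \<eta>) (\<pi> a \<xi>)"
    using cinner_commutator[OF star_domain[OF a \<eta>] \<xi>] by (simp add: star_star)
  also have "\<dots> = cnj (- cinner (commutator D (\<pi> a) \<xi>) \<eta>)"
    unfolding cinner_commutator[OF Lip_domain[OF a \<xi>] \<eta>]
    using cinner_commute[of "\<pi> (star a) \<eta>" "D \<xi>"] cinner_commute[of "D \<eta>" "\<pi> a \<xi>"] by simp
  finally have "cmod (cinner (commutator D (\<pi> (star a)) \<eta>) \<xi>) = cmod (cinner (commutator D (\<pi> a) \<xi>) \<eta>)"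
    by (simp only: complex_mod_cnj norm_minus_cancel)
  also have "\<dots> \<le> norm (commutator D (\<pi> a) \<xi>) * norm \<eta>" by (rule norm_cinner_le)
  also have "\<dots> \<le> (N a * norm \<xi>) * norm \<eta>"
    by (intro mult_right_mono commutator_le a \<xi> norm_ge_zero)
  finally show "cmod (cinner (commutator D (\<pi> (star a)) \<eta>) \<xi>) \<le> N a * norm \<eta> * norm \<xi>"
    by (simp add: mult_ac)
qed (use N_nonneg[OF a] in simp)

lemma Lip_add: assumes "a \<in> Lip" "b \<in> Lip" shows "a + b \<in> Lip" "N (a + b) \<le> N a + N b"
proof -
  have le: "norm (commutator D (\<pi> (a + b)) \<xi>) \<le> (N a + N b) * norm \<xi>" if "\<xi> \<in> V" for \<xi>
    using norm_triangle_ineq[of "commutator D (\<pi> a) \<xi>" "commutator D (\<pi> b) \<xi>"]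
      commutator_le[OF assms(1) that] commutator_le[OF assms(2) that]
    by (simp add: commutator_add assms that distrib_right)
  show "a + b \<in> Lip" by (rule LipI[OF _ le]) (simp_all add: rep_add V_add Lip_domain assms)
  show "N (a + b) \<le> N a + N b" by (rule N_le[OF _ le]) (simp add: N_nonneg assms)
qed

lemma Lip_scaleC: assumes "a \<in> Lip" shows "c *\<^sub>C a \<in> Lip" "N (c *\<^sub>C a) \<le> cmod c * N a"
proof -
  have le: "norm (commutator D (\<pi> (c *\<^sub>C a)) \<xi>) \<le> (cmod c * N a) * norm \<xi>" if "\<xi> \<in> V" for \<xi>
    using mult_left_mono[OF commutator_le[OF assms that], of "cmod c"]
    by (simp add: commutator_alg_scaleC assms that norm_scaleC mult.assoc)
  show "c *\<^sub>C a \<in> Lip" by (rule LipI[OF _ le]) (simp_all add: rep_scaleC V_scaleC Lip_domain assms)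
  show "N (c *\<^sub>C a) \<le> cmod c * N a" by (rule N_le[OF _ le]) (simp add: N_nonneg assms)
qed

lemma Lip_mult: assumes "a \<in> Lip" "b \<in> Lip" shows "a * b \<in> Lip"
proof (rule LipI)
  show "\<pi> (a * b) \<xi> \<in> V" if "\<xi> \<in> V" for \<xi> using that assms by (simp add: rep_mult Lip_domain)
  show "norm (commutator D (\<pi> (a * b)) \<xi>) \<le> (N a * norm b + norm a * N b) * norm \<xi>"
    if \<xi>: "\<xi> \<in> V" for \<xi>
  proof -
    have "norm (commutator D (\<pi> (a * b)) \<xi>) \<le>
        norm (commutator D (\<pi> a) (\<pi> b \<xi>)) + norm (\<pi> a (commutator D (\<pi> b) \<xi>))"
      unfolding commutator_mult[OF assms(2) \<xi>] by (rule norm_triangle_ineq)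
    also have "\<dots> \<le> N a * norm (\<pi> b \<xi>) + norm a * norm (commutator D (\<pi> b) \<xi>)"
      by (intro add_mono commutator_le rep_norm_le assms Lip_domain \<xi>)
    also have "\<dots> \<le> N a * (norm b * norm \<xi>) + norm a * (N b * norm \<xi>)"
      by (intro add_mono mult_left_mono rep_norm_le commutator_le assms \<xi> N_nonneg norm_ge_zero)
    finally show ?thesis by (simp add: algebra_simps)
  qed
qed

lemma Lip_star: assumes "a \<in> Lip" shows "star a \<in> Lip" "N (star a) \<le> N a"
proof -
  show "star a \<in> Lip"
    by (rule LipI[OF star_domain[OF assms] commutator_star_le[OF assms]])
  show "N (star a) \<le> N a"
    by (rule N_le[OF N_nonneg[OF assms] commutator_star_le[OF assms]])
qed

lemma Lip_const: "1 \<in> Lip" "N 1 = 0"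
proof -
  have le: "norm (commutator D (\<pi> 1) \<xi>) \<le> 0 * norm \<xi>" for \<xi>
    by (simp add: commutator_def rep_one)
  show one: "1 \<in> Lip" by (rule LipI[OF _ le]) (simp add: rep_one)
  show "N 1 = 0" using N_le[OF order_refl le] N_nonneg[OF one] by simp
qed

lemma dense_unital_star_subalgebra_Lip: "dense_unital_star_subalgebra Lip"
proof -
  have "0 \<in> Lip" using Lip_scaleC(1)[OF Lip_const(1), of 0] scaleC_of_real[of 0 "1::'a"] by simp
  moreover obtain B where "dense_star_subalgebra B" "B \<subseteq> Lip"
    using triple by (auto simp: spectral_triple_def)
  then have "closure Lip = UNIV" using closure_mono[of B Lip] by (auto simp: dense_star_subalgebra_def)
  ultimately show ?thesis
    by (simp add: dense_unital_star_subalgebra_def dense_star_subalgebra_def star_subalgebra_def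
        Lip_add Lip_scaleC Lip_mult Lip_star Lip_const)
qed

lemma lipschitz_seminorm_N: "lipschitz_seminorm Lip N"
  unfolding lipschitz_seminorm_def
proof (intro conjI ballI allI)
  fix c a assume a: "a \<in> Lip"
  show "N (c *\<^sub>C a) = cmod c * N a"
  proof (cases "c = 0")
    case True
    then show ?thesis using Lip_scaleC[OF a, of 0] N_nonneg[OF Lip_scaleC(1)[OF a, of 0]] by simp
  next
    case False
    have "N ((1/c) *\<^sub>C (c *\<^sub>C a)) \<le> cmod (1/c) * N (c *\<^sub>C a)" by (intro Lip_scaleC a)
    then have "cmod c * N a \<le> N (c *\<^sub>C a)" using False by (simp add: scaleC_scaleC norm_divide field_simps)
    then show ?thesis using Lip_scaleC(2)[OF a, of c] by simp
  qed
qed (use N_nonneg Lip_add Lip_const in auto)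

lemma star_invariant_N: "star_invariant_seminorm Lip N"
  unfolding star_invariant_seminorm_def
proof
  fix a assume a: "a \<in> Lip"
  show "N (star a) = N a"
    using Lip_star(2)[OF a] Lip_star(2)[OF Lip_star(1)[OF a]] by (simp add: star_star)
qed

lemma tendsto_rep:
  assumes "\<sigma> \<longlonglongrightarrow> a" shows "(\<lambda>n. \<pi> (\<sigma> n) \<xi>) \<longlonglongrightarrow> \<pi> a \<xi>"
proof -
  have "bounded_linear (\<lambda>a. \<pi> a \<xi>)"
    by (rule bounded_linear_intro[of _ "norm \<xi>"]) (simp_all add: rep_add rep_scaleR rep_norm_le)
  then show ?thesis using assms by (rule bounded_linear.tendsto)
qed

text \<open>The matrix coefficients of \<open>[D, \<pi> a]\<close> between vectors of the domain depend continuously on \<open>a\<close>.\<close>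

lemma lsc_N: "lsc_seminorm Lip N"
proof -
  have lim: "a \<in> {a\<in>Lip. N a \<le> 1}" if \<sigma>: "\<And>n. \<sigma> n \<in> {a\<in>Lip. N a \<le> 1}" "\<sigma> \<longlonglongrightarrow> a" and a: "a \<in> Lip" for \<sigma> a
  proof -
    have "norm (commutator D (\<pi> a) \<xi>) \<le> 1 * norm \<xi>" if \<xi>: "\<xi> \<in> V" for \<xi>
    proof (rule norm_le_of_cinner_le_dense[OF V_dense])
      fix \<eta> assume \<eta>: "\<eta> \<in> V"
      have star_lim: "(\<lambda>n. star (\<sigma> n)) \<longlonglongrightarrow> star a"
        by (rule bounded_linear.tendsto[OF bounded_linear_star \<sigma>(2)])
      have eq: "cinner (commutator D (\<pi> b) \<xi>) \<eta> = cinner (\<pi> b \<xi>) (D \<eta>) - cinner (D \<xi>) (\<pi> (star b) \<eta>)"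
        if "b \<in> Lip" for b by (rule cinner_commutator[OF Lip_domain[OF that \<xi>] \<eta>])
      have "(\<lambda>n. cinner (commutator D (\<pi> (\<sigma> n)) \<xi>) \<eta>) \<longlonglongrightarrow> cinner (commutator D (\<pi> a) \<xi>) \<eta>"
        using \<sigma>(1) a
        by (simp add: eq) (intro tendsto_diff bounded_linear.tendsto[OF bounded_linear_cinner_left]
            bounded_linear.tendsto[OF bounded_linear_cinner_right] tendsto_rep \<sigma>(2) star_lim)
      then have "(\<lambda>n. cmod (cinner (commutator D (\<pi> (\<sigma> n)) \<xi>) \<eta>)) \<longlonglongrightarrow>
          cmod (cinner (commutator D (\<pi> a) \<xi>) \<eta>)" by (rule tendsto_norm)
      moreover have "cmod (cinner (commutator D (\<pi> (\<sigma> n)) \<xi>) \<eta>) \<le> 1 * norm \<xi> * norm \<eta>" for n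
      proof -
        have "norm (commutator D (\<pi> (\<sigma> n)) \<xi>) \<le> N (\<sigma> n) * norm \<xi>" using commutator_le \<sigma>(1) \<xi> by simp
        also have "\<dots> \<le> 1 * norm \<xi>" using \<sigma>(1) by (intro mult_right_mono) auto
        finally have "norm (commutator D (\<pi> (\<sigma> n)) \<xi>) * norm \<eta> \<le> 1 * norm \<xi> * norm \<eta>"
          by (rule mult_right_mono) simp
        then show ?thesis using norm_cinner_le order_trans by blast
      qed
      ultimately show "cmod (cinner (commutator D (\<pi> a) \<xi>) \<eta>) \<le> 1 * norm \<xi> * norm \<eta>"
        by (intro LIMSEQ_le_const2) auto
    qed simp
    then show ?thesis using a N_le[of 1 a] by simp
  qed
  then have "{a\<in>Lip. N a \<le> 1} = Lip \<inter> closure {a\<in>Lip. N a \<le> 1}"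
  proof (intro equalityI subsetI)
    fix a assume a: "a \<in> Lip \<inter> closure {a\<in>Lip. N a \<le> 1}"
    then have "a \<in> closure {a\<in>Lip. N a \<le> 1}" by (rule IntD2)
    then obtain \<sigma> where "\<forall>n. \<sigma> n \<in> {a\<in>Lip. N a \<le> 1}" "\<sigma> \<longlonglongrightarrow> a"
      unfolding closure_sequential by blast
    then show "a \<in> {a\<in>Lip. N a \<le> 1}" using lim[of \<sigma> a] a by blast
  next
    fix a assume "a \<in> {a\<in>Lip. N a \<le> 1}"
    then show "a \<in> Lip \<inter> closure {a\<in>Lip. N a \<le> 1}"
      using subsetD[OF closure_subset, of a "{a\<in>Lip. N a \<le> 1}"] by simp
  qed
  then have "closedin (top_of_set Lip) {a\<in>Lip. N a \<le> 1}"
    unfolding closedin_closed using closed_closure by blast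
  then show ?thesis unfolding lsc_seminorm_def by (intro exI[of _ 1]) simp
qed

end

section \<open>Equivalence of the isometry conditions\<close>

theorem proposition2p6:
  fixes \<Gamma> :: "('g, 'm) monoid_scheme"
    and \<alpha> :: "'g \<Rightarrow> 'a::unital_cstar_algebra \<Rightarrow> 'a"
    and \<A> :: "'a set" and L :: "'a \<Rightarrow> real"
    and \<pi> :: "'a \<Rightarrow> 'h::complex_hilbert \<Rightarrow> 'h" and V :: "'h set" and D :: "'h \<Rightarrow> 'h"
  assumes "separable_space (euclidean :: 'a topology)"
    and "group \<Gamma>" and "cstar_action \<Gamma> \<alpha>"
  shows "(dense_unital_star_subalgebra \<A> \<and> lipschitz_seminorm \<A> L \<and> lsc_seminorm \<A> L \<and>
          compact_quantum_metric_space \<A> L \<and> smooth_action \<Gamma> \<alpha> \<A> \<longrightarrow>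
            (has_equivalent_isometric_seminorm \<Gamma> \<alpha> \<A> L \<longrightarrow>
               has_equivalent_invariant_metric \<Gamma> \<alpha> \<A> L) \<and>
            (star_invariant_seminorm \<A> L \<longrightarrow>
               has_equivalent_invariant_metric \<Gamma> \<alpha> \<A> L \<longrightarrow>
               metrically_equicontinuous \<Gamma> \<alpha> \<A> L) \<and>
            (closed_seminorm \<A> L \<longrightarrow>
               metrically_equicontinuous \<Gamma> \<alpha> \<A> L \<longrightarrow>
               has_equivalent_isometric_seminorm \<Gamma> \<alpha> \<A> L)) \<and>
         (spectral_triple \<pi> V D \<longrightarrow>
            dense_unital_star_subalgebra (lipschitz_algebra \<pi> V D) \<and>
            lipschitz_seminorm (lipschitz_algebra \<pi> V D) (spectral_seminorm \<pi> V D) \<and>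
            lsc_seminorm (lipschitz_algebra \<pi> V D) (spectral_seminorm \<pi> V D) \<and>
            star_invariant_seminorm (lipschitz_algebra \<pi> V D) (spectral_seminorm \<pi> V D))"
proof (intro conjI impI)
  assume A: "dense_unital_star_subalgebra \<A> \<and> lipschitz_seminorm \<A> L \<and> lsc_seminorm \<A> L \<and>
      compact_quantum_metric_space \<A> L \<and> smooth_action \<Gamma> \<alpha> \<A>"
  then interpret lipschitz_space \<A> L by unfold_locales simp_all
  show "has_equivalent_invariant_metric \<Gamma> \<alpha> \<A> L" if "has_equivalent_isometric_seminorm \<Gamma> \<alpha> \<A> L"
    using invariant_metric_of_isometric_seminorm[OF \<open>group \<Gamma>\<close> _ that] A by blast
  show "metrically_equicontinuous \<Gamma> \<alpha> \<A> L"
    if "star_invariant_seminorm \<A> L" "has_equivalent_invariant_metric \<Gamma> \<alpha> \<A> L"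
    using metrically_equicontinuous_of_invariant_metric[OF \<open>group \<Gamma>\<close> \<open>cstar_action \<Gamma> \<alpha>\<close> _ _ _ that] A
    by blast
  show "has_equivalent_isometric_seminorm \<Gamma> \<alpha> \<A> L"
    if "closed_seminorm \<A> L" "metrically_equicontinuous \<Gamma> \<alpha> \<A> L"
    using isometric_seminorm_of_metrically_equicontinuous[OF \<open>group \<Gamma>\<close> \<open>cstar_action \<Gamma> \<alpha>\<close> _ that] A
    by blast
next
  assume "spectral_triple \<pi> V D"
  then interpret spectral_data \<pi> V D by unfold_locales
  show "dense_unital_star_subalgebra (lipschitz_algebra \<pi> V D)"
    by (rule dense_unital_star_subalgebra_Lip)
  show "lipschitz_seminorm (lipschitz_algebra \<pi> V D) (spectral_seminorm \<pi> V D)"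
    by (rule lipschitz_seminorm_N)
  show "lsc_seminorm (lipschitz_algebra \<pi> V D) (spectral_seminorm \<pi> V D)" by (rule lsc_N)
  show "star_invariant_seminorm (lipschitz_algebra \<pi> V D) (spectral_seminorm \<pi> V D)"
    by (rule star_invariant_N)
qed


end
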